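(* Let $p \in (1,\infty)\setminus\{2\}$ and let $A$ be an approximately unital $L^p$-operator algebra. Then $A$ is scaled if and only if $A$ is $M$-approximately unital.
   Context: An $L^p$-operator algebra is a (complex) Banach algebra isometrically isomorphic to a norm closed subalgebra of $B(L^p(X,\mu))$ for some measure space $(X,\mu)$. A unital Banach algebra is one with an identity of norm $1$. A cai is a contractive approximate identity (a net $(e_t)$ with $\|e_t\|\le1$, $e_ta\to a$, $ae_t\to a$ for all $a$). Approximately unital means having a cai. Multiplier unitization: for a nonunital approximately unital Banach algebra $A$, $A^1 = A + \mathbb{C}1$ with norm $\|a+\lambda 1\| = \sup\{\|ac+\lambda c\| : c \in A, \|c\|\le 1\}$; if $A$ is unital, $A^1 = A$. A state on a unital Banach algebra is a linear functional $\omega$ with $\|\omega\| = \omega(1)=1$. A state on an approximately unital Banach algebra $A$ is a functional of norm $1$ on $A$ which is the restriction to $A$ of a state on $A^1$. The quasistate space is $Q(A) = \{\lambda\varphi : \lambda\in[0,1],\ \varphi \text{ a state on } A\}$. A nonunital approximately unital Banach algebra $A$ is scaled if the set of restrictions to $A$ of states on $A^1$ equals $Q(A)$; all unital Banach algebras are (regarded as) scaled. (Equivalently, in all cases: every $\varphi\in A^*$ with $\mathrm{Re}\,\varphi(a)\ge 0$ for all $a \in A$ that are real positive in $A^1$, i.e. with $\mathrm{Re}\,\omega(a)\ge0$ for all states $\omega$ of $A^1$, is a nonnegative multiple of a state on $A$.) An idempotent $P\in B(E)$ on a Banach space $E$ is an $L$-projection if $\|\xi\| = \|P\xi\| + \|(1-P)\xi\|$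 for all $\xi$; ranges of $L$-projections are $L$-summands. A closed subspace $J\subseteq E$ is an $M$-ideal if $J^\perp$ is an $L$-summand in $E^*$. An approximately unital Banach algebra $A$ is $M$-approximately unital if $A$ is an $M$-ideal in $A^1$. *)

theory Defs
  imports "HOL-Analysis.Analysis" "HOL-Library.Function_Algebras"
begin

class scaleC =
  fixes scaleC :: "complex \<Rightarrow> 'a \<Rightarrow> 'a"  (infixr \<open>*\<^sub>C\<close> 75)

class complex_vector = scaleC + ab_group_add +
  assumes scaleC_add_right: "c *\<^sub>C (x + y) = c *\<^sub>C x + c *\<^sub>C y"
    and scaleC_add_left: "(c + d) *\<^sub>C x = c *\<^sub>C x + d *\<^sub>C x"
    and scaleC_scaleC: "c *\<^sub>C d *\<^sub>C x = (c * d) *\<^sub>C x"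
    and scaleC_one: "1 *\<^sub>C x = x"

text \<open>No unit is required, and the zero algebra is an instance.\<close>

class complex_banach_algebra = complex_vector + real_normed_algebra + banach +
  assumes scaleR_eq_scaleC: "r *\<^sub>R x = complex_of_real r *\<^sub>C x"
    and norm_scaleC: "norm (c *\<^sub>C x) = cmod c * norm x"
    and mult_scaleC_left: "(c *\<^sub>C x) * y = c *\<^sub>C (x * y)"
    and mult_scaleC_right: "x * (c *\<^sub>C y) = c *\<^sub>C (x * y)"

instantiation complex :: complex_vector
begin
definition scaleC_complex :: "complex \<Rightarrow> complex \<Rightarrow> complex"
  where "scaleC_complex c x = c * x"
instance
  by standard (simp_all add: scaleC_complex_def algebra_simps)
end

instantiation prod :: (complex_vector, complex_vector) complex_vector
begin
definition scaleC_prod :: "complex \<Rightarrow> 'a \<times> 'b \<Rightarrow> 'a \<times> 'b"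
  where "scaleC_prod c x = (c *\<^sub>C fst x, c *\<^sub>C snd x)"
instance
  by standard
    (simp_all add: scaleC_prod_def scaleC_add_right scaleC_add_left scaleC_scaleC scaleC_one)
end

instantiation "fun" :: (type, complex_vector) complex_vector
begin
definition scaleC_fun :: "complex \<Rightarrow> ('a \<Rightarrow> 'b) \<Rightarrow> 'a \<Rightarrow> 'b"
  where "scaleC_fun c f = (\<lambda>x. c *\<^sub>C f x)"
instance
  by standard
    (simp_all add: scaleC_fun_def fun_eq_iff scaleC_add_right scaleC_add_left scaleC_scaleC scaleC_one)
end

text \<open>
  A normed space is given by a subspace \<open>E\<close> of a complex vector space together with a function
  \<open>N\<close> whose values on \<open>E\<close> are the norms. A carrier is needed because the multiplier unitization
  and dual spaces are not whole types.
\<close>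

definition csubspace :: "'v::complex_vector set \<Rightarrow> bool" where
  "csubspace E \<longleftrightarrow> 0 \<in> E \<and> (\<forall>x\<in>E. \<forall>y\<in>E. x + y \<in> E) \<and> (\<forall>c. \<forall>x\<in>E. c *\<^sub>C x \<in> E)"

definition clinear_on :: "'v::complex_vector set \<Rightarrow> ('v \<Rightarrow> 'w::complex_vector) \<Rightarrow> bool" where
  "clinear_on E T \<longleftrightarrow>
     (\<forall>x\<in>E. \<forall>y\<in>E. T (x + y) = T x + T y) \<and> (\<forall>c. \<forall>x\<in>E. T (c *\<^sub>C x) = c *\<^sub>C T x)"

definition bounded_operator_on ::
    "'v::complex_vector set \<Rightarrow> ('v \<Rightarrow> real) \<Rightarrow> ('v \<Rightarrow> 'v) \<Rightarrow> bool" where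
  "bounded_operator_on E N T \<longleftrightarrow>
     clinear_on E T \<and> T ` E \<subseteq> E \<and> (\<exists>K. \<forall>x\<in>E. N (T x) \<le> K * N x)"

text \<open>
  Functionals on \<open>E\<close> are extended by \<open>0\<close> outside \<open>E\<close>, so that equal functionals are equal
  functions.
\<close>

definition dual :: "'v::complex_vector set \<Rightarrow> ('v \<Rightarrow> real) \<Rightarrow> ('v \<Rightarrow> complex) set" where
  "dual E N = {\<phi>. clinear_on E \<phi> \<and> (\<exists>K. \<forall>x\<in>E. cmod (\<phi> x) \<le> K * N x) \<and> (\<forall>x. x \<notin> E \<longrightarrow> \<phi> x = 0)}"

definition dual_norm :: "'v::complex_vector set \<Rightarrow> ('v \<Rightarrow> real) \<Rightarrow> ('v \<Rightarrow> complex) \<Rightarrow> real" where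
  "dual_norm E N \<phi> = Sup {cmod (\<phi> x) | x. x \<in> E \<and> N x \<le> 1}"

definition annihilator ::
    "'v::complex_vector set \<Rightarrow> ('v \<Rightarrow> real) \<Rightarrow> 'v set \<Rightarrow> ('v \<Rightarrow> complex) set" where
  "annihilator E N J = {\<phi> \<in> dual E N. \<forall>x\<in>J. \<phi> x = 0}"

definition L_projection ::
    "'v::complex_vector set \<Rightarrow> ('v \<Rightarrow> real) \<Rightarrow> ('v \<Rightarrow> 'v) \<Rightarrow> bool" where
  "L_projection E N P \<longleftrightarrow>
     bounded_operator_on E N P \<and> (\<forall>\<xi>\<in>E. P (P \<xi>) = P \<xi>) \<and>
     (\<forall>\<xi>\<in>E. N \<xi> = N (P \<xi>) + N (\<xi> - P \<xi>))"

definition L_summand :: "'v::complex_vector set \<Rightarrow> ('v \<Rightarrow> real) \<Rightarrow> 'v set \<Rightarrow> bool" where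
  "L_summand E N S \<longleftrightarrow> (\<exists>P. L_projection E N P \<and> S = P ` E)"

text \<open>
  Points at \<open>N\<close>-distance \<open>0\<close> are identified in the conclusion. If \<open>N\<close> is a norm on \<open>E\<close> this is
  the usual closedness of \<open>J\<close>; the only degenerate case arising below is the zero algebra, where
  the multiplier formula gives just a seminorm on the unitization.
\<close>

definition norm_closed_in :: "'v::complex_vector set \<Rightarrow> ('v \<Rightarrow> real) \<Rightarrow> 'v set \<Rightarrow> bool" where
  "norm_closed_in E N J \<longleftrightarrow>
     (\<forall>x\<in>E. (\<forall>\<epsilon>>0. \<exists>y\<in>J. N (x - y) < \<epsilon>) \<longrightarrow> (\<exists>y\<in>J. N (x - y) = 0))"

definition M_ideal :: "'v::complex_vector set \<Rightarrow> ('v \<Rightarrow> real) \<Rightarrow> 'v set \<Rightarrow> bool" where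
  "M_ideal E N J \<longleftrightarrow>
     J \<subseteq> E \<and> csubspace J \<and> norm_closed_in E N J \<and>
     L_summand (dual E N) (dual_norm E N) (annihilator E N J)"

definition is_unit_elem :: "'a::complex_banach_algebra \<Rightarrow> bool" where
  "is_unit_elem u \<longleftrightarrow> norm u = 1 \<and> (\<forall>a. u * a = a \<and> a * u = a)"

definition unital :: "'a::complex_banach_algebra itself \<Rightarrow> bool" where
  "unital (_ :: 'a itself) \<longleftrightarrow> (\<exists>u::'a. is_unit_elem u)"

text \<open>
  Nets in the algebra are represented by filters: a net gives the filter generated by its tails,
  and every proper filter is the tail filter of a net.
\<close>

definition contractive_approximate_identity :: "'a::complex_banach_algebra filter \<Rightarrow> bool" where
  "contractive_approximate_identity F \<longleftrightarrow>
     F \<noteq> bot \<and> (\<forall>\<^sub>F e in F. norm e \<le> 1) \<and>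
     (\<forall>a. ((\<lambda>e. e * a) \<longlongrightarrow> a) F \<and> ((\<lambda>e. a * e) \<longlongrightarrow> a) F)"

definition approximately_unital :: "'a::complex_banach_algebra itself \<Rightarrow> bool" where
  "approximately_unital (_ :: 'a itself) \<longleftrightarrow>
     (\<exists>F :: 'a filter. contractive_approximate_identity F)"

text \<open>
  The pair \<open>(a, \<lambda>)\<close> stands for \<open>a + \<lambda>1\<close>. For a unital algebra the unitization is the algebra
  itself, embedded as the pairs \<open>(a, 0)\<close>. In both cases \<open>range (\<lambda>a. (a, 0))\<close> is the copy of the
  algebra inside its unitization.
\<close>

definition unitization :: "('a::complex_banach_algebra \<times> complex) set" where
  "unitization = (if unital TYPE('a) then UNIV \<times> {0} else UNIV)"

definition unitization_norm :: "'a::complex_banach_algebra \<times> complex \<Rightarrow> real" where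
  "unitization_norm x =
     (if unital TYPE('a) then norm (fst x)
      else Sup {norm (fst x * c + snd x *\<^sub>C c) | c. norm c \<le> 1})"

definition unitization_one :: "'a::complex_banach_algebra \<times> complex" where
  "unitization_one = (if unital TYPE('a) then (THE u. is_unit_elem u, 0) else (0, 1))"

definition M_approximately_unital :: "'a::complex_banach_algebra itself \<Rightarrow> bool" where
  "M_approximately_unital (_ :: 'a itself) \<longleftrightarrow>
     approximately_unital TYPE('a) \<and>
     M_ideal (unitization :: ('a \<times> complex) set) unitization_norm (range (\<lambda>a. (a, 0)))"

definition unitization_states :: "('a::complex_banach_algebra \<times> complex \<Rightarrow> complex) set" where
  "unitization_states =
     {\<omega> \<in> dual unitization unitization_norm.
        dual_norm unitization unitization_norm \<omega> = 1 \<and> \<omega> unitization_one = 1}"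

definition restricted_states :: "('a::complex_banach_algebra \<Rightarrow> complex) set" where
  "restricted_states = (\<lambda>\<omega> a. \<omega> (a, 0)) ` unitization_states"

definition states :: "('a::complex_banach_algebra \<Rightarrow> complex) set" where
  "states = {\<phi> \<in> restricted_states. dual_norm UNIV norm \<phi> = 1}"

definition quasistates :: "('a::complex_banach_algebra \<Rightarrow> complex) set" where
  "quasistates = {complex_of_real t *\<^sub>C \<phi> | t \<phi>. 0 \<le> t \<and> t \<le> 1 \<and> \<phi> \<in> states}"

definition scaled :: "'a::complex_banach_algebra itself \<Rightarrow> bool" where
  "scaled (_ :: 'a itself) \<longleftrightarrow>
     unital TYPE('a) \<or> (restricted_states :: ('a \<Rightarrow> complex) set) = quasistates"

text \<open>
  Elements of \<open>L\<^sup>p(M)\<close> are represented by \<open>p\<close>-integrable functions, and equality in \<open>L\<^sup>p(M)\<close> is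
  equality almost everywhere. Accordingly an operator on \<open>L\<^sup>p(M)\<close> is represented by a map of
  functions that respects equality almost everywhere and is linear up to it, and two such maps
  are the same operator iff \<open>Lp_op_eq\<close> holds.
\<close>

definition Lp_space :: "real \<Rightarrow> 'b measure \<Rightarrow> ('b \<Rightarrow> complex) set" where
  "Lp_space p M = {f \<in> borel_measurable M. integrable M (\<lambda>x. cmod (f x) powr p)}"

definition Lp_norm :: "real \<Rightarrow> 'b measure \<Rightarrow> ('b \<Rightarrow> complex) \<Rightarrow> real" where
  "Lp_norm p M f = (\<integral>x. cmod (f x) powr p \<partial>M) powr (1 / p)"

type_synonym 'b fun_op = "('b \<Rightarrow> complex) \<Rightarrow> ('b \<Rightarrow> complex)"

definition Lp_operators :: "real \<Rightarrow> 'b measure \<Rightarrow> 'b fun_op set" where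
  "Lp_operators p M =
     {T. (\<forall>f\<in>Lp_space p M. T f \<in> Lp_space p M) \<and>
         (\<forall>f\<in>Lp_space p M. \<forall>g\<in>Lp_space p M.
            (AE x in M. f x = g x) \<longrightarrow> (AE x in M. T f x = T g x)) \<and>
         (\<forall>f\<in>Lp_space p M. \<forall>g\<in>Lp_space p M. AE x in M. T (f + g) x = T f x + T g x) \<and>
         (\<forall>c. \<forall>f\<in>Lp_space p M. AE x in M. T (c *\<^sub>C f) x = c * T f x) \<and>
         (\<exists>K. \<forall>f\<in>Lp_space p M. Lp_norm p M (T f) \<le> K * Lp_norm p M f)}"

definition Lp_op_eq :: "real \<Rightarrow> 'b measure \<Rightarrow> 'b fun_op \<Rightarrow> 'b fun_op \<Rightarrow> bool" where
  "Lp_op_eq p M S T \<longleftrightarrow> (\<forall>f\<in>Lp_space p M. AE x in M. S f x = T f x)"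

definition Lp_op_norm :: "real \<Rightarrow> 'b measure \<Rightarrow> 'b fun_op \<Rightarrow> real" where
  "Lp_op_norm p M T = Sup {Lp_norm p M (T f) | f. f \<in> Lp_space p M \<and> Lp_norm p M f \<le> 1}"

definition Lp_closed_subalgebra :: "real \<Rightarrow> 'b measure \<Rightarrow> 'b fun_op set \<Rightarrow> bool" where
  "Lp_closed_subalgebra p M B \<longleftrightarrow>
     B \<subseteq> Lp_operators p M \<and>
     (\<forall>S\<in>B. \<forall>T\<in>Lp_operators p M. Lp_op_eq p M S T \<longrightarrow> T \<in> B) \<and>
     csubspace B \<and>
     (\<forall>S\<in>B. \<forall>T\<in>B. S \<circ> T \<in> B) \<and>
     (\<forall>S T. (\<forall>n::nat. S n \<in> B) \<and> T \<in> Lp_operators p M \<and>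
            (\<lambda>n. Lp_op_norm p M (S n - T)) \<longlonglongrightarrow> 0 \<longrightarrow> T \<in> B)"

definition isometric_isomorphism_onto ::
    "real \<Rightarrow> 'b measure \<Rightarrow> 'b fun_op set \<Rightarrow> ('a::complex_banach_algebra \<Rightarrow> 'b fun_op) \<Rightarrow> bool" where
  "isometric_isomorphism_onto p M B \<pi> \<longleftrightarrow>
     (\<forall>a. \<pi> a \<in> B) \<and>
     (\<forall>T\<in>B. \<exists>a. Lp_op_eq p M (\<pi> a) T) \<and>
     (\<forall>a b. Lp_op_eq p M (\<pi> (a + b)) (\<pi> a + \<pi> b)) \<and>
     (\<forall>c a. Lp_op_eq p M (\<pi> (c *\<^sub>C a)) (c *\<^sub>C \<pi> a)) \<and>
     (\<forall>a b. Lp_op_eq p M (\<pi> (a * b)) (\<pi> a \<circ> \<pi> b)) \<and>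
     (\<forall>a. Lp_op_norm p M (\<pi> a) = norm a)"

definition Lp_operator_algebra_over ::
    "real \<Rightarrow> 'b measure \<Rightarrow> 'a::complex_banach_algebra itself \<Rightarrow> bool" where
  "Lp_operator_algebra_over p M (_ :: 'a itself) \<longleftrightarrow>
     (\<exists>B. \<exists>\<pi> :: 'a \<Rightarrow> 'b fun_op. Lp_closed_subalgebra p M B \<and> isometric_isomorphism_onto p M B \<pi>)"

end

theory Submission
  imports Defs
begin

text \<open>
  Let \<open>A\<close> be nonunital and nonzero and let \<open>\<chi>\<close> be the character of \<open>A\<^sup>1\<close> with kernel \<open>A\<close>. The algebra
  \<open>A\<close> is an \<open>M\<close>-ideal iff the multiples of \<open>\<chi>\<close> are the range of an \<open>L\<close>-projection \<open>P\<close>. If they are,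
  then \<open>P \<omega>\<close> and \<open>\<omega> - P \<omega>\<close> are nonnegative multiples of states for every state \<open>\<omega>\<close>, and the
  restriction of the second one to \<open>A\<close> does not lose norm; hence \<open>A\<close> is scaled.

  Conversely let \<open>A\<close> be scaled. Uniform convexity of \<open>L\<^sup>p\<close> shows that states of \<open>A\<close> tend to \<open>1\<close> along
  an approximate identity, so that all states of \<open>A\<^sup>1\<close> become real along it. By a minimax
  argument there is an approximate identity of nearly Hermitian elements \<open>h\<close>, for which
  \<open>exp (\<i> \<theta> h)\<close> is nearly isometric. In a representation on \<open>L\<^sup>p\<close> with \<open>p \<noteq> 2\<close> such rotations make
  functions fixed by \<open>h\<close> nearly disjoint from functions annihilated by \<open>h\<close>: the duality map
  turns \<open>z x + y\<close> into a function affine in \<open>cnj z\<close> (no reflexivity or complemented subspaces are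
  needed, since an element of the approximate identity far out plays the role of the projection
  onto the essential subspace), and pointwise this forces \<open>x y = 0\<close>. With
  \<open>e = (1 - exp (\<i> \<pi> h)) / 2\<close> for \<open>h\<close> early in the approximate identity and \<open>f\<close> for \<open>h\<close> late in it, the
  elements \<open>e b e + \<alpha> (1 - f)\<close> with \<open>\<parallel>b\<parallel> \<le> 1\<close>, \<open>|\<alpha>| \<le> 1\<close> then have norm at most \<open>1\<close> in the limit,
  since \<open>\<parallel>e \<xi>\<parallel>\<^sup>p + \<parallel>(1 - f) \<xi>\<parallel>\<^sup>p = \<parallel>(e + 1 - f) \<xi>\<parallel>\<^sup>p\<close> and \<open>e + 1 - f\<close> is half of \<open>1\<close> plus an isometry.
  This is the inequality \<open>\<parallel>\<phi>\<parallel> \<ge> \<parallel>P \<phi>\<parallel> + \<parallel>\<phi> - P \<phi>\<parallel>\<close> for \<open>P \<phi> = (\<phi> 1 - lim \<phi> e) \<chi>\<close>.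
\<close>

section \<open>Complex vector spaces and the Hahn--Banach theorem\<close>

text \<open>The elements at hand are only nearly Hermitian and only nearly absorb one another, and
  the vectors that nearly attain a norm change with the error. Hence neither a limit projection nor
  a limit vector is available, and every geometric fact about L^p has to hold uniformly over all
  vectors of bounded norm. Each such fact is reduced to a statement about numbers: if a continuous
  function on C^k, homogeneous of degree p, is not positive at the zeros of a nonnegative second
  one, compactness of the sphere turns this into an inequality that can be integrated. Uniform
  convexity, continuity of the duality map and disjointness all arise in this way from their
  pointwise equality cases. As the algebra has no unit, exponentials are replaced by Euler products
  with the unit subtracted; a product of single steps is also what a bound on the numerical range
  controls. In the converse direction scaledness enters only through limits of states: a state of
  A^1 restricts to t times a state of A and so tends to the real number t along the approximate
  identity.\<close>

lemma scaleC_zero_right [simp]: "c *\<^sub>C (0::'v::complex_vector) = 0"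
  using scaleC_add_right[of c 0 "0::'v"] by simp

lemma scaleC_zero_left [simp]: "0 *\<^sub>C (x::'v::complex_vector) = 0"
  using scaleC_add_left[of 0 0 x] by simp

lemma scaleC_minus_left: "(- c) *\<^sub>C (x::'v::complex_vector) = - (c *\<^sub>C x)"
  using scaleC_add_left[of c "- c" x] by (simp add: eq_neg_iff_add_eq_0 add.commute)

lemma scaleC_minus_right: "c *\<^sub>C (- x::'v::complex_vector) = - (c *\<^sub>C x)"
  using scaleC_add_right[of c x "- x"] by (simp add: eq_neg_iff_add_eq_0 add.commute)

lemma scaleC_minus_one: "(- 1) *\<^sub>C (x::'v::complex_vector) = - x"
  by (simp add: scaleC_minus_left scaleC_one)

lemma scaleC_diff_right: "c *\<^sub>C (x - y::'v::complex_vector) = c *\<^sub>C x - c *\<^sub>C y"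
  using scaleC_add_right[of c x "- y"] by (simp add: scaleC_minus_right)

lemma scaleC_diff_left: "(c - d) *\<^sub>C (x::'v::complex_vector) = c *\<^sub>C x - d *\<^sub>C x"
  using scaleC_add_left[of c "- d" x] by (simp add: scaleC_minus_left)

lemma scaleC_simps [simp]:
  "c *\<^sub>C (x::complex) = c * x"
  "fst (c *\<^sub>C z) = c *\<^sub>C fst z" "snd (c *\<^sub>C z) = c *\<^sub>C snd z"
  "c *\<^sub>C (x', y') = (c *\<^sub>C x', c *\<^sub>C y')" "(c *\<^sub>C f) t = c *\<^sub>C f t"
  by (simp_all add: scaleC_complex_def scaleC_prod_def scaleC_fun_def)

abbreviation scaleR' :: "real \<Rightarrow> 'v::complex_vector \<Rightarrow> 'v"  (infixr \<open>*\<^sub>r\<close> 75)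
  where "r *\<^sub>r x \<equiv> complex_of_real r *\<^sub>C x"

definition sublinear :: "('v::complex_vector \<Rightarrow> real) \<Rightarrow> bool" where
  "sublinear q \<longleftrightarrow> (\<forall>x y. q (x + y) \<le> q x + q y) \<and> (\<forall>r x. 0 \<le> r \<longrightarrow> q (r *\<^sub>r x) = r * q x)"

definition real_linear :: "('v::complex_vector \<Rightarrow> real) \<Rightarrow> bool" where
  "real_linear g \<longleftrightarrow> (\<forall>x y. g (x + y) = g x + g y) \<and> (\<forall>r x. g (r *\<^sub>r x) = r * g x)"

lemma sublinear_add: "sublinear q \<Longrightarrow> q (x + y) \<le> q x + q y"
  and sublinear_scale: "sublinear q \<Longrightarrow> 0 \<le> r \<Longrightarrow> q (r *\<^sub>r x) = r * q x"
  by (simp_all add: sublinear_def)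

lemma sublinear_0: "sublinear q \<Longrightarrow> q 0 = 0"
  using sublinear_scale[of q 0 0] by simp

lemma sublinear_neg: "sublinear q \<Longrightarrow> - q (- x) \<le> q x"
  using sublinear_add[of q x "- x"] sublinear_0[of q] by simp

lemma real_linear_add: "real_linear g \<Longrightarrow> g (x + y) = g x + g y"
  and real_linear_scale: "real_linear g \<Longrightarrow> g (r *\<^sub>r x) = r * g x"
  by (simp_all add: real_linear_def)

lemma real_linear_minus: "real_linear g \<Longrightarrow> g (- x) = - g x"
  using real_linear_scale[of g "-1" x] by (simp add: scaleC_minus_one)

lemma real_linear_0: "real_linear g \<Longrightarrow> g 0 = 0"
  using real_linear_scale[of g 0 0] by simp

text \<open>A pair \<open>(k, r)\<close> stands for the demand \<open>r \<le> g k\<close> on the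
  functional \<open>g\<close> to be found. Demands can be added and scaled, so they may be taken to
  form a cone.\<close>

definition real_cone :: "('v::complex_vector \<times> real) set \<Rightarrow> bool" where
  "real_cone K \<longleftrightarrow> (0, 0) \<in> K \<and> (\<forall>(x, a)\<in>K. \<forall>(y, b)\<in>K. (x + y, a + b) \<in> K) \<and>
     (\<forall>(x, a)\<in>K. \<forall>r>0. (r *\<^sub>r x, r * a) \<in> K)"

lemma real_coneI:
  assumes "(0, 0) \<in> K" "\<And>x a y b. (x, a) \<in> K \<Longrightarrow> (y, b) \<in> K \<Longrightarrow> (x + y, a + b) \<in> K"
    "\<And>x a r. (x, a) \<in> K \<Longrightarrow> 0 < r \<Longrightarrow> (r *\<^sub>r x, r * a) \<in> K"
  shows "real_cone K"
  using assms unfolding real_cone_def by blast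

lemma real_cone_ray: "real_cone {(t *\<^sub>r x, t * a) | t. 0 \<le> t}"
proof (rule real_coneI)
  show "(0, 0) \<in> {(t *\<^sub>r x, t * a) | t. 0 \<le> t}" by (intro CollectI exI[of _ 0]) simp
next
  fix y b z c assume "(y, b) \<in> {(t *\<^sub>r x, t * a) | t. 0 \<le> t}" "(z, c) \<in> {(t *\<^sub>r x, t * a) | t. 0 \<le> t}"
  then obtain t u where "0 \<le> t" "0 \<le> u" "y = t *\<^sub>r x" "b = t * a" "z = u *\<^sub>r x" "c = u * a" by blast
  then show "(y + z, b + c) \<in> {(t *\<^sub>r x, t * a) | t. 0 \<le> t}"
    by (intro CollectI exI[of _ "t + u"]) (simp add: scaleC_add_left distrib_right)
next
  fix y b and r :: real assume "(y, b) \<in> {(t *\<^sub>r x, t * a) | t. 0 \<le> t}" "0 < r"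
  then obtain t where "0 \<le> t" "y = t *\<^sub>r x" "b = t * a" by blast
  then show "(r *\<^sub>r y, r * b) \<in> {(t *\<^sub>r x, t * a) | t. 0 \<le> t}"
    using \<open>0 < r\<close> by (intro CollectI exI[of _ "r * t"]) (simp add: scaleC_scaleC)
qed

text \<open>This merges the bound \<open>q\<close> with the demands: for a cone \<open>K\<close>
  with \<open>r \<le> q k\<close> throughout, a linear functional \<open>g\<close> lies below
  \<open>cone_shift q K\<close> iff it lies below \<open>q\<close> and satisfies
  \<open>r \<le> g k\<close> for all \<open>(k, r)\<close> in \<open>K\<close>.\<close>

definition cone_shift :: "('v::complex_vector \<Rightarrow> real) \<Rightarrow> ('v \<times> real) set \<Rightarrow> 'v \<Rightarrow> real" where
  "cone_shift q K x = Inf {q (x + k) - r | k r. (k, r) \<in> K}"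

lemma
  assumes q: "sublinear q" and K: "real_cone K" and le: "\<forall>(k, r)\<in>K. r \<le> q k"
  shows cone_shift_sublinear: "sublinear (cone_shift q K)"
    and cone_shift_le: "\<And>x k r. (k, r) \<in> K \<Longrightarrow> cone_shift q K x \<le> q (x + k) - r"
proof -
  let ?S = "\<lambda>x. {q (x + k) - r | k r. (k, r) \<in> K}"
  have K0: "(0, 0) \<in> K" and Kadd: "\<And>x a y b. (x, a) \<in> K \<Longrightarrow> (y, b) \<in> K \<Longrightarrow> (x + y, a + b) \<in> K"
    and Kscale: "\<And>x a r. (x, a) \<in> K \<Longrightarrow> 0 < r \<Longrightarrow> (r *\<^sub>r x, r * a) \<in> K"
    using K unfolding real_cone_def by blast+
  have ne: "?S x \<noteq> {}" for x using K0 by blast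
  have bdd: "bdd_below (?S x)" for x
  proof (rule bdd_belowI[where m = "- q (- x)"])
    fix y assume "y \<in> ?S x"
    then obtain k r where kr: "(k, r) \<in> K" "y = q (x + k) - r" by blast
    have "r \<le> q k" using le kr(1) by auto
    then have "r \<le> q (x + k) + q (- x)"
      using sublinear_add[OF q, of "x + k" "- x"] by simp
    then show "- q (- x) \<le> y" using kr by simp
  qed
  show lower: "cone_shift q K x \<le> q (x + k) - r" if "(k, r) \<in> K" for x k r
    unfolding cone_shift_def using that by (intro cInf_lower bdd) blast
  have greatest: "b \<le> cone_shift q K x" if "\<And>k r. (k, r) \<in> K \<Longrightarrow> b \<le> q (x + k) - r" for b x
    unfolding cone_shift_def using that ne[of x] by (intro cInf_greatest) blast+
  have sc: "r * cone_shift q K x \<le> cone_shift q K (r *\<^sub>r x)" if "0 < r" for r x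
  proof (rule greatest)
    fix k a assume ka: "(k, a) \<in> K"
    have "cone_shift q K x \<le> q (x + inverse r *\<^sub>r k) - inverse r * a"
      using lower[OF Kscale[OF ka, of "inverse r"]] that by simp
    moreover have "r *\<^sub>r x + k = r *\<^sub>r (x + inverse r *\<^sub>r k)"
      using that by (simp add: scaleC_add_right scaleC_scaleC scaleC_one flip: of_real_mult)
    then have "q (r *\<^sub>r x + k) = r * q (x + inverse r *\<^sub>r k)"
      using sublinear_scale[OF q] that by simp
    ultimately show "r * cone_shift q K x \<le> q (r *\<^sub>r x + k) - a"
      using that by (simp add: field_simps)
  qed
  have q0: "cone_shift q K 0 = 0"
    using lower[OF K0, of 0] sublinear_0[OF q] greatest[of 0 0] le by (force intro: order_antisym)
  show "sublinear (cone_shift q K)"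
    unfolding sublinear_def
  proof (intro conjI allI impI)
    fix x y
    have "cone_shift q K (x + y) - (q (x + k) - r) \<le> cone_shift q K y" if k: "(k, r) \<in> K" for k r
    proof (rule greatest)
      fix l s assume l: "(l, s) \<in> K"
      have "cone_shift q K (x + y) \<le> q ((x + y) + (k + l)) - (r + s)"
        by (rule lower[OF Kadd[OF k l]])
      also have "(x + y) + (k + l) = (x + k) + (y + l)" by (simp add: algebra_simps)
      finally show "cone_shift q K (x + y) - (q (x + k) - r) \<le> q (y + l) - s"
        using sublinear_add[OF q, of "x + k" "y + l"] by linarith
    qed
    then have "cone_shift q K (x + y) - cone_shift q K y \<le> cone_shift q K x"
      by (intro greatest) (metis diff_le_eq add.commute)
    then show "cone_shift q K (x + y) \<le> cone_shift q K x + cone_shift q K y" by simp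
  next
    fix r :: real and x assume "0 \<le> r"
    show "cone_shift q K (r *\<^sub>r x) = r * cone_shift q K x"
    proof (cases "r = 0")
      case False
      with \<open>0 \<le> r\<close> have r: "0 < r" by simp
      have "inverse r * cone_shift q K (r *\<^sub>r x) \<le> cone_shift q K (inverse r *\<^sub>r r *\<^sub>r x)"
        using sc[of "inverse r" "r *\<^sub>r x"] r by simp
      then have "inverse r * cone_shift q K (r *\<^sub>r x) \<le> cone_shift q K x"
        using r by (simp add: scaleC_scaleC scaleC_one flip: of_real_mult)
      then have "cone_shift q K (r *\<^sub>r x) \<le> r * cone_shift q K x"
        using r by (simp add: field_simps)
      with sc[OF r, of x] show ?thesis by simp
    qed (simp add: q0)
  qed
qed

text \<open>Zorn's lemma for the reversed pointwise order. The values of a chain at \<open>x\<close>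
  are bounded below by \<open>- q (- x)\<close>, so pointwise infima exist.\<close>

lemma sublinear_minimal_below:
  assumes q: "sublinear q"
  obtains s where "sublinear s" "s \<le> q" "\<And>s'. sublinear s' \<Longrightarrow> s' \<le> s \<Longrightarrow> s' = s"
proof -
  let ?A = "{s. sublinear s \<and> s \<le> q}" and ?P = "\<lambda>s s' :: 'a \<Rightarrow> real. s' \<le> s"
  have "\<exists>m\<in>?A. \<forall>a\<in>?A. ?P m a \<longrightarrow> a = m"
  proof (rule predicate_Zorn)
    show "partial_order_on ?A (relation_of ?P ?A)"
      by (auto simp: partial_order_on_def preorder_on_def refl_on_def trans_def antisym_def relation_of_def)
    fix C assume "C \<in> Chains (relation_of ?P ?A)"
    then have CA: "C \<subseteq> ?A" and lin: "\<And>s t. s \<in> C \<Longrightarrow> t \<in> C \<Longrightarrow> s \<le> t \<or> t \<le> s"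
      unfolding Chains_def relation_of_def by blast+
    show "\<exists>u\<in>?A. \<forall>a\<in>C. ?P a u"
    proof (cases "C = {}")
      case True
      then show ?thesis using q by auto
    next
      case False
      define u where "u x = (INF s\<in>C. s x)" for x
      have bdd: "bdd_below ((\<lambda>s. s x) ` C)" for x
      proof (rule bdd_belowI[where m = "- q (- x)"])
        fix y assume "y \<in> (\<lambda>s. s x) ` C"
        then obtain s where s: "s \<in> C" "y = s x" by blast
        then have "sublinear s" "s (- x) \<le> q (- x)" using CA by (auto simp: le_fun_def)
        then show "- q (- x) \<le> y" using sublinear_neg[of s x] s by linarith
      qed
      have low: "u x \<le> s x" if "s \<in> C" for s x
        unfolding u_def using that by (intro cINF_lower bdd)
      have gr: "b \<le> u x" if "\<And>s. s \<in> C \<Longrightarrow> b \<le> s x" for b x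
        unfolding u_def using that False by (intro cINF_greatest)
      have "u (x + y) \<le> u x + u y" for x y
      proof -
        have "u (x + y) - s x \<le> t y" if st: "s \<in> C" "t \<in> C" for s t
        proof -
          \<comment> \<open>In a chain the smaller of \<open>s\<close> and \<open>t\<close> serves
            in both places, which makes the pointwise infimum subadditive.\<close>
          obtain v where v: "v \<in> C" "v \<le> s" "v \<le> t" using lin[OF st] st by blast
          have "sublinear v" using v CA by blast
          then have "u (x + y) \<le> v x + v y"
            using low[OF v(1), of "x + y"] sublinear_add[of v x y] by linarith
          also have "\<dots> \<le> s x + t y" using v by (auto simp: le_fun_def intro: add_mono)
          finally show ?thesis by simp
        qed
        then have "u (x + y) - s x \<le> u y" if "s \<in> C" for s using gr that by blast
        then have "u (x + y) - u y \<le> u x" by (intro gr) (metis diff_le_eq add.commute)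
        then show ?thesis by simp
      qed
      moreover have "u (r *\<^sub>r x) = r * u x" if "0 \<le> r" for r x
      proof (rule antisym)
        have sC: "s (r *\<^sub>r x) = r * s x" if "s \<in> C" for s x
          using that CA \<open>0 \<le> r\<close> sublinear_scale[of s r x] by blast
        show "u (r *\<^sub>r x) \<le> r * u x"
        proof (cases "r = 0")
          case True
          obtain s where "s \<in> C" using False by blast
          then show ?thesis using low[of s "r *\<^sub>r x"] sC[of s x] True by simp
        next
          case f: False
          have "u (r *\<^sub>r x) / r \<le> u x"
          proof (rule gr)
            fix s assume "s \<in> C"
            then show "u (r *\<^sub>r x) / r \<le> s x"
              using low[of s "r *\<^sub>r x"] sC[of s x] f that by (simp add: field_simps)
          qed
          then show ?thesis using f that by (simp add: field_simps)
        qed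
        show "r * u x \<le> u (r *\<^sub>r x)"
          by (rule gr) (simp add: sC low mult_left_mono that)
      qed
      moreover have "u \<le> q"
      proof -
        obtain s where "s \<in> C" using False by blast
        then have "u \<le> s" "s \<le> q" using low CA by (auto intro: le_funI)
        then show ?thesis by (rule order_trans)
      qed
      ultimately show ?thesis
        by (intro bexI[of _ u]) (auto simp: sublinear_def le_fun_def low)
    qed
  qed
  then obtain m where m: "m \<in> ?A" "\<And>a. a \<in> ?A \<Longrightarrow> a \<le> m \<Longrightarrow> a = m" by blast
  show ?thesis
    using m by (intro that[of m]) (auto intro: order_trans)
qed

text \<open>
  The Mazur--Orlicz form of the Hahn--Banach theorem. For a cone generated by the graph of a linear
  functional on a subspace it is the extension theorem, for one generated by \<open>C \<times> {\<delta>}\<close> with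
  \<open>C\<close> convex it is a separation theorem. In the proof, shifting by the cone generated by
  \<open>(y, s y)\<close> shows that a minimal sublinear functional \<open>s\<close> is additive.
\<close>

lemma mazur_orlicz:
  assumes q: "sublinear q" and K: "real_cone K" and le: "\<And>k r. (k, r) \<in> K \<Longrightarrow> r \<le> q k"
  obtains g where "real_linear g" "\<And>x. g x \<le> q x" "\<And>k r. (k, r) \<in> K \<Longrightarrow> r \<le> g k"
proof -
  have "\<forall>(k, r)\<in>K. r \<le> q k" using le by blast
  note sh = cone_shift_sublinear[OF q K this] cone_shift_le[OF q K this]
  obtain s where s: "sublinear s" "s \<le> cone_shift q K"
    and min: "\<And>s'. sublinear s' \<Longrightarrow> s' \<le> s \<Longrightarrow> s' = s"
    using sublinear_minimal_below[OF sh(1)] by blast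
  have add: "s (x + y) = s x + s y" for x y
  proof -
    let ?K = "{(t *\<^sub>r y, t * s y) | t. 0 \<le> t}"
    have K': "real_cone ?K" by (rule real_cone_ray)
    have le': "\<forall>(k, r)\<in>?K. r \<le> s k"
      using sublinear_scale[OF s(1)] by auto
    note sh' = cone_shift_sublinear[OF s(1) K' le'] cone_shift_le[OF s(1) K' le']
    have z: "(0, 0) \<in> ?K" and o: "(y, s y) \<in> ?K"
      by (auto intro: exI[of _ 0] exI[of _ 1] simp: scaleC_one)
    have "cone_shift s ?K = s"
      using sh'(2)[OF z] by (intro min[OF sh'(1)]) (simp add: le_fun_def)
    then have "s x \<le> s (x + y) - s y" using sh'(2)[OF o, of x] by simp
    then show ?thesis using sublinear_add[OF s(1), of x y] by simp
  qed
  have neg: "s (- x) = - s x" for x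
    using add[of x "- x"] sublinear_0[OF s(1)] by simp
  have "s (r *\<^sub>r x) = r * s x" for r x
  proof (cases "0 \<le> r")
    case False
    then have "s (- (r *\<^sub>r x)) = (- r) * s x"
      using sublinear_scale[OF s(1), of "- r" x] by (simp add: scaleC_minus_left)
    then show ?thesis by (simp add: neg)
  qed (rule sublinear_scale[OF s(1)])
  then have lin: "real_linear s" by (simp add: real_linear_def add)
  have K0: "(0, 0) \<in> K" using K by (simp add: real_cone_def)
  show ?thesis
  proof (rule that[OF lin])
    show "s x \<le> q x" for x
      using s(2) sh(2)[OF K0, of x] by (auto simp: le_fun_def intro: order_trans)
    show "r \<le> s k" if "(k, r) \<in> K" for k r
    proof -
      \<comment> \<open>At \<open>- k\<close> the shift by the pair \<open>(k, r)\<close> itself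
        leaves only \<open>- r\<close>, since \<open>q 0 = 0\<close>.\<close>
      have "s (- k) \<le> q (- k + k) - r"
        using s(2) sh(2)[OF that, of "- k"] by (auto simp: le_fun_def intro: order_trans)
      then show ?thesis by (simp add: neg sublinear_0[OF q])
    qed
  qed
qed

section \<open>Complex seminorms and complex forms of the Hahn-Banach theorem\<close>

definition cseminorm :: "('v::complex_vector \<Rightarrow> real) \<Rightarrow> bool" where
  "cseminorm N \<longleftrightarrow> (\<forall>x y. N (x + y) \<le> N x + N y) \<and> (\<forall>c x. N (c *\<^sub>C x) = cmod c * N x)"

lemma cseminorm_sublinear: "cseminorm N \<Longrightarrow> sublinear N"
  by (simp add: cseminorm_def sublinear_def)

lemma cseminorm_minus: "cseminorm N \<Longrightarrow> N (- x) = N x"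
  using scaleC_minus_one[of x] by (metis cseminorm_def norm_minus_cancel norm_one mult_1)

lemma cseminorm_0: "cseminorm N \<Longrightarrow> N 0 = 0"
  by (simp add: cseminorm_sublinear sublinear_0)

lemma cseminorm_nonneg: "cseminorm N \<Longrightarrow> 0 \<le> N x"
  using sublinear_neg[OF cseminorm_sublinear, of N x] cseminorm_minus[of N x] by simp

lemma cseminorm_scale: "cseminorm N \<Longrightarrow> N (c *\<^sub>C x) = cmod c * N x"
  by (simp add: cseminorm_def)

lemma cseminorm_mult: "cseminorm N \<Longrightarrow> 0 \<le> k \<Longrightarrow> cseminorm (\<lambda>x. k * N x)"
  unfolding cseminorm_def by (auto simp: distrib_left[symmetric] mult_left_mono)

lemma clinear_on_add: "clinear_on UNIV \<phi> \<Longrightarrow> \<phi> (x + y) = \<phi> x + \<phi> y"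
  and clinear_on_scale: "clinear_on UNIV \<phi> \<Longrightarrow> \<phi> (c *\<^sub>C x) = c *\<^sub>C \<phi> x"
  by (simp_all add: clinear_on_def)

lemma clinear_on_minus: "clinear_on UNIV \<phi> \<Longrightarrow> \<phi> (- x) = - \<phi> x"
  using clinear_on_scale[of \<phi> "- 1" x] by (simp add: scaleC_minus_one)

lemma clinear_on_diff: "clinear_on UNIV \<phi> \<Longrightarrow> \<phi> (x - y) = \<phi> x - \<phi> y"
  using clinear_on_add[of \<phi> x "- y"] by (simp add: clinear_on_minus)

text \<open>This is the only complex-linear functional with real part \<open>g\<close>, since
  \<open>Im z = - Re (\<i> * z)\<close>.\<close>

definition complexify :: "('v::complex_vector \<Rightarrow> real) \<Rightarrow> 'v \<Rightarrow> complex" where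
  "complexify g x = Complex (g x) (- g (\<i> *\<^sub>C x))"

lemma Re_complexify [simp]: "Re (complexify g x) = g x"
  by (simp add: complexify_def)

lemma complexify_clinear:
  assumes "real_linear g"
  shows "clinear_on UNIV (complexify g)"
proof -
  have "complexify g (c *\<^sub>C x) = c * complexify g x" for c x
  proof -
    have c: "c = Re c + Im c * \<i>" and ic: "\<i> * c = Re c * \<i> + complex_of_real (- Im c)"
      by (simp_all add: complex_eq_iff)
    have 1: "c *\<^sub>C x = Re c *\<^sub>r x + Im c *\<^sub>r \<i> *\<^sub>C x"
      by (subst c) (simp only: scaleC_add_left scaleC_scaleC)
    have 2: "\<i> *\<^sub>C c *\<^sub>C x = Re c *\<^sub>r \<i> *\<^sub>C x + (- Im c) *\<^sub>r x"
      by (simp only: scaleC_scaleC ic scaleC_add_left)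
    have g1: "g (c *\<^sub>C x) = Re c * g x + Im c * g (\<i> *\<^sub>C x)"
      by (simp only: 1 real_linear_add[OF assms] real_linear_scale[OF assms])
    have g2: "g (\<i> *\<^sub>C c *\<^sub>C x) = Re c * g (\<i> *\<^sub>C x) + (- Im c) * g x"
      by (simp only: 2 real_linear_add[OF assms] real_linear_scale[OF assms])
    show ?thesis
      by (simp add: complexify_def complex_eq_iff g1 g2)
  qed
  moreover have "complexify g (x + y) = complexify g x + complexify g y" for x y
    by (simp add: complexify_def complex_eq_iff scaleC_add_right real_linear_add[OF assms])
  ultimately show ?thesis by (simp add: clinear_on_def)
qed

text \<open>Rotating \<open>x\<close> makes \<open>\<phi> x\<close> real and nonnegative.\<close>

lemma cmod_le_of_Re_le:
  assumes "clinear_on UNIV \<phi>" "cseminorm N" "\<And>x. Re (\<phi> x) \<le> N x"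
  shows "cmod (\<phi> x) \<le> N x"
proof -
  define c where "c = cnj (sgn (\<phi> x))"
  have c: "cmod c \<le> 1" by (simp add: c_def norm_sgn)
  have "c * \<phi> x = cmod (\<phi> x)"
  proof (cases "\<phi> x = 0")
    case False
    have "c * \<phi> x = \<phi> x * cnj (\<phi> x) / cmod (\<phi> x)" by (simp add: c_def sgn_eq)
    also have "\<dots> = (cmod (\<phi> x))\<^sup>2 / cmod (\<phi> x)" by (simp only: complex_norm_square of_real_divide)
    finally show ?thesis using False by (simp add: power2_eq_square)
  qed simp
  then have "cmod (\<phi> x) = Re (\<phi> (c *\<^sub>C x))"
    by (simp add: clinear_on_scale[OF assms(1)])
  also have "\<dots> \<le> cmod c * N x" using assms(3) cseminorm_scale[OF assms(2)] by metis
  also have "\<dots> \<le> 1 * N x" by (intro mult_right_mono c cseminorm_nonneg assms)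
  finally show ?thesis by simp
qed

lemma mazur_orlicz_complex:
  assumes N: "cseminorm N" and "real_cone K" "\<And>k r. (k, r) \<in> K \<Longrightarrow> r \<le> N k"
  obtains \<phi> where "clinear_on UNIV \<phi>" "\<And>x. cmod (\<phi> x) \<le> N x" "\<And>k r. (k, r) \<in> K \<Longrightarrow> r \<le> Re (\<phi> k)"
proof -
  obtain g where g: "real_linear g" "\<And>x. g x \<le> N x" "\<And>k r. (k, r) \<in> K \<Longrightarrow> r \<le> g k"
    using mazur_orlicz[OF cseminorm_sublinear[OF N] assms(2,3)] by blast
  show ?thesis
    using g by (intro that[of "complexify g"] complexify_clinear cmod_le_of_Re_le[OF _ N]) auto
qed

lemma hahn_banach_norming:
  assumes N: "cseminorm N"
  obtains \<phi> where "clinear_on UNIV \<phi>" "\<And>x. cmod (\<phi> x) \<le> N x" "\<phi> c = N c"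
proof -
  let ?K = "{(t *\<^sub>r c, t * N c) | t. 0 \<le> t}"
  have K: "real_cone ?K" by (rule real_cone_ray)
  have le: "r \<le> N k" if "(k, r) \<in> ?K" for k r using that by (auto simp: cseminorm_scale[OF N])
  obtain \<phi> where p: "clinear_on UNIV \<phi>" "\<And>x. cmod (\<phi> x) \<le> N x" "\<And>k r. (k, r) \<in> ?K \<Longrightarrow> r \<le> Re (\<phi> k)"
    using mazur_orlicz_complex[OF N K le] by blast
  have "N c \<le> Re (\<phi> c)" 
    by (intro p(3) CollectI exI[of _ 1]) (simp add: scaleC_one)
  moreover have "Re (\<phi> c) \<le> cmod (\<phi> c)" by (rule complex_Re_le_cmod)
  ultimately have "Re (\<phi> c) = N c" "cmod (\<phi> c) = N c" using p(2)[of c] by linarith+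
  then have "\<phi> c = N c"
    using cmod_power2[of "\<phi> c"] by (simp add: complex_eq_iff)
  then show ?thesis using that p by blast
qed

lemma hahn_banach_extension:
  assumes N: "cseminorm N" and S: "csubspace S" and f: "clinear_on S f" "\<And>x. x \<in> S \<Longrightarrow> cmod (f x) \<le> N x"
  obtains \<phi> where "clinear_on UNIV \<phi>" "\<And>x. cmod (\<phi> x) \<le> N x" "\<And>x. x \<in> S \<Longrightarrow> \<phi> x = f x"
proof -
  let ?K = "{(x, Re (f x)) | x. x \<in> S}"
  have fadd: "f (x + y) = f x + f y" if "x \<in> S" "y \<in> S" for x y
    using f that by (simp add: clinear_on_def)
  have fsc: "f (c *\<^sub>C x) = c * f x" if "x \<in> S" for c x
    using f that by (simp add: clinear_on_def)
  have Sadd: "x + y \<in> S" if "x \<in> S" "y \<in> S" for x y using S that by (simp add: csubspace_def)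
  have Ssc: "c *\<^sub>C x \<in> S" if "x \<in> S" for c x using S that by (simp add: csubspace_def)
  have S0: "0 \<in> S" using S by (simp add: csubspace_def)
  have f0: "f 0 = 0" using fsc[OF S0, of 0] by simp
  have "real_cone ?K"
    unfolding real_cone_def
    using S0 f0 by (auto simp: fadd Sadd Ssc fsc)
  then obtain \<phi> where p: "clinear_on UNIV \<phi>" "\<And>x. cmod (\<phi> x) \<le> N x" "\<And>k r. (k, r) \<in> ?K \<Longrightarrow> r \<le> Re (\<phi> k)"
  proof (rule mazur_orlicz_complex[OF N])
    show "r \<le> N k" if "(k, r) \<in> ?K" for k r
      using that f(2)[of k] complex_Re_le_cmod[of "f k"] by auto
  qed auto
  have ge: "Re (f x) \<le> Re (\<phi> x)" if "x \<in> S" for x using p(3) that by auto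
  have re: "Re (f x) = Re (\<phi> x)" if "x \<in> S" for x
    using ge[OF that] ge[OF Ssc[OF that, of "- 1"]] fsc[OF that, of "- 1"]
    by (simp add: scaleC_minus_one clinear_on_minus[OF p(1)])
  have "\<phi> x = f x" if "x \<in> S" for x
    using re[OF that] re[OF Ssc[OF that, of "\<i>"]] fsc[OF that, of "\<i>"]
    by (simp add: clinear_on_scale[OF p(1)] complex_eq_iff)
  then show ?thesis using that p by blast
qed

section \<open>Homogeneous functions and integrals\<close>

text \<open>Such a function is determined by its values on the unit sphere, which is compact because
  the domain has finite dimension. The constants below come from there and do not see the measure
  space.\<close>

definition homog :: "real \<Rightarrow> ('e::euclidean_space \<Rightarrow> 'f::real_normed_vector) \<Rightarrow> bool" where
  "homog d \<Phi> \<longleftrightarrow> continuous_on UNIV \<Phi> \<and> (\<forall>r>0. \<forall>x. \<Phi> (r *\<^sub>R x) = (r powr d) *\<^sub>R \<Phi> x)"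

lemma homogI:
  "continuous_on UNIV \<Phi> \<Longrightarrow> (\<And>r x. 0 < r \<Longrightarrow> \<Phi> (r *\<^sub>R x) = (r powr d) *\<^sub>R \<Phi> x) \<Longrightarrow> homog d \<Phi>"
  by (simp add: homog_def)

lemma homog_continuous: "homog d \<Phi> \<Longrightarrow> continuous_on UNIV \<Phi>"
  and homog_scale: "homog d \<Phi> \<Longrightarrow> 0 < r \<Longrightarrow> \<Phi> (r *\<^sub>R x) = (r powr d) *\<^sub>R \<Phi> x"
  by (simp_all add: homog_def)

lemma homog_0:
  assumes "homog d \<Phi>" "0 < d"
  shows "\<Phi> 0 = 0"
proof -
  have "\<Phi> 0 = (2 powr d) *\<^sub>R \<Phi> 0" using homog_scale[OF assms(1), of 2 0] by simp
  then have "(2 powr d - 1) *\<^sub>R \<Phi> 0 = 0" by (simp add: algebra_simps)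
  moreover have "(2::real) powr d \<noteq> 1" using assms(2) powr_less_mono[of 0 d 2] by simp
  ultimately show ?thesis by simp
qed

lemma homog_normalize:
  assumes "homog d \<Phi>" "x \<noteq> 0"
  shows "\<Phi> x = (norm x powr d) *\<^sub>R \<Phi> (sgn x)"
  using homog_scale[OF assms(1), of "norm x" "sgn x"] assms(2) by (simp add: sgn_div_norm)

lemma homog_compose: "homog a \<Phi> \<Longrightarrow> homog b \<Psi> \<Longrightarrow> homog (a * b) (\<lambda>x. \<Psi> (\<Phi> x))"
  by (intro homogI)
    (auto simp: homog_scale powr_powr intro: continuous_on_compose2[OF homog_continuous homog_continuous])

lemma homog_add: "homog d \<Phi> \<Longrightarrow> homog d \<Psi> \<Longrightarrow> homog d (\<lambda>x. \<Phi> x + \<Psi> x)"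
  and homog_diff: "homog d \<Phi> \<Longrightarrow> homog d \<Psi> \<Longrightarrow> homog d (\<lambda>x. \<Phi> x - \<Psi> x)"
  and homog_cmult: "homog d \<Theta> \<Longrightarrow> homog d (\<lambda>x. c * \<Theta> x)" for c :: "'h::real_normed_algebra"
  unfolding homog_def by (auto intro: continuous_intros simp: algebra_simps)

lemma homog_mult:
  "homog d \<Phi> \<Longrightarrow> homog e \<Psi> \<Longrightarrow> homog (d + e) (\<lambda>x. \<Phi> x * \<Psi> x :: 'f::real_normed_algebra)"
  unfolding homog_def by (auto intro: continuous_intros simp: powr_add mult.commute)

lemma homog_sum: "(\<And>u. u \<in> S \<Longrightarrow> homog d (\<Phi> u)) \<Longrightarrow> homog d (\<lambda>x. \<Sum>u\<in>S. \<Phi> u x)"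
  unfolding homog_def by (auto intro!: continuous_intros simp: scaleR_sum_right)

lemma homog_linear: "bounded_linear f \<Longrightarrow> homog 1 f"
  by (intro homogI) (auto intro: linear_continuous_on simp: linear_simps)

lemma homog_norm_powr:
  assumes "homog d \<Phi>" "0 < e"
  shows "homog (d * e) (\<lambda>x. norm (\<Phi> x) powr e)"
proof (rule homogI)
  show "continuous_on UNIV (\<lambda>x. norm (\<Phi> x) powr e)"
    using assms by (intro continuous_on_powr' continuous_intros) (auto simp: homog_continuous)
qed (use assms in \<open>simp add: homog_scale powr_mult powr_powr\<close>)

lemma homog_norm: "homog d \<Phi> \<Longrightarrow> homog d (\<lambda>x. norm (\<Phi> x))"
  unfolding homog_def by (auto intro: continuous_intros)

lemma homog_bound:
  assumes "homog d \<Phi>" "0 < d"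
  obtains C where "0 \<le> C" "\<And>x. norm (\<Phi> x) \<le> C * norm x powr d"
proof -
  have "compact ((\<lambda>x. norm (\<Phi> x)) ` sphere 0 1)"
    using assms(1) by (intro compact_continuous_image continuous_on_norm) (auto intro: continuous_on_subset homog_continuous)
  then obtain C where C: "\<And>x. x \<in> sphere 0 1 \<Longrightarrow> norm (\<Phi> x) \<le> C"
    using compact_imp_bounded by (fastforce simp: bounded_iff)
  have "norm (\<Phi> x) \<le> max C 0 * norm x powr d" for x
  proof (cases "x = 0")
    case False
    then have "norm (\<Phi> (sgn x)) \<le> max C 0" using C[of "sgn x"] by (simp add: norm_sgn)
    then show ?thesis
      using homog_normalize[OF assms(1) False] by (simp add: mult.commute mult_right_mono)
  qed (simp add: homog_0[OF assms])
  then show ?thesis using that[of "max C 0"] by simp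
qed

text \<open>By compactness of the set of unit vectors with \<open>\<Phi> x \<ge> \<epsilon>\<close>, where \<open>\<Psi>\<close> has no zero.\<close>

lemma homog_dominate:
  fixes \<Phi> \<Psi> :: "'e::euclidean_space \<Rightarrow> real"
  assumes "0 < d" "homog d \<Phi>" "homog d \<Psi>" and nonneg: "\<And>x. 0 \<le> \<Psi> x"
    and zero: "\<And>x. \<Psi> x = 0 \<Longrightarrow> \<Phi> x \<le> 0" and "0 < \<epsilon>"
  obtains C where "0 \<le> C" "\<And>x. \<Phi> x \<le> \<epsilon> * norm x powr d + C * \<Psi> x"
proof -
  let ?K = "sphere 0 1 \<inter> {x. \<epsilon> \<le> \<Phi> x}"
  have cont: "continuous_on UNIV \<Phi>" "continuous_on UNIV \<Psi>" using assms by (auto intro: homog_continuous)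
  have K: "compact ?K"
    by (intro compact_Int_closed compact_sphere closed_Collect_le continuous_intros cont)
  obtain B where B: "0 \<le> B" "\<And>x. norm (\<Phi> x) \<le> B * norm x powr d"
    using homog_bound[OF assms(2,1)] by blast
  obtain m where m: "0 < m" "\<And>x. x \<in> ?K \<Longrightarrow> m \<le> \<Psi> x"
  proof (cases "?K = {}")
    case True
    then show ?thesis using that[of 1] by simp
  next
    case False
    then obtain x0 where x0: "x0 \<in> ?K" "\<And>x. x \<in> ?K \<Longrightarrow> \<Psi> x0 \<le> \<Psi> x"
      using continuous_attains_inf[OF K False] cont by (metis continuous_on_subset subset_UNIV)
    have "\<Psi> x0 \<noteq> 0" using zero[of x0] x0(1) \<open>0 < \<epsilon>\<close> by auto
    then show ?thesis using that[of "\<Psi> x0"] x0 nonneg[of x0] by simp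
  qed
  have "\<Phi> x \<le> \<epsilon> * norm x powr d + B / m * \<Psi> x" for x
  proof (cases "x = 0")
    case True
    then show ?thesis using homog_0[OF assms(2,1)] homog_0[OF assms(3,1)] by simp
  next
    case False
    let ?y = "sgn x"
    have y: "norm ?y = 1" using False by (simp add: norm_sgn)
    have "\<Phi> ?y \<le> \<epsilon> + B / m * \<Psi> ?y"
    proof (cases "\<epsilon> \<le> \<Phi> ?y")
      case True
      then have "m \<le> \<Psi> ?y" using m(2)[of ?y] y by simp
      then have "B / m * m \<le> B / m * \<Psi> ?y" using B m by (intro mult_left_mono) auto
      moreover have "\<Phi> ?y \<le> B" using B(2)[of ?y] y by simp
      ultimately show ?thesis using m(1) \<open>0 < \<epsilon>\<close> by simp
    next
      case False
      moreover have "0 \<le> B / m * \<Psi> ?y" using B m nonneg by simp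
      ultimately show ?thesis by linarith
    qed
    then have "norm x powr d * \<Phi> ?y \<le> norm x powr d * (\<epsilon> + B / m * \<Psi> ?y)"
      by (intro mult_left_mono) auto
    then show ?thesis
      using homog_normalize[OF assms(2) False] homog_normalize[OF assms(3) False]
      by (simp add: algebra_simps)
  qed
  then show ?thesis using that[of "B / m"] B m by simp
qed

lemma homog_fst: "homog d \<Phi> \<Longrightarrow> homog d (\<lambda>z. \<Phi> (fst z))"
  and homog_snd: "homog d \<Phi> \<Longrightarrow> homog d (\<lambda>z. \<Phi> (snd z))"
  using homog_compose[OF homog_linear[OF bounded_linear_fst]] homog_compose[OF homog_linear[OF bounded_linear_snd]]
  by (metis mult_1)+

lemma homog_id: "homog 1 (\<lambda>x. x)"
  by (simp add: homog_linear bounded_linear_ident)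

lemma
  assumes p: "0 < p"
  shows homog_cmod_fst: "homog p (\<lambda>z :: complex \<times> complex. cmod (fst z) powr p)"
    and homog_cmod_snd: "homog p (\<lambda>z :: complex \<times> complex. cmod (snd z) powr p)"
    and homog_cmod_add: "homog p (\<lambda>z :: complex \<times> complex. cmod (fst z + snd z) powr p)"
    and homog_cmod_diff: "homog p (\<lambda>z :: complex \<times> complex. cmod (fst z - snd z) powr p)"
  using homog_norm_powr[OF homog_fst[OF homog_id] p] homog_norm_powr[OF homog_snd[OF homog_id] p]
    homog_norm_powr[OF homog_add[OF homog_fst[OF homog_id] homog_snd[OF homog_id]] p]
    homog_norm_powr[OF homog_diff[OF homog_fst[OF homog_id] homog_snd[OF homog_id]] p]
  by simp_all

section \<open>Vector-valued functions with integrable p-th power, and integrated pointwise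
  inequalities\<close>

definition Lp_fun :: "real \<Rightarrow> 'b measure \<Rightarrow> ('b \<Rightarrow> 'e::euclidean_space) \<Rightarrow> bool" where
  "Lp_fun p M F \<longleftrightarrow> F \<in> borel_measurable M \<and> integrable M (\<lambda>x. norm (F x) powr p)"

text \<open>The p-th power of the norm, which unlike the norm is an integral and so follows
  pointwise inequalities directly. Values in a Euclidean space let a pair or triple of functions
  count as one function.\<close>

definition Lp_int :: "real \<Rightarrow> 'b measure \<Rightarrow> ('b \<Rightarrow> 'e::euclidean_space) \<Rightarrow> real" where
  "Lp_int p M F = (\<integral>x. norm (F x) powr p \<partial>M)"

lemma Lp_int_nonneg: "0 \<le> Lp_int p M F"
  by (simp add: Lp_int_def)

lemma homog_measurable:
  assumes "homog d \<Phi>" "F \<in> borel_measurable M"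
  shows "(\<lambda>x. \<Phi> (F x)) \<in> borel_measurable M"
  using measurable_comp[OF assms(2) borel_measurable_continuous_onI[OF homog_continuous[OF assms(1)]]]
  by (simp add: comp_def)

lemma Lp_fun_integrable:
  fixes \<Phi> :: "'e::euclidean_space \<Rightarrow> 'f::euclidean_space"
  assumes "0 < p" "Lp_fun p M F" "homog p \<Phi>"
  shows "integrable M (\<lambda>x. \<Phi> (F x))"
proof -
  obtain C where C: "0 \<le> C" "\<And>x. norm (\<Phi> x) \<le> C * norm x powr p"
    using homog_bound[OF assms(3,1)] by blast
  show ?thesis
  proof (rule Bochner_Integration.integrable_bound)
    show "integrable M (\<lambda>x. C * norm (F x) powr p)" using assms(2) by (simp add: Lp_fun_def)
    show "(\<lambda>x. \<Phi> (F x)) \<in> borel_measurable M"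
      using assms by (auto intro: homog_measurable simp: Lp_fun_def)
    show "AE x in M. norm (\<Phi> (F x)) \<le> norm (C * norm (F x) powr p)"
      using C by (intro AE_I2) (simp add: order_trans)
  qed
qed

lemma Lp_fun_homog:
  fixes \<Phi> :: "'e::euclidean_space \<Rightarrow> 'f::euclidean_space"
  assumes "0 < p" "Lp_fun p M F" "homog 1 \<Phi>"
  shows "Lp_fun p M (\<lambda>x. \<Phi> (F x))"
proof -
  have "homog p (\<lambda>x. norm (\<Phi> x) powr p)" using homog_norm_powr[OF assms(3,1)] by simp
  then show ?thesis
    using Lp_fun_integrable[OF assms(1,2)] assms by (auto simp: Lp_fun_def intro: homog_measurable)
qed

lemma Lp_int_homog_le:
  fixes \<Phi> :: "'e::euclidean_space \<Rightarrow> 'f::euclidean_space"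
  assumes "0 < p" "homog 1 \<Phi>"
  obtains C where "0 \<le> C" "\<And>F. Lp_fun p M F \<Longrightarrow> Lp_int p M (\<lambda>x. \<Phi> (F x)) \<le> C * Lp_int p M F"
proof -
  have h: "homog p (\<lambda>x. norm (\<Phi> x) powr p)" using homog_norm_powr[OF assms(2,1)] by simp
  obtain C where C: "0 \<le> C" "\<And>x. norm (norm (\<Phi> x) powr p) \<le> C * norm x powr p"
    using homog_bound[OF h assms(1)] by blast
  show ?thesis
  proof (rule that[OF C(1)])
    fix F :: "'a \<Rightarrow> 'e" assume F: "Lp_fun p M F"
    have "Lp_int p M (\<lambda>x. \<Phi> (F x)) \<le> (\<integral>x. C * norm (F x) powr p \<partial>M)"
      unfolding Lp_int_def
      using C F Lp_fun_integrable[OF assms(1) F h]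
      by (intro integral_mono) (auto simp: Lp_fun_def)
    then show "Lp_int p M (\<lambda>x. \<Phi> (F x)) \<le> C * Lp_int p M F" by (simp add: Lp_int_def)
  qed
qed

text \<open>This integrates \<open>homog_dominate\<close>. The point is the order of quantifiers:
  one \<open>\<kappa>\<close> serves every \<open>F\<close> with
  \<open>Lp_int p M F \<le> B\<close>, so the conclusion applies along sequences of functions that
  do not converge.\<close>

lemma integral_transfer:
  fixes \<Phi> \<Psi> :: "'e::euclidean_space \<Rightarrow> real"
  assumes p: "0 < p" and h: "homog p \<Phi>" "homog p \<Psi>" and nonneg: "\<And>x. 0 \<le> \<Psi> x"
    and zero: "\<And>x. \<Psi> x = 0 \<Longrightarrow> \<Phi> x \<le> 0" and e: "0 < \<epsilon>"
  obtains \<kappa> where "0 < \<kappa>"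
    "\<And>F. Lp_fun p M F \<Longrightarrow> Lp_int p M F \<le> B \<Longrightarrow> (\<integral>x. \<Psi> (F x) \<partial>M) \<le> \<kappa> \<Longrightarrow> (\<integral>x. \<Phi> (F x) \<partial>M) \<le> \<epsilon>"
proof -
  \<comment> \<open>Half of \<open>\<epsilon>\<close> is spent on the norm term and half on
    \<open>C * \<Psi>\<close>; the \<open>+ 1\<close> keeps the denominators positive when
    \<open>B\<close> or \<open>C\<close> vanishes.\<close>
  define \<delta> where "\<delta> = \<epsilon> / (2 * (\<bar>B\<bar> + 1))"
  have d: "0 < \<delta>" using e by (simp add: \<delta>_def)
  obtain C where C: "0 \<le> C" "\<And>x. \<Phi> x \<le> \<delta> * norm x powr p + C * \<Psi> x"
    using homog_dominate[OF p h nonneg zero d] by blast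
  show ?thesis
  proof (rule that)
    show "0 < \<epsilon> / (2 * (C + 1))" using e C by simp
    fix F assume F: "Lp_fun p M F" "Lp_int p M F \<le> B" "(\<integral>x. \<Psi> (F x) \<partial>M) \<le> \<epsilon> / (2 * (C + 1))"
    have "(\<integral>x. \<Phi> (F x) \<partial>M) \<le> (\<integral>x. \<delta> * norm (F x) powr p + C * \<Psi> (F x) \<partial>M)"
      using F Lp_fun_integrable[OF p F(1)] h C by (intro integral_mono) (auto simp: Lp_fun_def)
    also have "\<dots> = \<delta> * Lp_int p M F + C * (\<integral>x. \<Psi> (F x) \<partial>M)"
      using F Lp_fun_integrable[OF p F(1)] h by (subst Bochner_Integration.integral_add) (auto simp: Lp_fun_def Lp_int_def)
    also have "\<dots> \<le> \<delta> * (\<bar>B\<bar> + 1) + (C + 1) * (\<epsilon> / (2 * (C + 1)))"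
    proof (intro add_mono mult_left_mono)
      have "C * (\<integral>x. \<Psi> (F x) \<partial>M) \<le> C * (\<epsilon> / (2 * (C + 1)))" using F C by (intro mult_left_mono)
      also have "\<dots> \<le> (C + 1) * (\<epsilon> / (2 * (C + 1)))" using C e by (intro mult_right_mono) auto
      finally show "C * (\<integral>x. \<Psi> (F x) \<partial>M) \<le> (C + 1) * (\<epsilon> / (2 * (C + 1)))" .
    qed (use F d in auto)
    also have "\<dots> = \<epsilon>"
    proof -
      have "\<epsilon> / (2 * b) * b = \<epsilon> / 2" if "b \<noteq> 0" for b using that by simp
      then have "\<delta> * (\<bar>B\<bar> + 1) = \<epsilon> / 2" unfolding \<delta>_def by (smt (verit))
      moreover have "(C + 1) * (\<epsilon> / (2 * (C + 1))) = \<epsilon> / 2" using C by (simp add: field_simps)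
      ultimately show ?thesis by simp
    qed
    finally show "(\<integral>x. \<Phi> (F x) \<partial>M) \<le> \<epsilon>" .
  qed
qed

lemma Lp_fun_Pair:
  assumes "0 < p" "Lp_fun p M f" "Lp_fun p M g"
  shows "Lp_fun p M (\<lambda>x. (f x, g x))"
    and "Lp_int p M (\<lambda>x. (f x, g x)) \<le> 2 powr p * (Lp_int p M f + Lp_int p M g)"
proof -
  have le: "norm (a, b) powr p \<le> 2 powr p * (norm a powr p + norm b powr p)" for a :: 'b and b :: 'c
  proof -
    have "norm (a, b) \<le> norm a + norm b" by (rule norm_Pair_le)
    also have "\<dots> \<le> 2 * max (norm a) (norm b)" by simp
    finally have "norm (a, b) powr p \<le> (2 * max (norm a) (norm b)) powr p"
      using assms(1) by (intro powr_mono2) auto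
    also have "\<dots> = 2 powr p * max (norm a) (norm b) powr p" by (simp add: powr_mult)
    also have "\<dots> \<le> 2 powr p * (norm a powr p + norm b powr p)"
      by (intro mult_left_mono) (auto simp: max_def)
    finally show ?thesis .
  qed
  have i: "integrable M (\<lambda>x. 2 powr p * (norm (f x) powr p + norm (g x) powr p))"
    using assms by (auto simp: Lp_fun_def)
  have m: "(\<lambda>x. (f x, g x)) \<in> borel_measurable M" using assms by (auto simp: Lp_fun_def)
  have i': "integrable M (\<lambda>x. norm (f x, g x) powr p)"
    by (rule Bochner_Integration.integrable_bound[OF i]) (use m le in auto)
  show "Lp_fun p M (\<lambda>x. (f x, g x))" using m i' by (simp add: Lp_fun_def)
  have "Lp_int p M (\<lambda>x. (f x, g x)) \<le> (\<integral>x. 2 powr p * (norm (f x) powr p + norm (g x) powr p) \<partial>M)"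
    unfolding Lp_int_def by (intro integral_mono i i' le)
  also have "\<dots> = 2 powr p * (Lp_int p M f + Lp_int p M g)"
    using assms by (simp add: Lp_int_def Lp_fun_def)
  finally show "Lp_int p M (\<lambda>x. (f x, g x)) \<le> 2 powr p * (Lp_int p M f + Lp_int p M g)" .
qed

lemma Lp_fun_add: "0 < p \<Longrightarrow> Lp_fun p M f \<Longrightarrow> Lp_fun p M g \<Longrightarrow> Lp_fun p M (\<lambda>x. f x + g x)"
  using Lp_fun_homog[OF _ Lp_fun_Pair(1), where \<Phi> = "\<lambda>z. fst z + snd z"]
  by (simp add: homog_linear bounded_linear_add bounded_linear_fst bounded_linear_snd)

lemma Lp_fun_diff: "0 < p \<Longrightarrow> Lp_fun p M f \<Longrightarrow> Lp_fun p M g \<Longrightarrow> Lp_fun p M (\<lambda>x. f x - g x)"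
  using Lp_fun_homog[OF _ Lp_fun_Pair(1), where \<Phi> = "\<lambda>z. fst z - snd z"]
  by (simp add: homog_linear bounded_linear_sub bounded_linear_fst bounded_linear_snd)

lemma Lp_fun_mult: "0 < p \<Longrightarrow> Lp_fun p M f \<Longrightarrow> Lp_fun p M (\<lambda>x. c * f x :: complex)"
  using Lp_fun_homog[where \<Phi> = "\<lambda>z. c * z"]
  by (simp add: homog_linear bounded_linear_mult_right)

lemma Lp_int_mult: "Lp_int p M (\<lambda>x. c * f x :: complex) = cmod c powr p * Lp_int p M f"
  by (simp add: Lp_int_def norm_mult powr_mult)

lemma Lp_int_cong_AE:
  assumes "f \<in> borel_measurable M" "g \<in> borel_measurable M" "AE x in M. f x = g x"
  shows "Lp_int p M f = Lp_int p M g"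
  unfolding Lp_int_def using assms by (intro integral_cong_AE) auto

section \<open>The duality map of \<open>L\<^sup>p\<close>\<close>

text \<open>For f in L^p the function \<open>dmap p\<close> of f represents the functional that
  norms f, scaled so that its value at f is \<open>Lp_int p M f\<close>. The conjugate sits here so
  that \<open>pairing\<close> is bilinear.\<close>

definition dmap :: "real \<Rightarrow> complex \<Rightarrow> complex" where
  "dmap p a = cnj (sgn a) * of_real (cmod a powr (p - 1))"

lemma norm_dmap: "cmod (dmap p a) = cmod a powr (p - 1)"
  by (cases "a = 0") (simp_all add: dmap_def norm_mult norm_sgn)

lemma mult_dmap: "a * dmap p a = of_real (cmod a powr p)"
proof (cases "a = 0")
  case False
  have "a * cnj (sgn a) = a * cnj a / cmod a" by (simp add: sgn_eq)
  also have "\<dots> = cmod a" using False by (simp only: complex_norm_square[symmetric]) (simp add: power2_eq_square)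
  finally have "a * dmap p a = of_real (cmod a * cmod a powr (p - 1))" by (simp add: dmap_def mult.assoc[symmetric])
  also have "cmod a * cmod a powr (p - 1) = cmod a powr p"
    using False by (simp add: powr_diff)
  finally show ?thesis .
qed (simp add: dmap_def)

lemma homog_dmap:
  assumes "1 < p"
  shows "homog (p - 1) (dmap p)"
proof (rule homogI)
  show "continuous_on UNIV (dmap p)"
    unfolding continuous_on_eq_continuous_within
  proof
    fix a :: complex
    show "isCont (dmap p) a"
    proof (cases "a = 0")
      case True
      have "((\<lambda>x. cmod x powr (p - 1)) \<longlongrightarrow> cmod (0::complex) powr (p - 1)) (at 0)"
        using assms by (intro tendsto_powr' tendsto_intros) auto
      then have "((\<lambda>x. cmod (dmap p x)) \<longlongrightarrow> 0) (at 0)"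
        by (simp add: norm_dmap)
      then have "(dmap p \<longlongrightarrow> 0) (at 0)" by (rule tendsto_norm_zero_cancel)
      moreover have "dmap p 0 = 0" by (simp add: dmap_def)
      ultimately show ?thesis using True by (simp add: isCont_def)
    next
      case False
      show ?thesis unfolding dmap_def using False assms by (intro continuous_intros) auto
    qed
  qed
  show "dmap p (r *\<^sub>R x) = (r powr (p - 1)) *\<^sub>R dmap p x" if "0 < r" for r x
    using that by (simp add: dmap_def sgn_mult norm_mult powr_mult sgn_of_real scaleR_conv_of_real)
qed

text \<open>Young's inequality for \<open>cmod c\<close> and \<open>cmod a powr (p - 1)\<close>.
  Equality holds at \<open>c = a\<close>, so it can stand in both for Hoelder's inequality and for
  the derivative of the norm.\<close>

lemma young_dmap:
  assumes "1 < p"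
  shows "Re (c * dmap p a) \<le> cmod c powr p / p + (p - 1) / p * cmod a powr p"
proof (cases "c \<noteq> 0 \<and> a \<noteq> 0")
  case True
  have "Re (c * dmap p a) \<le> cmod c * cmod a powr (p - 1)"
    using complex_Re_le_cmod[of "c * dmap p a"] by (simp add: norm_mult norm_dmap)
  also have "\<dots> = (cmod c powr p) powr (1 / p) * (cmod a powr p) powr ((p - 1) / p)"
    using assms by (simp add: powr_powr)
  also have "\<dots> \<le> 1 / p * cmod c powr p + (p - 1) / p * cmod a powr p"
    using assms True by (intro Youngs_inequality_0) (auto simp: field_simps)
  finally show ?thesis by simp
qed (use assms in \<open>auto simp: dmap_def\<close>)

definition pairing :: "'b measure \<Rightarrow> ('b \<Rightarrow> complex) \<Rightarrow> ('b \<Rightarrow> complex) \<Rightarrow> complex" where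
  "pairing M v f = (\<integral>x. v x * f x \<partial>M)"

lemma homog_mult_fst_snd:
  fixes \<Phi> :: "'e::euclidean_space \<Rightarrow> complex"
  assumes "homog (p - 1) \<Phi>"
  shows "homog p (\<lambda>z. fst z * \<Phi> (snd z))"
  using homog_mult[OF homog_fst[OF homog_id] homog_snd[OF assms]] by simp

lemma pairing_integrable:
  fixes \<Phi> :: "'e::euclidean_space \<Rightarrow> complex"
  assumes "0 < p" "Lp_fun p M v" "Lp_fun p M F" "homog (p - 1) \<Phi>"
  shows "integrable M (\<lambda>x. v x * \<Phi> (F x))"
  using Lp_fun_integrable[OF assms(1) Lp_fun_Pair(1)[OF assms(1-3)] homog_mult_fst_snd[OF assms(4)]] by simp

section \<open>Symmetric sums of powers, and pointwise disjointness for p other than 2\<close>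

definition sym_powr :: "real \<Rightarrow> real \<Rightarrow> real \<Rightarrow> real" where
  "sym_powr s A r = (A + r) powr s + (A - r) powr s"

lemma sym_powr_abs: "sym_powr s A \<bar>r\<bar> = sym_powr s A r"
  by (simp add: sym_powr_def abs_if)

lemma
  assumes "0 < s" "0 \<le> x" "x < y" "y \<le> A"
  shows sym_powr_increasing: "1 < s \<Longrightarrow> sym_powr s A x < sym_powr s A y"
    and sym_powr_decreasing: "s < 1 \<Longrightarrow> sym_powr s A y < sym_powr s A x"
proof -
  have cont: "continuous_on {x..y} (sym_powr s A)"
    unfolding sym_powr_def using assms by (intro continuous_intros continuous_on_powr') auto
  have der: "(sym_powr s A has_real_derivative s * ((A + r) powr (s - 1) - (A - r) powr (s - 1))) (at r)"
    if "x < r" "r < y" for r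
    unfolding sym_powr_def using assms that
    by (auto intro!: derivative_eq_intros simp: algebra_simps)
  show "sym_powr s A x < sym_powr s A y" if s: "1 < s"
  proof (rule DERIV_pos_imp_increasing_open[OF assms(3) _ cont])
    fix r assume r: "x < r" "r < y"
    then have "0 < s * ((A + r) powr (s - 1) - (A - r) powr (s - 1))"
      using assms s by (simp add: powr_less_mono2)
    then show "\<exists>d. (sym_powr s A has_real_derivative d) (at r) \<and> 0 < d" using der[OF r] by blast
  qed
  show "sym_powr s A y < sym_powr s A x" if s: "s < 1"
  proof (rule DERIV_neg_imp_decreasing_open[OF assms(3) _ cont])
    fix r assume r: "x < r" "r < y"
    then have "s * ((A + r) powr (s - 1) - (A - r) powr (s - 1)) < 0"
      using assms s by (intro mult_pos_neg) (auto simp: powr_less_mono2_neg)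
    then show "\<exists>d. (sym_powr s A has_real_derivative d) (at r) \<and> d < 0" using der[OF r] by blast
  qed
qed

text \<open>For \<open>s = 1\<close> the function is the constant \<open>2 * A\<close>; otherwise it
  is strictly monotone in the absolute value. With \<open>s = p - 1\<close> this is where
  \<open>p \<noteq> 2\<close> does its work.\<close>

lemma sym_powr_inj:
  assumes "0 < s" "s \<noteq> 1" "\<bar>x\<bar> \<le> A" "\<bar>y\<bar> \<le> A" "sym_powr s A x = sym_powr s A y"
  shows "\<bar>x\<bar> = \<bar>y\<bar>"
proof (rule ccontr)
  assume "\<bar>x\<bar> \<noteq> \<bar>y\<bar>"
  then consider "\<bar>x\<bar> < \<bar>y\<bar>" | "\<bar>y\<bar> < \<bar>x\<bar>" by linarith
  then show False
    using sym_powr_increasing[of s "\<bar>x\<bar>" "\<bar>y\<bar>" A] sym_powr_increasing[of s "\<bar>y\<bar>" "\<bar>x\<bar>" A]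
      sym_powr_decreasing[of s "\<bar>x\<bar>" "\<bar>y\<bar>" A] sym_powr_decreasing[of s "\<bar>y\<bar>" "\<bar>x\<bar>" A] assms
    by cases (auto simp: sym_powr_abs neq_iff)
qed

text \<open>
  If \<open>z \<mapsto> dmap p (z a + b)\<close> agrees with a function \<open>z \<mapsto> \<alpha> + \<beta> cnj z\<close> at the six points, then by
  the parallelogram law \<open>sym_powr (p - 1) A (2 Re (z a cnj b))\<close> takes the same value at
  \<open>z = 1, \<i>, \<zeta>\<close>, where \<open>A = |a|\<^sup>2 + |b|\<^sup>2\<close>.
\<close>

definition \<zeta> :: complex where "\<zeta> = Complex (3/5) (4/5)"

lemma cmod_\<zeta> [simp]: "cmod \<zeta> = 1"
  by (simp add: \<zeta>_def cmod_def power_divide)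

text \<open>The subtracted term is the value at \<open>u\<close> of the function affine in
  \<open>cnj u\<close> that interpolates the values at \<open>1\<close> and
  \<open>-1\<close>.\<close>

definition six_defect :: "real \<Rightarrow> complex \<Rightarrow> complex \<times> complex \<Rightarrow> complex" where
  "six_defect p u z = dmap p (u * fst z + snd z)
     - ((1 + cnj u) / 2 * dmap p (fst z + snd z) + (1 - cnj u) / 2 * dmap p (snd z - fst z))"

lemma dmap_disjoint:
  assumes p: "1 < p" "p \<noteq> 2" and z: "\<And>u. u \<in> {\<i>, - \<i>, \<zeta>, - \<zeta>} \<Longrightarrow> six_defect p u (a, b) = 0"
  shows "a = 0 \<or> b = 0"
proof -
  define \<alpha> \<beta> where "\<alpha> = (dmap p (a + b) + dmap p (b - a)) / 2" and "\<beta> = (dmap p (a + b) - dmap p (b - a)) / 2"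
  define A where "A = (cmod a)\<^sup>2 + (cmod b)\<^sup>2"
  define c where "c = a * cnj b"
  have K: "dmap p (u * a + b) = \<alpha> + cnj u * \<beta>" if "u \<in> {1, -1, \<i>, - \<i>, \<zeta>, - \<zeta>}" for u
  proof (cases "u = 1 \<or> u = -1")
    case True
    then show ?thesis
    proof
      assume "u = 1" then show ?thesis by (simp add: \<alpha>_def \<beta>_def field_simps)
    next
      assume "u = -1" then show ?thesis by (simp add: \<alpha>_def \<beta>_def field_simps)
    qed
  next
    case False
    then have "six_defect p u (a, b) = 0" using z that by blast
    then show ?thesis by (simp add: six_defect_def \<alpha>_def \<beta>_def field_simps)
  qed
  have nsq: "(cmod (u * a + b))\<^sup>2 = A + 2 * Re (u * c)" if "cmod u = 1" for u
  proof -
    have "(cmod (u * a + b))\<^sup>2 = (cmod (u * a))\<^sup>2 + (cmod b)\<^sup>2 + 2 * Re (u * a * cnj b)"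
      by (simp only: cmod_power2) (simp add: power2_eq_square algebra_simps)
    then show ?thesis using that by (simp add: A_def c_def norm_mult mult.assoc)
  qed
  have S: "sym_powr (p - 1) A (2 * Re (u * c)) = 2 * (cmod \<alpha>)\<^sup>2 + 2 * (cmod \<beta>)\<^sup>2"
    if u: "u \<in> {1, \<i>, \<zeta>}" for u
  proof -
    have u1: "cmod u = 1" using u by auto
    have d: "(cmod (dmap p x))\<^sup>2 = (cmod x)\<^sup>2 powr (p - 1)" for x
      by (cases "x = 0") (simp_all add: norm_dmap power2_eq_square powr_mult)
    have "sym_powr (p - 1) A (2 * Re (u * c)) = (cmod (dmap p (u * a + b)))\<^sup>2 + (cmod (dmap p (- u * a + b)))\<^sup>2"
    proof -
      have "(cmod (- u * a + b))\<^sup>2 = A - 2 * Re (u * c)" using nsq[of "- u"] u1 by simp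
      then show ?thesis using nsq[OF u1] by (simp only: sym_powr_def d)
    qed
    also have "\<dots> = (cmod (\<alpha> + cnj u * \<beta>))\<^sup>2 + (cmod (\<alpha> - cnj u * \<beta>))\<^sup>2"
      using K[of u] K[of "- u"] u by auto
    also have "\<dots> = 2 * (cmod \<alpha>)\<^sup>2 + 2 * (cmod (cnj u * \<beta>))\<^sup>2"
      by (simp only: cmod_power2) (simp add: power2_eq_square algebra_simps)
    finally show ?thesis using u1 by (simp add: norm_mult)
  qed
  have bd: "\<bar>2 * Re (u * c)\<bar> \<le> A" if "cmod u = 1" for u
  proof -
    have "\<bar>Re (u * c)\<bar> \<le> cmod a * cmod b"
      using abs_Re_le_cmod[of "u * c"] that by (simp add: c_def norm_mult)
    moreover have "2 * (cmod a * cmod b) \<le> A"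
      using sum_squares_bound[of "cmod a" "cmod b"] by (simp add: A_def)
    ultimately show ?thesis by linarith
  qed
  have eq: "\<bar>2 * Re (u * c)\<bar> = \<bar>2 * Re (1 * c)\<bar>" if "u \<in> {\<i>, \<zeta>}" for u
    using that p S[of u] S[of 1] bd[of u] bd[of 1] by (intro sym_powr_inj[of "p - 1" _ A]) auto
  \<comment> \<open>The point \<open>\<i>\<close> alone would leave the diagonals
    \<open>Im c = Re c\<close> and \<open>Im c = - Re c\<close>. On them \<open>\<zeta>\<close>
    gives 1/5 or 7/5 times \<open>\<bar>Re c\<bar>\<close>, so only \<open>c = 0\<close>
    remains.\<close>
  have "\<bar>Im c\<bar> = \<bar>Re c\<bar>" "\<bar>3 / 5 * Re c - 4 / 5 * Im c\<bar> = \<bar>Re c\<bar>"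
    using eq[of \<i>] eq[of \<zeta>] by (simp_all add: \<zeta>_def abs_mult)
  then have "Re c = 0" "Im c = 0" by (auto simp: abs_if split: if_splits)
  then have "c = 0" by (simp add: complex_eq_iff)
  then show ?thesis by (simp add: c_def)
qed

section \<open>Uniform continuity and convexity\<close>

text \<open>Here and in the next lemmas \<open>integral_transfer\<close> is applied to a pair or
  triple of functions. All there is to supply is that the controlled integrand vanishes where the
  controlling one does.\<close>

lemma Lp_int_continuous:
  assumes p: "0 < p" and e: "0 < \<epsilon>"
  obtains \<kappa> where "0 < \<kappa>"
    "\<And>f g :: 'b \<Rightarrow> complex. Lp_fun p M f \<Longrightarrow> Lp_fun p M g \<Longrightarrow> Lp_int p M f \<le> B \<Longrightarrow> Lp_int p M g \<le> B \<Longrightarrow>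
       Lp_int p M (\<lambda>x. f x - g x) \<le> \<kappa> \<Longrightarrow> \<bar>Lp_int p M f - Lp_int p M g\<bar> \<le> \<epsilon>"
proof -
  let ?\<Phi> = "\<lambda>z :: complex \<times> complex. norm (cmod (fst z) powr p - cmod (snd z) powr p)"
  let ?\<Psi> = "\<lambda>z :: complex \<times> complex. cmod (fst z - snd z) powr p"
  have h: "homog p ?\<Phi>" by (intro homog_norm homog_diff homog_cmod_fst homog_cmod_snd p)
  have h': "homog p ?\<Psi>" by (rule homog_cmod_diff[OF p])
  have nn: "0 \<le> ?\<Psi> z" and zz: "?\<Psi> z = 0 \<Longrightarrow> ?\<Phi> z \<le> 0" for z by auto
  obtain \<kappa> where k: "0 < \<kappa>" "\<And>F. Lp_fun p M F \<Longrightarrow> Lp_int p M F \<le> 2 powr p * (B + B) \<Longrightarrow>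
      (\<integral>x. ?\<Psi> (F x) \<partial>M) \<le> \<kappa> \<Longrightarrow> (\<integral>x. ?\<Phi> (F x) \<partial>M) \<le> \<epsilon>"
    using integral_transfer[OF p h h' nn zz e, of M "2 powr p * (B + B)"] by blast
  show ?thesis
  proof (rule that[OF k(1)])
    fix f g :: "'b \<Rightarrow> complex"
    assume a: "Lp_fun p M f" "Lp_fun p M g" "Lp_int p M f \<le> B" "Lp_int p M g \<le> B" "Lp_int p M (\<lambda>x. f x - g x) \<le> \<kappa>"
    have "Lp_int p M (\<lambda>x. (f x, g x)) \<le> 2 powr p * (B + B)"
      using Lp_fun_Pair(2)[OF p a(1,2)] a(3,4)
      by (rule order_trans[OF _ mult_left_mono[OF add_mono]]) auto
    then have "(\<integral>x. norm (cmod (f x) powr p - cmod (g x) powr p) \<partial>M) \<le> \<epsilon>"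
      using k(2)[OF Lp_fun_Pair(1)[OF p a(1,2)]] a(5) by (simp add: Lp_int_def)
    moreover have "\<bar>Lp_int p M f - Lp_int p M g\<bar> \<le> (\<integral>x. norm (cmod (f x) powr p - cmod (g x) powr p) \<partial>M)"
      using a integral_norm_bound[of M "\<lambda>x. cmod (f x) powr p - cmod (g x) powr p"]
      by (simp add: Lp_int_def Lp_fun_def)
    ultimately show "\<bar>Lp_int p M f - Lp_int p M g\<bar> \<le> \<epsilon>" by linarith
  qed
qed

lemma pairing_continuous:
  assumes p: "1 < p" and e: "0 < \<epsilon>"
  obtains \<kappa> where "0 < \<kappa>"
    "\<And>v f g :: 'b \<Rightarrow> complex. Lp_fun p M v \<Longrightarrow> Lp_fun p M f \<Longrightarrow> Lp_fun p M g \<Longrightarrow>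
       Lp_int p M v \<le> B \<Longrightarrow> Lp_int p M f \<le> B \<Longrightarrow> Lp_int p M g \<le> B \<Longrightarrow> Lp_int p M (\<lambda>x. f x - g x) \<le> \<kappa> \<Longrightarrow>
       cmod (pairing M v (\<lambda>x. dmap p (f x)) - pairing M v (\<lambda>x. dmap p (g x))) \<le> \<epsilon>"
proof -
  have p0: "0 < p" using p by simp
  let ?\<Phi> = "\<lambda>z :: complex \<times> complex \<times> complex. cmod (fst z * (dmap p (fst (snd z)) - dmap p (snd (snd z))))"
  let ?\<Psi> = "\<lambda>z :: complex \<times> complex \<times> complex. cmod (fst (snd z) - snd (snd z)) powr p"
  have hd: "homog (p - 1) (\<lambda>w :: complex \<times> complex. dmap p (fst w) - dmap p (snd w))"
    using homog_dmap[OF p] by (intro homog_diff homog_fst homog_snd)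
  have h: "homog p ?\<Phi>" by (rule homog_norm[OF homog_mult_fst_snd[OF hd]])
  have h': "homog p ?\<Psi>"
    using homog_snd[OF homog_cmod_diff[OF p0]] by simp
  have nn: "0 \<le> ?\<Psi> z" and zz: "?\<Psi> z = 0 \<Longrightarrow> ?\<Phi> z \<le> 0" for z by auto
  obtain \<kappa> where k: "0 < \<kappa>" "\<And>F. Lp_fun p M F \<Longrightarrow> Lp_int p M F \<le> 2 powr p * (B + 2 powr p * (B + B)) \<Longrightarrow>
      (\<integral>x. ?\<Psi> (F x) \<partial>M) \<le> \<kappa> \<Longrightarrow> (\<integral>x. ?\<Phi> (F x) \<partial>M) \<le> \<epsilon>"
    using integral_transfer[OF p0 h h' nn zz e, of M "2 powr p * (B + 2 powr p * (B + B))"] by blast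
  show ?thesis
  proof (rule that[OF k(1)])
    fix v f g :: "'b \<Rightarrow> complex"
    assume v: "Lp_fun p M v" "Lp_int p M v \<le> B"
      and a: "Lp_fun p M f" "Lp_fun p M g" "Lp_int p M f \<le> B" "Lp_int p M g \<le> B" "Lp_int p M (\<lambda>x. f x - g x) \<le> \<kappa>"
    have fg: "Lp_int p M (\<lambda>x. (f x, g x)) \<le> 2 powr p * (B + B)"
      using Lp_fun_Pair(2)[OF p0 a(1,2)] a(3,4)
      by (rule order_trans[OF _ mult_left_mono[OF add_mono]]) auto
    have F: "Lp_fun p M (\<lambda>x. (v x, f x, g x))" by (intro Lp_fun_Pair p0 v a)
    have "Lp_int p M (\<lambda>x. (v x, f x, g x)) \<le> 2 powr p * (B + 2 powr p * (B + B))"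
      using Lp_fun_Pair(2)[OF p0 v(1) Lp_fun_Pair(1)[OF p0 a(1,2)]] v(2) fg
      by (rule order_trans[OF _ mult_left_mono[OF add_mono]]) auto
    then have le: "(\<integral>x. cmod (v x * (dmap p (f x) - dmap p (g x))) \<partial>M) \<le> \<epsilon>"
      using k(2)[OF F] a(5) by (simp add: Lp_int_def)
    have "pairing M v (\<lambda>x. dmap p (f x)) - pairing M v (\<lambda>x. dmap p (g x)) = (\<integral>x. v x * (dmap p (f x) - dmap p (g x)) \<partial>M)"
      unfolding pairing_def right_diff_distrib
      by (intro Bochner_Integration.integral_diff[symmetric] pairing_integrable[OF p0 v(1) _ homog_dmap[OF p]] a)
    then show "cmod (pairing M v (\<lambda>x. dmap p (f x)) - pairing M v (\<lambda>x. dmap p (g x))) \<le> \<epsilon>"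
      by (simp only:) (rule order_trans[OF integral_norm_bound le])
  qed
qed

lemma pairing_small:
  assumes p: "1 < p" and e: "0 < \<epsilon>"
  obtains \<kappa> where "0 < \<kappa>"
    "\<And>v f :: 'b \<Rightarrow> complex. Lp_fun p M v \<Longrightarrow> Lp_fun p M f \<Longrightarrow> Lp_int p M v \<le> B \<Longrightarrow> Lp_int p M f \<le> B \<Longrightarrow>
       Lp_int p M v \<le> \<kappa> \<Longrightarrow> cmod (pairing M v (\<lambda>x. dmap p (f x))) \<le> \<epsilon>"
proof -
  have p0: "0 < p" using p by simp
  let ?\<Phi> = "\<lambda>z :: complex \<times> complex. cmod (fst z * dmap p (snd z))"
  let ?\<Psi> = "\<lambda>z :: complex \<times> complex. cmod (fst z) powr p"
  have h: "homog p ?\<Phi>" by (rule homog_norm[OF homog_mult_fst_snd[OF homog_dmap[OF p]]])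
  have h': "homog p ?\<Psi>" using homog_norm_powr[OF homog_fst[OF homog_id] p0] by simp
  have nn: "0 \<le> ?\<Psi> z" and zz: "?\<Psi> z = 0 \<Longrightarrow> ?\<Phi> z \<le> 0" for z by auto
  obtain \<kappa> where k: "0 < \<kappa>" "\<And>F. Lp_fun p M F \<Longrightarrow> Lp_int p M F \<le> 2 powr p * (B + B) \<Longrightarrow>
      (\<integral>x. ?\<Psi> (F x) \<partial>M) \<le> \<kappa> \<Longrightarrow> (\<integral>x. ?\<Phi> (F x) \<partial>M) \<le> \<epsilon>"
    using integral_transfer[OF p0 h h' nn zz e, of M "2 powr p * (B + B)"] by blast
  show ?thesis
  proof (rule that[OF k(1)])
    fix v f :: "'b \<Rightarrow> complex"
    assume a: "Lp_fun p M v" "Lp_fun p M f" "Lp_int p M v \<le> B" "Lp_int p M f \<le> B" "Lp_int p M v \<le> \<kappa>"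
    have "Lp_int p M (\<lambda>x. (v x, f x)) \<le> 2 powr p * (B + B)"
      using Lp_fun_Pair(2)[OF p0 a(1,2)] a(3,4)
      by (rule order_trans[OF _ mult_left_mono[OF add_mono]]) auto
    then have le: "(\<integral>x. cmod (v x * dmap p (f x)) \<partial>M) \<le> \<epsilon>"
      using k(2)[OF Lp_fun_Pair(1)[OF p0 a(1,2)]] a(5) by (simp add: Lp_int_def)
    show "cmod (pairing M v (\<lambda>x. dmap p (f x))) \<le> \<epsilon>"
      unfolding pairing_def by (rule order_trans[OF integral_norm_bound le])
  qed
qed

text \<open>Write the two moduli as \<open>A + r\<close> and \<open>A - r\<close>. Convexity is the
  monotonicity of \<open>sym_powr p A\<close> in \<open>r\<close>; equality forces
  \<open>r = 0\<close> and, through the triangle inequality, equal arguments.\<close>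

lemma midpoint_powr:
  fixes a b :: complex
  assumes p: "1 < p"
  shows "cmod (a + b) powr p \<le> 2 powr p * ((cmod a powr p + cmod b powr p) / 2)"
    and "cmod (a + b) powr p = 2 powr p * ((cmod a powr p + cmod b powr p) / 2) \<Longrightarrow> a = b"
proof -
  define A where "A = (cmod a + cmod b) / 2"
  define r where "r = \<bar>cmod a - cmod b\<bar> / 2"
  have F0: "sym_powr p A 0 = 2 * A powr p" by (simp add: sym_powr_def)
  have Fr: "sym_powr p A r = cmod a powr p + cmod b powr p"
    unfolding r_def A_def sym_powr_def by (simp add: abs_if field_simps)
  have r: "0 \<le> r" "r \<le> A" by (auto simp: r_def A_def abs_if field_simps)
  have lt: "sym_powr p A 0 < sym_powr p A r" if "0 < r"
    using p r that by (intro sym_powr_increasing) auto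
  have le: "sym_powr p A 0 \<le> sym_powr p A r"
    using lt r by (cases "r = 0") auto
  have ab: "cmod (a + b) \<le> 2 * A" using norm_triangle_ineq[of a b] by (simp add: A_def)
  have abp: "cmod (a + b) powr p \<le> 2 powr p * A powr p"
    using powr_mono2[OF _ _ ab, of p] p r by (simp add: powr_mult)
  have "2 powr p * A powr p \<le> 2 powr p * (sym_powr p A r / 2)" using le by (simp add: F0)
  with abp show "cmod (a + b) powr p \<le> 2 powr p * ((cmod a powr p + cmod b powr p) / 2)"
    by (simp only: Fr)
  assume eq: "cmod (a + b) powr p = 2 powr p * ((cmod a powr p + cmod b powr p) / 2)"
  then have "2 powr p * (sym_powr p A r / 2) \<le> 2 powr p * A powr p" using abp by (simp only: Fr)
  then have "sym_powr p A r / 2 \<le> A powr p" by (rule mult_left_le_imp_le) simp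
  then have "\<not> 0 < r" using lt F0 by linarith
  then have ra: "cmod a = cmod b" using r by (simp add: r_def)
  have "cmod (a + b) powr p = (2 * A) powr p" using eq r ra by (simp add: A_def powr_mult)
  then have "cmod (a + b) = 2 * A"
    using powr_less_mono2[of p "cmod (a + b)" "2 * A"] p ab by (cases "cmod (a + b) < 2 * A") auto
  then have "cmod (a + b) = cmod a + cmod b" by (simp add: A_def)
  then have "cmod a *\<^sub>R b = cmod b *\<^sub>R a" by (simp only: norm_triangle_eq)
  then show "a = b" using ra by (cases "a = 0") auto
qed

text \<open>Uniform convexity follows from strict convexity on numbers: the midpoint defect is
  homogeneous and vanishes only on the diagonal. Neither Clarkson's inequalities nor a distinction
  between p below and above 2 enters.\<close>

lemma Lp_uniformly_convex:
  assumes p: "1 < p" and e: "0 < \<epsilon>"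
  obtains \<kappa> where "0 < \<kappa>"
    "\<And>f g :: 'b \<Rightarrow> complex. Lp_fun p M f \<Longrightarrow> Lp_fun p M g \<Longrightarrow> Lp_int p M f \<le> 1 \<Longrightarrow> Lp_int p M g \<le> 1 \<Longrightarrow>
       2 powr p * (1 - \<kappa>) \<le> Lp_int p M (\<lambda>x. f x + g x) \<Longrightarrow> Lp_int p M (\<lambda>x. f x - g x) \<le> \<epsilon>"
proof -
  have p0: "0 < p" using p by simp
  let ?\<Phi> = "\<lambda>z :: complex \<times> complex. cmod (fst z - snd z) powr p"
  let ?\<Psi> = "\<lambda>z :: complex \<times> complex. 2 powr p * (1 / 2 * (cmod (fst z) powr p + cmod (snd z) powr p)) - cmod (fst z + snd z) powr p"
  have h: "homog p ?\<Phi>" by (rule homog_cmod_diff[OF p0])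
  have h': "homog p ?\<Psi>" by (intro homog_diff homog_cmult homog_add homog_cmod_fst homog_cmod_snd homog_cmod_add p0)
  have nn: "0 \<le> ?\<Psi> z" for z using midpoint_powr(1)[OF p, of "fst z" "snd z"] by simp
  have zz: "?\<Phi> z \<le> 0" if "?\<Psi> z = 0" for z using midpoint_powr(2)[OF p, of "fst z" "snd z"] that by simp
  obtain \<kappa> where k: "0 < \<kappa>" "\<And>F. Lp_fun p M F \<Longrightarrow> Lp_int p M F \<le> 2 powr p * (1 + 1) \<Longrightarrow>
      (\<integral>x. ?\<Psi> (F x) \<partial>M) \<le> \<kappa> \<Longrightarrow> (\<integral>x. ?\<Phi> (F x) \<partial>M) \<le> \<epsilon>"
    using integral_transfer[OF p0 h h' nn zz e, of M "2 powr p * (1 + 1)"] by blast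
  show ?thesis
  proof (rule that)
    show "0 < \<kappa> / 2 powr p" using k(1) by simp
    fix f g :: "'b \<Rightarrow> complex"
    assume a: "Lp_fun p M f" "Lp_fun p M g" "Lp_int p M f \<le> 1" "Lp_int p M g \<le> 1"
      "2 powr p * (1 - \<kappa> / 2 powr p) \<le> Lp_int p M (\<lambda>x. f x + g x)"
    have "Lp_int p M (\<lambda>x. (f x, g x)) \<le> 2 powr p * (1 + 1)"
      using Lp_fun_Pair(2)[OF p0 a(1,2)] a(3,4)
      by (rule order_trans[OF _ mult_left_mono[OF add_mono]]) auto
    moreover have "(\<integral>x. ?\<Psi> (f x, g x) \<partial>M) \<le> \<kappa>"
    proof -
      have i: "integrable M (\<lambda>x. cmod (f x) powr p)" "integrable M (\<lambda>x. cmod (g x) powr p)"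
        "integrable M (\<lambda>x. cmod (f x + g x) powr p)"
        using a Lp_fun_add[OF p0 a(1,2)] by (auto simp: Lp_fun_def)
      have "(\<integral>x. ?\<Psi> (f x, g x) \<partial>M) = 2 powr p * (1 / 2 * (Lp_int p M f + Lp_int p M g)) - Lp_int p M (\<lambda>x. f x + g x)"
        using i by (simp add: Lp_int_def)
      also have "\<dots> \<le> 2 powr p * (1 / 2 * (1 + 1)) - 2 powr p * (1 - \<kappa> / 2 powr p)"
        using a by (intro diff_mono mult_left_mono add_mono) auto
      also have "\<dots> = \<kappa>" by (simp add: algebra_simps)
      finally show ?thesis .
    qed
    ultimately show "Lp_int p M (\<lambda>x. f x - g x) \<le> \<epsilon>"
      using k(2)[OF Lp_fun_Pair(1)[OF p0 a(1,2)]] by (simp add: Lp_int_def)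
  qed
qed

section \<open>Representations on \<open>L\<^sup>p\<close>\<close>

text \<open>The last two assumptions say that the representation is isometric, in p-th powers and
  without a supremum: vectors need only nearly attain the norm.\<close>

locale Lp_representation =
  fixes p :: real and M :: "'b measure" and \<pi> :: "'a::complex_banach_algebra \<Rightarrow> 'b fun_op"
  assumes p: "1 < p"
    and rep_in: "Lp_fun p M f \<Longrightarrow> Lp_fun p M (\<pi> a f)"
    and rep_add_vec: "Lp_fun p M f \<Longrightarrow> Lp_fun p M g \<Longrightarrow> AE t in M. \<pi> a (\<lambda>t. f t + g t) t = \<pi> a f t + \<pi> a g t"
    and rep_mult_vec: "Lp_fun p M f \<Longrightarrow> AE t in M. \<pi> a (\<lambda>t. c * f t) t = c * \<pi> a f t"
    and rep_add: "Lp_fun p M f \<Longrightarrow> AE t in M. \<pi> (a + b) f t = \<pi> a f t + \<pi> b f t"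
    and rep_scaleC: "Lp_fun p M f \<Longrightarrow> AE t in M. \<pi> (c *\<^sub>C a) f t = c * \<pi> a f t"
    and rep_mult: "Lp_fun p M f \<Longrightarrow> AE t in M. \<pi> (a * b) f t = \<pi> a (\<pi> b f) t"
    and rep_bound: "Lp_fun p M f \<Longrightarrow> Lp_int p M (\<pi> a f) \<le> norm a powr p * Lp_int p M f"
    and rep_norming: "0 \<le> r \<Longrightarrow> r < norm a \<Longrightarrow> \<exists>f. Lp_fun p M f \<and> Lp_int p M f \<le> 1 \<and> r powr p < Lp_int p M (\<pi> a f)"
begin

abbreviation "\<I> \<equiv> Lp_int p M"
abbreviation "\<L> \<equiv> Lp_fun p M"
abbreviation J :: "('b \<Rightarrow> complex) \<Rightarrow> 'b \<Rightarrow> complex" where "J f \<equiv> \<lambda>t. dmap p (f t)"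

lemma p0: "0 < p" using p by simp

lemma meas: "\<L> f \<Longrightarrow> f \<in> borel_measurable M"
  by (simp add: Lp_fun_def)

lemmas \<L>_intros = rep_in Lp_fun_add[OF p0] Lp_fun_diff[OF p0] Lp_fun_mult[OF p0]

lemma rep_diff: "\<L> f \<Longrightarrow> AE t in M. \<pi> (a - b) f t = \<pi> a f t - \<pi> b f t"
  using rep_add[of f a "- b"] rep_scaleC[of f "- 1" b]
  by (auto simp: scaleC_minus_one elim: eventually_elim2)

lemma Lp_int_add_le:
  fixes f g :: "'b \<Rightarrow> complex"
  assumes "\<L> f" "\<L> g"
  shows "\<I> (\<lambda>t. f t + g t) \<le> 2 powr p * (\<I> f + \<I> g)"
proof -
  have "\<I> (\<lambda>t. f t + g t) \<le> (\<integral>t. 2 powr p * ((cmod (f t) powr p + cmod (g t) powr p) / 2) \<partial>M)"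
    unfolding Lp_int_def using assms Lp_fun_add[OF p0 assms] midpoint_powr(1)[OF p]
    by (intro integral_mono) (auto simp: Lp_fun_def)
  also have "\<dots> = 2 powr p * ((\<I> f + \<I> g) / 2)" using assms by (simp add: Lp_int_def Lp_fun_def)
  also have "\<dots> \<le> 2 powr p * (\<I> f + \<I> g)"
    using Lp_int_nonneg[of p M f] Lp_int_nonneg[of p M g] by (intro mult_left_mono) auto
  finally show ?thesis .
qed

lemma rep_bound_le: "\<L> f \<Longrightarrow> norm a \<le> r \<Longrightarrow> \<I> f \<le> B \<Longrightarrow> \<I> (\<pi> a f) \<le> r powr p * B"
  using rep_bound[of f a] p0
  by (meson Lp_int_nonneg mult_mono norm_ge_zero order_trans powr_ge_zero powr_mono2 less_imp_le)

lemma rep_tendsto_0: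
  assumes "(\<lambda>n. norm (a n)) \<longlonglongrightarrow> 0" "\<And>n. \<L> (f n)" "\<And>n. \<I> (f n) \<le> B"
  shows "(\<lambda>n. \<I> (\<pi> (a n) (f n))) \<longlonglongrightarrow> 0"
proof (rule tendsto_sandwich)
  show "\<forall>\<^sub>F n in sequentially. 0 \<le> \<I> (\<pi> (a n) (f n))" by (simp add: Lp_int_nonneg)
  show "\<forall>\<^sub>F n in sequentially. \<I> (\<pi> (a n) (f n)) \<le> norm (a n) powr p * B"
    using assms rep_bound_le by (intro always_eventually allI) blast
  have "(\<lambda>n. norm (a n) powr p) \<longlonglongrightarrow> 0 powr p"
    using assms(1) p0 by (intro tendsto_powr') auto
  then show "(\<lambda>n. norm (a n) powr p * B) \<longlonglongrightarrow> 0" by (intro tendsto_mult_left_zero) simp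
qed simp

lemma Lp_int_tendsto_diff:
  fixes f g :: "nat \<Rightarrow> 'b \<Rightarrow> complex"
  assumes "\<And>n. \<L> (f n)" "\<And>n. \<L> (g n)" "\<And>n. \<I> (f n) \<le> B" "\<And>n. \<I> (g n) \<le> B"
    "(\<lambda>n. \<I> (\<lambda>t. f n t - g n t)) \<longlonglongrightarrow> 0"
  shows "(\<lambda>n. \<I> (f n) - \<I> (g n)) \<longlonglongrightarrow> 0"
proof (rule LIMSEQ_I)
  fix r :: real assume r: "0 < r"
  obtain \<kappa> where k: "0 < \<kappa>" "\<And>f g :: 'b \<Rightarrow> complex. \<L> f \<Longrightarrow> \<L> g \<Longrightarrow> \<I> f \<le> B \<Longrightarrow> \<I> g \<le> B \<Longrightarrow>
       \<I> (\<lambda>x. f x - g x) \<le> \<kappa> \<Longrightarrow> \<bar>\<I> f - \<I> g\<bar> \<le> r / 2"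
    using Lp_int_continuous[OF p0, of "r / 2" M B] r by auto
  have "\<forall>\<^sub>F n in sequentially. \<I> (\<lambda>t. f n t - g n t) < \<kappa>"
    using assms(5) k(1) by (rule order_tendstoD)
  then have "\<forall>\<^sub>F n in sequentially. norm (\<I> (f n) - \<I> (g n) - 0) < r"
  proof eventually_elim
    case (elim n)
    then have "\<bar>\<I> (f n) - \<I> (g n)\<bar> \<le> r / 2" using assms by (intro k(2)) auto
    then show ?case using r by simp
  qed
  then show "\<exists>no. \<forall>n\<ge>no. norm (\<I> (f n) - \<I> (g n) - 0) < r" by (simp add: eventually_sequentially)
qed

lemma pairing_tendsto_diff:
  fixes f g :: "nat \<Rightarrow> 'b \<Rightarrow> complex"
  assumes "\<And>n. \<L> (f n)" "\<And>n. \<L> (g n)" "\<And>n. \<I> (f n) \<le> B" "\<And>n. \<I> (g n) \<le> B"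
    "(\<lambda>n. \<I> (\<lambda>t. f n t - g n t)) \<longlonglongrightarrow> 0" "\<And>n. \<L> (v n)" "\<And>n. \<I> (v n) \<le> B"
  shows "(\<lambda>n. pairing M (v n) (J (f n)) - pairing M (v n) (J (g n))) \<longlonglongrightarrow> 0"
proof (rule LIMSEQ_I)
  fix r :: real assume r: "0 < r"
  obtain \<kappa> where k: "0 < \<kappa>" "\<And>v f g :: 'b \<Rightarrow> complex. \<L> v \<Longrightarrow> \<L> f \<Longrightarrow> \<L> g \<Longrightarrow> \<I> v \<le> B \<Longrightarrow> \<I> f \<le> B \<Longrightarrow> \<I> g \<le> B \<Longrightarrow>
       \<I> (\<lambda>x. f x - g x) \<le> \<kappa> \<Longrightarrow> cmod (pairing M v (J f) - pairing M v (J g)) \<le> r / 2"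
    using pairing_continuous[OF p, of "r / 2" M B] r by auto
  have "\<forall>\<^sub>F n in sequentially. \<I> (\<lambda>t. f n t - g n t) < \<kappa>"
    using assms(5) k(1) by (rule order_tendstoD)
  then have "\<forall>\<^sub>F n in sequentially. norm (pairing M (v n) (J (f n)) - pairing M (v n) (J (g n)) - 0) < r"
  proof eventually_elim
    case (elim n)
    then have "cmod (pairing M (v n) (J (f n)) - pairing M (v n) (J (g n))) \<le> r / 2" using assms by (intro k(2)) auto
    then show ?case using r by simp
  qed
  then show "\<exists>no. \<forall>n\<ge>no. norm (pairing M (v n) (J (f n)) - pairing M (v n) (J (g n)) - 0) < r"
    by (simp add: eventually_sequentially)
qed

lemma pairing_tendsto_0:
  fixes f v :: "nat \<Rightarrow> 'b \<Rightarrow> complex"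
  assumes "\<And>n. \<L> (f n)" "\<And>n. \<I> (f n) \<le> B" "\<And>n. \<L> (v n)" "(\<lambda>n. \<I> (v n)) \<longlonglongrightarrow> 0"
  shows "(\<lambda>n. pairing M (v n) (J (f n))) \<longlonglongrightarrow> 0"
proof (rule LIMSEQ_I)
  fix r :: real assume r: "0 < r"
  obtain \<kappa> where k: "0 < \<kappa>" "\<And>v f :: 'b \<Rightarrow> complex. \<L> v \<Longrightarrow> \<L> f \<Longrightarrow> \<I> v \<le> max B 1 \<Longrightarrow> \<I> f \<le> max B 1 \<Longrightarrow>
       \<I> v \<le> \<kappa> \<Longrightarrow> cmod (pairing M v (J f)) \<le> r / 2"
    using pairing_small[OF p, of "r / 2" M "max B 1"] r by auto
  have "\<forall>\<^sub>F n in sequentially. \<I> (v n) < min \<kappa> 1"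
    using assms(4) k(1) by (intro order_tendstoD) auto
  then have "\<forall>\<^sub>F n in sequentially. norm (pairing M (v n) (J (f n)) - 0) < r"
  proof eventually_elim
    case (elim n)
    have "\<I> (f n) \<le> max B 1" using assms(2)[of n] by simp
    then have "cmod (pairing M (v n) (J (f n))) \<le> r / 2" using assms elim by (intro k(2)) auto
    then show ?case using r by simp
  qed
  then show "\<exists>no. \<forall>n\<ge>no. norm (pairing M (v n) (J (f n)) - 0) < r"
    by (simp add: eventually_sequentially)
qed

lemma pairing_int: "\<L> v \<Longrightarrow> \<L> f \<Longrightarrow> integrable M (\<lambda>t. v t * dmap p (f t))"
  by (rule pairing_integrable[OF p0 _ _ homog_dmap[OF p]])

lemma pairing_add: "\<L> v \<Longrightarrow> \<L> w \<Longrightarrow> \<L> f \<Longrightarrow> pairing M (\<lambda>t. v t + w t) (J f) = pairing M v (J f) + pairing M w (J f)"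
  by (simp add: pairing_def distrib_right pairing_int)

lemma pairing_mult: "\<L> v \<Longrightarrow> \<L> f \<Longrightarrow> pairing M (\<lambda>t. c * v t) (J f) = c * pairing M v (J f)"
  by (simp add: pairing_def mult.assoc)

lemma pairing_cong_AE:
  assumes "\<L> v" "\<L> w" "\<L> f" "AE t in M. v t = w t"
  shows "pairing M v (J f) = pairing M w (J f)"
proof -
  have [measurable]: "v \<in> borel_measurable M" "w \<in> borel_measurable M" "(\<lambda>t. dmap p (f t)) \<in> borel_measurable M"
    using assms homog_measurable[OF homog_dmap[OF p] meas] by (auto dest: meas)
  show ?thesis unfolding pairing_def
    by (rule integral_cong_AE) (use assms(4) in auto)
qed

lemma pairing_rep_add: "\<L> v \<Longrightarrow> \<L> f \<Longrightarrow> pairing M (\<pi> (a + b) v) (J f) = pairing M (\<pi> a v) (J f) + pairing M (\<pi> b v) (J f)"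
  by (subst pairing_add[symmetric]) (auto intro!: pairing_cong_AE rep_add \<L>_intros)

lemma pairing_rep_scaleC: "\<L> v \<Longrightarrow> \<L> f \<Longrightarrow> pairing M (\<pi> (c *\<^sub>C a) v) (J f) = c * pairing M (\<pi> a v) (J f)"
  by (subst pairing_mult[symmetric]) (auto intro!: pairing_cong_AE rep_scaleC \<L>_intros)

lemma Re_pairing: "\<L> v \<Longrightarrow> \<L> f \<Longrightarrow> Re (pairing M v (J f)) = (\<integral>t. Re (v t * dmap p (f t)) \<partial>M)"
  unfolding pairing_def by (rule integral_Re[OF pairing_int, symmetric])

lemma pairing_self: "pairing M f (J f) = of_real (\<I> f)"
  by (simp add: pairing_def mult_dmap Lp_int_def)

lemma pairing_young:
  assumes "\<L> v" "\<L> f"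
  shows "Re (pairing M v (J f)) \<le> \<I> v / p + (p - 1) / p * \<I> f"
proof -
  have "Re (pairing M v (J f)) \<le> (\<integral>t. cmod (v t) powr p / p + (p - 1) / p * cmod (f t) powr p \<partial>M)"
    unfolding Re_pairing[OF assms]
  proof (rule integral_mono)
    show "integrable M (\<lambda>t. Re (v t * dmap p (f t)))" by (rule integrable_Re[OF pairing_int[OF assms]])
    show "integrable M (\<lambda>t. cmod (v t) powr p / p + (p - 1) / p * cmod (f t) powr p)"
      using assms by (auto simp: Lp_fun_def)
  qed (rule young_dmap[OF p])
  also have "\<dots> = \<I> v / p + (p - 1) / p * \<I> f" using assms by (simp add: Lp_int_def Lp_fun_def)
  finally show ?thesis .
qed

text \<open>
  The functional \<open>v \<mapsto> \<langle>V v, J (V w)\<rangle>\<close> is dominated, up to a constant, by the norm and nearly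
  attains it at \<open>w\<close>. Young's inequality replaces the differentiation of the norm.
\<close>

lemma smoothness_ineq:
  assumes "\<L> v" "\<L> w" "norm a \<le> r"
  shows "t * p * Re (pairing M (\<pi> a v) (J (\<pi> a w)) - pairing M v (J (\<lambda>x. w x + t * v x)))
     \<le> (r powr p - 1) * \<I> (\<lambda>x. w x + t * v x) + (\<I> w - \<I> (\<pi> a w))"
proof -
  let ?u = "\<lambda>x. w x + t * v x"
  note L = assms(1,2)
  have u: "\<L> ?u" by (intro \<L>_intros L)
  have "AE x in M. \<pi> a ?u x = \<pi> a w x + t * \<pi> a v x"
    using rep_add_vec[OF L(2) Lp_fun_mult[OF p0 L(1), of t], of a] rep_mult_vec[OF L(1), of a t] by eventually_elim simp
  then have "pairing M (\<pi> a ?u) (J (\<pi> a w)) = pairing M (\<lambda>x. \<pi> a w x + t * \<pi> a v x) (J (\<pi> a w))"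
    by (intro pairing_cong_AE \<L>_intros L)
  also have "\<dots> = \<I> (\<pi> a w) + t * pairing M (\<pi> a v) (J (\<pi> a w))"
    by (subst pairing_add) (auto intro!: \<L>_intros L simp: pairing_mult pairing_self L rep_in)
  finally have "Re (pairing M (\<pi> a ?u) (J (\<pi> a w))) = \<I> (\<pi> a w) + t * Re (pairing M (\<pi> a v) (J (\<pi> a w)))"
    by simp
  moreover have "Re (pairing M (\<pi> a ?u) (J (\<pi> a w))) \<le> \<I> (\<pi> a ?u) / p + (p - 1) / p * \<I> (\<pi> a w)"
    by (intro pairing_young \<L>_intros L)
  moreover have "\<I> (\<pi> a ?u) \<le> r powr p * \<I> ?u" by (rule rep_bound_le[OF u assms(3) order_refl])
  ultimately have "p * (\<I> (\<pi> a w) + t * Re (pairing M (\<pi> a v) (J (\<pi> a w)))) \<le> r powr p * \<I> ?u + (p - 1) * \<I> (\<pi> a w)"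
    using p0 by (simp add: field_simps)
  then have 1: "t * p * Re (pairing M (\<pi> a v) (J (\<pi> a w))) \<le> r powr p * \<I> ?u - \<I> (\<pi> a w)"
    by (simp add: algebra_simps)
  \<comment> \<open>Young's inequality once more, now for \<open>w\<close>, which is
    \<open>?u\<close> minus \<open>t\<close> times \<open>v\<close>, against the functional at
    \<open>?u\<close>. It bounds the difference quotient from the other side, and adding the two
    bounds gives the claim.\<close>
  have "pairing M (\<lambda>x. ?u x + c * v x) (J ?u) = \<I> ?u + c * pairing M v (J ?u)" for c
    by (simp only: pairing_add[OF u Lp_fun_mult[OF p0 L(1)] u] pairing_self pairing_mult[OF L(1) u])
  from this[of "- of_real t"] have "pairing M w (J ?u) = \<I> ?u - t * pairing M v (J ?u)" by simp
  then have "Re (pairing M w (J ?u)) = \<I> ?u - t * Re (pairing M v (J ?u))" by simp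
  moreover have "Re (pairing M w (J ?u)) \<le> \<I> w / p + (p - 1) / p * \<I> ?u"
    by (intro pairing_young L u)
  moreover have "A \<le> b / p + (p - 1) / p * i \<Longrightarrow> p * A \<le> b + (p - 1) * i" for A b i
    using p0 by (simp add: field_simps)
  ultimately have "p * (\<I> ?u - t * Re (pairing M v (J ?u))) \<le> \<I> w + (p - 1) * \<I> ?u"
    by presburger
  then have "\<I> ?u - \<I> w \<le> t * p * Re (pairing M v (J ?u))" by (simp add: algebra_simps)
  with 1 show ?thesis by (simp add: algebra_simps)
qed

text \<open>The step \<open>t\<close> is fixed first, so small that moving the base point from
  \<open>w\<close> to \<open>w\<close> plus \<open>t\<close> times \<open>v\<close> changes the
  functional by at most \<open>\<epsilon> / 2\<close>. For this fixed \<open>t\<close> the right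
  side of \<open>smoothness_ineq\<close> tends to 0.\<close>

lemma smoothness_one_sided:
  assumes a: "\<And>n. norm (a n) \<le> \<rho> n" "\<rho> \<longlonglongrightarrow> 1"
    and v: "\<And>n. \<L> (v n)" "\<And>n. \<I> (v n) \<le> B"
    and w: "\<And>n. \<L> (w n)" "\<And>n. \<I> (w n) \<le> B"
    and lim: "(\<lambda>n. \<I> (\<pi> (a n) (w n)) - \<I> (w n)) \<longlonglongrightarrow> 0" and e: "0 < \<epsilon>"
  shows "\<forall>\<^sub>F n in sequentially.
    Re (pairing M (\<pi> (a n) (v n)) (J (\<pi> (a n) (w n))) - pairing M (v n) (J (w n))) \<le> \<epsilon>"
proof -
  have B0: "0 \<le> B" using v(2)[of 0] Lp_int_nonneg[of p M "v 0"] by linarith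
  define B' where "B' = 2 powr p * (B + B)"
  have B': "B \<le> B'" "0 \<le> B'"
  proof -
    have "1 * B \<le> 2 powr p * (B + B)" using B0 p0 by (intro mult_mono) (auto simp: ge_one_powr_ge_zero)
    then show "B \<le> B'" by (simp add: B'_def)
    then show "0 \<le> B'" using B0 by simp
  qed
  obtain \<kappa> where k: "0 < \<kappa>" "\<And>v f g :: 'b \<Rightarrow> complex. \<L> v \<Longrightarrow> \<L> f \<Longrightarrow> \<L> g \<Longrightarrow> \<I> v \<le> B' \<Longrightarrow> \<I> f \<le> B' \<Longrightarrow> \<I> g \<le> B' \<Longrightarrow>
       \<I> (\<lambda>x. f x - g x) \<le> \<kappa> \<Longrightarrow> cmod (pairing M v (J f) - pairing M v (J g)) \<le> \<epsilon> / 2"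
    using pairing_continuous[OF p, of "\<epsilon> / 2" M B'] e by auto
  \<comment> \<open>This makes the p-th power of the norm of \<open>t\<close> times \<open>v\<close>
    at most \<open>\<kappa>\<close>; the cap at 1 keeps it below \<open>B\<close> as well.\<close>
  define t where "t = min 1 ((\<kappa> / (B + 1)) powr (1 / p))"
  have t: "0 < t" "t \<le> 1" using k(1) B0 by (auto simp: t_def)
  have "t powr p \<le> ((\<kappa> / (B + 1)) powr (1 / p)) powr p"
    using t p0 by (intro powr_mono2) (auto simp: t_def)
  also have "\<dots> = \<kappa> / (B + 1)" using p0 k(1) B0 by (simp add: powr_powr)
  finally have tp: "t powr p * (B + 1) \<le> \<kappa>" using B0 by (simp add: field_simps)
  let ?u = "\<lambda>n x. w n x + complex_of_real t * v n x"
  have tp1: "t powr p \<le> 1" using t p0 by (simp add: powr_le1)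
  have tv: "\<I> (\<lambda>x. complex_of_real t * v n x) \<le> min \<kappa> B" for n
  proof -
    have "t powr p * \<I> (v n) \<le> t powr p * B" using v by (intro mult_left_mono) auto
    moreover have "t powr p * B \<le> t powr p * (B + 1)" by (intro mult_left_mono) auto
    moreover have "t powr p * B \<le> 1 * B" using tp1 B0 by (intro mult_right_mono)
    ultimately have "t powr p * \<I> (v n) \<le> \<kappa>" "t powr p * \<I> (v n) \<le> B" using tp by linarith+
    then show ?thesis using t by (simp add: Lp_int_mult)
  qed
  have u: "\<L> (?u n)" "\<I> (?u n) \<le> B'" for n
  proof -
    show "\<L> (?u n)" by (intro \<L>_intros v w)
    have "\<I> (?u n) \<le> 2 powr p * (\<I> (w n) + \<I> (\<lambda>x. complex_of_real t * v n x))"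
      by (intro Lp_int_add_le \<L>_intros v w)
    also have "\<dots> \<le> B'" unfolding B'_def using w(2)[of n] tv[of n] by (intro mult_left_mono add_mono) auto
    finally show "\<I> (?u n) \<le> B'" .
  qed
  have near: "cmod (pairing M (v n) (J (?u n)) - pairing M (v n) (J (w n))) \<le> \<epsilon> / 2" for n
    using tv[of n] by (intro k(2) v w u order_trans[OF v(2) B'(1)] order_trans[OF w(2) B'(1)]) auto
  have "(\<lambda>n. (\<rho> n powr p - 1) * \<I> (?u n)) \<longlonglongrightarrow> 0"
  proof (rule Lim_null_comparison)
    show "\<forall>\<^sub>F n in sequentially. norm ((\<rho> n powr p - 1) * \<I> (?u n)) \<le> \<bar>\<rho> n powr p - 1\<bar> * B'"
      using u(2) by (intro always_eventually allI) (simp add: abs_mult mult_left_mono Lp_int_nonneg)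
    have "(\<lambda>n. \<bar>\<rho> n powr p - 1\<bar> * B') \<longlonglongrightarrow> \<bar>1 powr p - 1\<bar> * B'"
      using a(2) by (intro tendsto_intros) auto
    then show "(\<lambda>n. \<bar>\<rho> n powr p - 1\<bar> * B') \<longlonglongrightarrow> 0" by simp
  qed
  moreover have "(\<lambda>n. \<I> (w n) - \<I> (\<pi> (a n) (w n))) \<longlonglongrightarrow> 0"
    using tendsto_minus[OF lim] by simp
  ultimately have "(\<lambda>n. (\<rho> n powr p - 1) * \<I> (?u n) + (\<I> (w n) - \<I> (\<pi> (a n) (w n)))) \<longlonglongrightarrow> 0"
    using tendsto_add by fastforce
  moreover have "0 < t * p * (\<epsilon> / 2)" using t p0 e by simp
  ultimately have "\<forall>\<^sub>F n in sequentially. (\<rho> n powr p - 1) * \<I> (?u n) + (\<I> (w n) - \<I> (\<pi> (a n) (w n))) < t * p * (\<epsilon> / 2)"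
    by (rule order_tendstoD)
  then show ?thesis
  proof eventually_elim
    case (elim n)
    have "t * p * Re (pairing M (\<pi> (a n) (v n)) (J (\<pi> (a n) (w n))) - pairing M (v n) (J (?u n))) \<le> t * p * (\<epsilon> / 2)"
      using smoothness_ineq[OF v(1) w(1) a(1), of t n n n] elim by linarith
    then have "Re (pairing M (\<pi> (a n) (v n)) (J (\<pi> (a n) (w n))) - pairing M (v n) (J (?u n))) \<le> \<epsilon> / 2"
      using t p0 by (simp only: mult_le_cancel_left_pos mult_pos_pos)
    moreover have "Re (pairing M (v n) (J (?u n)) - pairing M (v n) (J (w n))) \<le> \<epsilon> / 2"
      using near[of n] complex_Re_le_cmod order_trans by blast
    ultimately show ?case by simp
  qed
qed

text \<open>A quantitative form of the uniqueness of norming functionals: a near contraction that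
  moves \<open>w\<close> to \<open>w'\<close> without loss of norm pulls the functional at
  \<open>w'\<close> back to the one at \<open>w\<close>. Rotating \<open>v n\<close> turns the
  one-sided bound into one on the modulus.\<close>

lemma smoothness:
  assumes a: "\<And>n. norm (a n) \<le> \<rho> n" "\<rho> \<longlonglongrightarrow> 1"
    and v: "\<And>n. \<L> (v n)" "\<And>n. \<I> (v n) \<le> B"
    and w: "\<And>n. \<L> (w n)" "\<And>n. \<I> (w n) \<le> B" and w': "\<And>n. \<L> (w' n)" "\<And>n. \<I> (w' n) \<le> B"
    and lim: "(\<lambda>n. \<I> (\<lambda>t. \<pi> (a n) (w n) t - w' n t)) \<longlonglongrightarrow> 0" "(\<lambda>n. \<I> (w' n) - \<I> (w n)) \<longlonglongrightarrow> 0"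
  shows "(\<lambda>n. pairing M (\<pi> (a n) (v n)) (J (w' n)) - pairing M (v n) (J (w n))) \<longlonglongrightarrow> 0"
proof -
  have B0: "0 \<le> B" using v(2)[of 0] Lp_int_nonneg[of p M "v 0"] by linarith
  obtain R where "\<And>n. norm (\<rho> n) \<le> R"
    using convergent_imp_Bseq[OF convergentI[OF a(2)]] by (auto simp: Bseq_def)
  then have aR: "norm (a n) \<le> R" for n using a(1)[of n] by (metis abs_le_D1 order_trans real_norm_def)
  define C where "C = max 1 (R powr p) * B"
  have C: "B \<le> C" "R powr p * B \<le> C"
    using B0 mult_right_mono[of 1 "max 1 (R powr p)" B] by (auto simp: C_def intro: mult_right_mono)
  have aw: "\<L> (\<pi> (a n) (w n))" "\<I> (\<pi> (a n) (w n)) \<le> C" for n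
    using rep_bound_le[OF w(1) aR w(2)] C w by (auto intro: \<L>_intros order_trans)
  have av: "\<L> (\<pi> (a n) (v n))" "\<I> (\<pi> (a n) (v n)) \<le> C" for n
    using rep_bound_le[OF v(1) aR v(2)] C v by (auto intro: \<L>_intros order_trans)
  have w'C: "\<I> (w' n) \<le> C" for n using w'(2)[of n] C by simp
  have lim': "(\<lambda>n. \<I> (\<pi> (a n) (w n)) - \<I> (w n)) \<longlonglongrightarrow> 0"
    using tendsto_add[OF Lp_int_tendsto_diff[OF aw(1) w'(1) aw(2) w'C lim(1)] lim(2)] by simp
  let ?D = "\<lambda>n. pairing M (\<pi> (a n) (v n)) (J (\<pi> (a n) (w n))) - pairing M (v n) (J (w n))"
  have D: "?D \<longlonglongrightarrow> 0"
  proof (rule LIMSEQ_I)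
    fix r :: real assume r: "0 < r"
    define u where "u n = cnj (sgn (?D n))" for n
    have u1: "cmod (u n) \<le> 1" for n by (simp add: u_def norm_sgn)
    let ?v = "\<lambda>n t. u n * v n t"
    have v': "\<L> (?v n)" "\<I> (?v n) \<le> B" for n
    proof -
      show "\<L> (?v n)" by (intro \<L>_intros v)
      have "cmod (u n) powr p * \<I> (v n) \<le> 1 * \<I> (v n)"
        using u1 p0 by (intro mult_right_mono) (auto simp: powr_le1 Lp_int_nonneg)
      then show "\<I> (?v n) \<le> B" using v(2)[of n] by (simp add: Lp_int_mult)
    qed
    have "\<forall>\<^sub>F n in sequentially. Re (pairing M (\<pi> (a n) (?v n)) (J (\<pi> (a n) (w n))) - pairing M (?v n) (J (w n))) \<le> r / 2"
      using smoothness_one_sided[OF a v' w lim', of "r / 2"] r by simp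
    then have "\<forall>\<^sub>F n in sequentially. norm (?D n - 0) < r"
    proof eventually_elim
      case (elim n)
      have "pairing M (\<pi> (a n) (?v n)) (J (\<pi> (a n) (w n))) = pairing M (\<lambda>t. u n * \<pi> (a n) (v n) t) (J (\<pi> (a n) (w n)))"
        by (intro pairing_cong_AE \<L>_intros v w rep_mult_vec)
      then have "pairing M (\<pi> (a n) (?v n)) (J (\<pi> (a n) (w n))) - pairing M (?v n) (J (w n)) = u n * ?D n"
        by (simp add: pairing_mult \<L>_intros v w right_diff_distrib)
      also have "\<dots> = cmod (?D n)"
        using mult_dmap[of "?D n" 1] by (simp add: dmap_def u_def mult.commute split: if_splits)
      finally show ?case using elim r by simp
    qed
    then show "\<exists>no. \<forall>n\<ge>no. norm (?D n - 0) < r" by (simp add: eventually_sequentially)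
  qed
  have "(\<lambda>n. pairing M (\<pi> (a n) (v n)) (J (\<pi> (a n) (w n))) - pairing M (\<pi> (a n) (v n)) (J (w' n))) \<longlonglongrightarrow> 0"
    by (rule pairing_tendsto_diff[OF aw(1) w'(1) aw(2) w'C lim(1) av])
  from tendsto_diff[OF D this] show ?thesis by simp
qed

text \<open>
  Up to errors that vanish in the limit, \<open>u\<close>-rotations \<open>v u\<close> of norm \<open>1\<close> send \<open>X + Y\<close> to
  \<open>u X + Y\<close>. Hence \<open>J (u X + Y)\<close> is the functional \<open>J (X + Y)\<close> composed with \<open>v (cnj u)\<close>, which is
  affine in \<open>cnj u\<close> as soon as \<open>J (X + Y)\<close> vanishes on the range of \<open>m (cnj u)\<close>. The latter is
  forced by the contraction \<open>w\<close>, which fixes \<open>X + Y\<close> and acts as \<open>- 1\<close> on that range. As \<open>p \<noteq> 2\<close>,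
  being affine in \<open>cnj u\<close> forces \<open>X\<close> and \<open>Y\<close> to have disjoint supports.
\<close>

lemma asymptotically_disjoint:
  fixes x y s q w :: "nat \<Rightarrow> 'a" and v m :: "complex \<Rightarrow> nat \<Rightarrow> 'a"
  assumes p2: "p \<noteq> 2"
    and g: "\<And>n. \<L> (g n)" "\<And>n. \<I> (g n) \<le> 1"
    and x: "\<And>n. norm (x n) \<le> C" and y: "\<And>n. norm (y n) \<le> C"
    and \<rho>: "\<rho> \<longlonglongrightarrow> 1" and v: "\<And>u n. cmod u = 1 \<Longrightarrow> norm (v u n) \<le> \<rho> n" and w: "\<And>n. norm (w n) \<le> \<rho> n"
    and vx: "\<And>u. cmod u = 1 \<Longrightarrow> (\<lambda>n. norm (v u n * x n - u *\<^sub>C x n)) \<longlonglongrightarrow> 0"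
    and vy: "\<And>u. cmod u = 1 \<Longrightarrow> (\<lambda>n. norm (v u n * y n - y n)) \<longlonglongrightarrow> 0"
    and wx: "(\<lambda>n. norm (w n * x n - x n)) \<longlonglongrightarrow> 0" and wy: "(\<lambda>n. norm (w n * y n - y n)) \<longlonglongrightarrow> 0"
    and split: "\<And>u. cmod u = 1 \<Longrightarrow> (\<lambda>n. norm (v u n - (u *\<^sub>C s n + q n + m u n))) \<longlonglongrightarrow> 0"
    and m: "\<And>u n. cmod u = 1 \<Longrightarrow> norm (m u n) \<le> C"
    and wm: "\<And>u. cmod u = 1 \<Longrightarrow> (\<lambda>n. norm (w n * m u n + m u n)) \<longlonglongrightarrow> 0"
  shows "(\<lambda>n. \<I> (\<lambda>t. \<pi> (x n) (g n) t + \<pi> (y n) (g n) t) - \<I> (\<pi> (x n) (g n)) - \<I> (\<pi> (y n) (g n))) \<longlonglongrightarrow> 0"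
proof -
  define X Y where "X n = \<pi> (x n) (g n)" and "Y n = \<pi> (y n) (g n)" for n
  define W where "W u n = (\<lambda>t. u * X n t + Y n t)" for u n
  define B where "B = 2 powr p * (C powr p + C powr p)"
  have XL: "\<L> (X n)" and YL: "\<L> (Y n)" for n by (simp_all add: X_def Y_def rep_in g)
  have XI: "\<I> (X n) \<le> C powr p" and YI: "\<I> (Y n) \<le> C powr p" for n
    using rep_bound_le[OF g(1) x g(2)] rep_bound_le[OF g(1) y g(2)] by (simp_all add: X_def Y_def)
  have WL: "\<L> (W u n)" for u n unfolding W_def by (intro \<L>_intros XL YL)
  have WI: "\<I> (W u n) \<le> B" if "cmod u = 1" for u n
  proof -
    have "\<I> (W u n) \<le> 2 powr p * (\<I> (\<lambda>t. u * X n t) + \<I> (Y n))"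
      unfolding W_def by (intro Lp_int_add_le \<L>_intros XL YL)
    also have "\<dots> \<le> B" unfolding B_def using XI YI that by (intro mult_left_mono add_mono) (auto simp: Lp_int_mult)
    finally show ?thesis .
  qed
  have B0: "0 \<le> B" by (simp add: B_def)
  have moves: "(\<lambda>n. \<I> (\<lambda>t. \<pi> (a n) (W z n) t - W (u * z) n t)) \<longlonglongrightarrow> 0"
    if a: "(\<lambda>n. norm (a n * x n - u *\<^sub>C x n)) \<longlonglongrightarrow> 0" "(\<lambda>n. norm (a n * y n - y n)) \<longlonglongrightarrow> 0" and z: "cmod z = 1"
    for a u z
  proof -
    define d e where "d n = \<pi> (a n * x n - u *\<^sub>C x n) (g n)" and "e n = \<pi> (a n * y n - y n) (g n)" for n
    have dL: "\<L> (d n)" and eL: "\<L> (e n)" for n by (simp_all add: d_def e_def rep_in g)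
    have "(\<lambda>n. \<I> (d n)) \<longlonglongrightarrow> 0" "(\<lambda>n. \<I> (e n)) \<longlonglongrightarrow> 0"
      unfolding d_def e_def by (rule rep_tendsto_0[OF _ g]; rule a)+
    from tendsto_mult_right[OF tendsto_add[OF this], of "2 powr p"]
    have lim: "(\<lambda>n. 2 powr p * (\<I> (d n) + \<I> (e n))) \<longlonglongrightarrow> 0" by simp
    have le: "\<I> (\<lambda>t. \<pi> (a n) (W z n) t - W (u * z) n t) \<le> 2 powr p * (\<I> (d n) + \<I> (e n))" for n
    proof -
      have "AE t in M. \<pi> (a n) (W z n) t - W (u * z) n t = z * d n t + e n t"
        using rep_add_vec[OF Lp_fun_mult[OF p0 XL, of z n] YL, of "a n" n] rep_mult_vec[OF XL, of "a n" z n]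
          rep_diff[OF g(1), of "a n * x n" "u *\<^sub>C x n" n] rep_scaleC[OF g(1), of u "x n" n] rep_mult[OF g(1), of "a n" "x n" n]
          rep_diff[OF g(1), of "a n * y n" "y n" n] rep_mult[OF g(1), of "a n" "y n" n]
        unfolding W_def d_def e_def X_def Y_def
        by eventually_elim algebra
      then have "\<I> (\<lambda>t. \<pi> (a n) (W z n) t - W (u * z) n t) = \<I> (\<lambda>t. z * d n t + e n t)"
        by (intro Lp_int_cong_AE meas \<L>_intros WL dL eL)
      also have "\<dots> \<le> 2 powr p * (\<I> (\<lambda>t. z * d n t) + \<I> (e n))" by (intro Lp_int_add_le \<L>_intros dL eL)
      finally show ?thesis using z by (simp add: Lp_int_mult)
    qed
    show ?thesis
      by (rule tendsto_sandwich[OF _ _ tendsto_const lim]) (auto simp: Lp_int_nonneg le)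
  qed
  obtain R where "\<And>n. norm (\<rho> n) \<le> R"
    using convergent_imp_Bseq[OF convergentI[OF \<rho>]] by (auto simp: Bseq_def)
  then have \<rho>R: "\<rho> n \<le> R" for n by (metis abs_le_D1 real_norm_def)
  have rot_le: "\<forall>\<^sub>F n in sequentially. \<I> (W (u * z) n) - \<I> (W z n) < \<epsilon>"
    if u: "cmod u = 1" "cmod z = 1" and e: "0 < \<epsilon>" for u z \<epsilon>
  proof -
    let ?V = "\<lambda>n. \<pi> (v u n) (W z n)"
    have VL: "\<L> (?V n)" for n by (intro \<L>_intros WL)
    have VI: "\<I> (?V n) \<le> max B (R powr p * B)" and WI': "\<I> (W (u * z) n) \<le> max B (R powr p * B)" for n
      using rep_bound_le[OF WL order_trans[OF v[OF u(1)] \<rho>R] WI[OF u(2)], of n] WI[of "u * z" n] u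
      by (simp_all add: norm_mult le_max_iff_disj)
    have l1: "(\<lambda>n. \<I> (?V n) - \<I> (W (u * z) n)) \<longlonglongrightarrow> 0"
      by (rule Lp_int_tendsto_diff[OF VL WL VI WI' moves[OF vx[OF u(1)] vy[OF u(1)] u(2)]])
    have "(\<lambda>n. \<bar>\<rho> n powr p - 1\<bar> * B) \<longlonglongrightarrow> \<bar>1 powr p - 1\<bar> * B"
      using \<rho> by (intro tendsto_intros) auto
    then have l2: "(\<lambda>n. \<bar>\<rho> n powr p - 1\<bar> * B - (\<I> (?V n) - \<I> (W (u * z) n))) \<longlonglongrightarrow> 0"
      using tendsto_diff[OF _ l1] by fastforce
    have "\<forall>\<^sub>F n in sequentially. \<bar>\<rho> n powr p - 1\<bar> * B - (\<I> (?V n) - \<I> (W (u * z) n)) < \<epsilon>"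
      by (rule order_tendstoD(2)[OF l2 e])
    then show ?thesis
    proof eventually_elim
      case (elim n)
      have "\<I> (?V n) \<le> \<rho> n powr p * \<I> (W z n)" by (rule rep_bound_le[OF WL v[OF u(1)] order_refl])
      also have "\<dots> = \<I> (W z n) + (\<rho> n powr p - 1) * \<I> (W z n)" by (simp add: algebra_simps)
      also have "(\<rho> n powr p - 1) * \<I> (W z n) \<le> \<bar>\<rho> n powr p - 1\<bar> * B"
        using WI[OF u(2)] by (intro mult_mono) (auto simp: Lp_int_nonneg)
      finally show ?case using elim by linarith
    qed
  qed
  \<comment> \<open>Applying the rotation by \<open>u\<close> and the one by \<open>cnj u\<close>
    bounds the difference from both sides.\<close>
  have rot: "(\<lambda>n. \<I> (W 1 n) - \<I> (W u n)) \<longlonglongrightarrow> 0" if u: "cmod u = 1" for u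
  proof (rule LIMSEQ_I)
    fix r :: real assume r: "0 < r"
    have cu: "cnj u * u = 1" using u by (metis complex_norm_square mult.commute of_real_1 one_power2)
    have "\<forall>\<^sub>F n in sequentially. \<I> (W (u * 1) n) - \<I> (W 1 n) < r"
      "\<forall>\<^sub>F n in sequentially. \<I> (W (cnj u * u) n) - \<I> (W u n) < r"
      using u r by (intro rot_le; simp)+
    then have "\<forall>\<^sub>F n in sequentially. norm (\<I> (W 1 n) - \<I> (W u n) - 0) < r"
      unfolding cu by eventually_elim auto
    then show "\<exists>no. \<forall>n\<ge>no. norm (\<I> (W 1 n) - \<I> (W u n) - 0) < r" by (simp add: eventually_sequentially)
  qed
  have affine: "(\<lambda>n. pairing M (f n) (J (W u n)) - (cnj u * pairing M (\<pi> (s n) (f n)) (J (W 1 n)) + pairing M (\<pi> (q n) (f n)) (J (W 1 n)))) \<longlonglongrightarrow> 0"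
    if u: "cmod u = 1" and f: "\<And>n. \<L> (f n)" "\<And>n. \<I> (f n) \<le> D" for u f D
  proof -
    define B' where "B' = max B (max D (C powr p * D))"
    have fB: "\<I> (f n) \<le> B'" for n using f(2)[of n] by (simp add: B'_def)
    have WB: "\<I> (W u n) \<le> B'" if "cmod u = 1" for u n using WI[OF that, of n] by (simp add: B'_def)
    have u': "cmod (cnj u) = 1" using u by simp
    have cu: "cnj u * u = 1" using u by (metis complex_norm_square mult.commute of_real_1 one_power2)
    have 1: "(\<lambda>n. pairing M (\<pi> (v (cnj u) n) (f n)) (J (W 1 n)) - pairing M (f n) (J (W u n))) \<longlonglongrightarrow> 0"
      using smoothness[OF v[OF u'] \<rho> f(1) fB WL WB[OF u] WL WB[of 1] _ rot[OF u]]
        moves[OF vx[OF u'] vy[OF u'] u] by (simp add: cu)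
    let ?m = "\<lambda>n. \<pi> (m (cnj u) n) (f n)"
    have mL: "\<L> (?m n)" and mI: "\<I> (?m n) \<le> B'" for n
      using rep_bound_le[OF f(1) m[OF u'] f(2), of n] by (simp_all add: B'_def le_max_iff_disj \<L>_intros f)
    have w1: "(\<lambda>n. norm (w n * x n - 1 *\<^sub>C x n)) \<longlonglongrightarrow> 0" using wx by (simp add: scaleC_one)
    have 2: "(\<lambda>n. pairing M (\<pi> (w n) (?m n)) (J (W 1 n)) - pairing M (?m n) (J (W 1 n))) \<longlonglongrightarrow> 0"
      using smoothness[OF w \<rho> mL mI WL WB[of 1] WL WB[of 1]] moves[OF w1 wy, of 1] by simp
    have small: "(\<lambda>n. pairing M (\<pi> (a n) (f n)) (J (W 1 n))) \<longlonglongrightarrow> 0" if "(\<lambda>n. norm (a n)) \<longlonglongrightarrow> 0" for a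
      by (rule pairing_tendsto_0[OF WL WI[of 1] _ rep_tendsto_0[OF that f]]) (auto intro: \<L>_intros f)
    have 3: "(\<lambda>n. pairing M (\<pi> (w n) (?m n)) (J (W 1 n)) + pairing M (?m n) (J (W 1 n))) \<longlonglongrightarrow> 0"
    proof -
      have "pairing M (\<pi> (w n * m (cnj u) n + m (cnj u) n) (f n)) (J (W 1 n))
          = pairing M (\<pi> (w n) (?m n)) (J (W 1 n)) + pairing M (?m n) (J (W 1 n))" for n
        using pairing_rep_add[OF f(1) WL] pairing_cong_AE[OF _ _ WL rep_mult[OF f(1)]] by (simp add: \<L>_intros f)
      then show ?thesis using small[OF wm[OF u']] by simp
    qed
    have "(\<lambda>n. (pairing M (\<pi> (w n) (?m n)) (J (W 1 n)) + pairing M (?m n) (J (W 1 n))) - (pairing M (\<pi> (w n) (?m n)) (J (W 1 n)) - pairing M (?m n) (J (W 1 n)))) \<longlonglongrightarrow> 0 - 0"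
      by (rule tendsto_diff[OF 3 2])
    then have "(\<lambda>n. 2 * pairing M (?m n) (J (W 1 n))) \<longlonglongrightarrow> 0" by (simp add: algebra_simps)
    from tendsto_mult_right[OF this, of "1/2"]
    have 4: "(\<lambda>n. pairing M (?m n) (J (W 1 n))) \<longlonglongrightarrow> 0" by simp
    let ?r = "\<lambda>n. v (cnj u) n - (cnj u *\<^sub>C s n + q n + m (cnj u) n)"
    have eq: "pairing M (\<pi> (v (cnj u) n) (f n)) (J (W 1 n)) = pairing M (\<pi> (?r n) (f n)) (J (W 1 n))
        + (cnj u * pairing M (\<pi> (s n) (f n)) (J (W 1 n)) + pairing M (\<pi> (q n) (f n)) (J (W 1 n)) + pairing M (?m n) (J (W 1 n)))" for n
    proof -
      have "v (cnj u) n = ?r n + (cnj u *\<^sub>C s n + q n + m (cnj u) n)" by simp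
      then have "pairing M (\<pi> (v (cnj u) n) (f n)) (J (W 1 n)) = pairing M (\<pi> (?r n + (cnj u *\<^sub>C s n + q n + m (cnj u) n)) (f n)) (J (W 1 n))"
        by (rule arg_cong)
      then show ?thesis by (simp only: pairing_rep_add[OF f(1) WL] pairing_rep_scaleC[OF f(1) WL])
    qed
    have "(\<lambda>n. (pairing M (\<pi> (?r n) (f n)) (J (W 1 n)) + pairing M (?m n) (J (W 1 n))) - (pairing M (\<pi> (v (cnj u) n) (f n)) (J (W 1 n)) - pairing M (f n) (J (W u n)))) \<longlonglongrightarrow> (0 + 0) - 0"
      by (intro tendsto_diff tendsto_add small split 1 4 u')
    then show ?thesis unfolding eq by (simp add: algebra_simps)
  qed
  define S where "S = {\<i>, - \<i>, \<zeta>, - \<zeta>}"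
  have S1: "cmod u = 1" if "u \<in> S" for u using that by (auto simp: S_def)
  define e where "e = p / (p - 1)"
  have e: "1 < e" "e - 1 = 1 / (p - 1)" "(p - 1) * e = p" using p by (auto simp: e_def field_simps)
  have XY: "\<L> (\<lambda>t. (X n t, Y n t))" "Lp_int p M (\<lambda>t. (X n t, Y n t)) \<le> B" for n
    using Lp_fun_Pair(1)[OF p0 XL YL, of n n]
      order_trans[OF Lp_fun_Pair(2)[OF p0 XL YL, of n n] mult_left_mono[OF add_mono[OF XI YI]]]
    by (simp_all add: B_def)
  have hR: "homog (p - 1) (six_defect p u)" for u
    unfolding six_defect_def
    using homog_compose[OF homog_add[OF homog_cmult[OF homog_fst[OF homog_id], of u] homog_snd[OF homog_id]] homog_dmap[OF p]]
      homog_compose[OF homog_add[OF homog_fst[OF homog_id] homog_snd[OF homog_id]] homog_dmap[OF p]]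
      homog_compose[OF homog_diff[OF homog_snd[OF homog_id] homog_fst[OF homog_id]] homog_dmap[OF p]]
    by (intro homog_diff homog_add homog_cmult) simp_all
  have dual_lim: "(\<lambda>n. \<integral>t. cmod (six_defect p u (X n t, Y n t)) powr e \<partial>M) \<longlonglongrightarrow> 0" if u: "u \<in> S" for u
  proof -
    \<comment> \<open>The defect lies in the dual of L^p, whose exponent is \<open>e\<close>; its
      own duality map gives the test function that reads off its norm. \<open>G\<close> has degree
      \<open>(p - 1) * (e - 1) = 1\<close>, so the test function lies in L^p.\<close>
    define G where "G z = dmap e (six_defect p u z)" for z
    have hG: "homog 1 G"
      using homog_compose[OF hR[of u] homog_dmap[OF e(1)]] e p unfolding G_def by (simp add: e)
    obtain D where D: "0 \<le> D" "\<And>F. Lp_fun p M F \<Longrightarrow> \<I> (\<lambda>t. G (F t)) \<le> D * Lp_int p M F"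
      using Lp_int_homog_le[OF p0 hG] by blast
    define f where "f n = (\<lambda>t. G (X n t, Y n t))" for n
    have f: "\<L> (f n)" "\<I> (f n) \<le> D * B" for n
      using Lp_fun_homog[OF p0 XY(1) hG] order_trans[OF D(2)[OF XY(1)] mult_left_mono[OF XY(2) D(1)]]
      by (simp_all add: f_def)
    let ?s = "\<lambda>n. pairing M (\<pi> (s n) (f n)) (J (W 1 n))" and ?q = "\<lambda>n. pairing M (\<pi> (q n) (f n)) (J (W 1 n))"
    let ?E = "\<lambda>z n. pairing M (f n) (J (W z n)) - (cnj z * ?s n + ?q n)"
    have E: "?E z \<longlonglongrightarrow> 0" if "cmod z = 1" for z by (rule affine[OF that f])
    \<comment> \<open>The weights reproduce every function affine in \<open>cnj u\<close>, so the
      unknown terms \<open>?s\<close> and \<open>?q\<close> cancel and only the defect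
      remains.\<close>
    have "(\<lambda>n. ?E u n - ((1 + cnj u) / 2 * ?E 1 n + (1 - cnj u) / 2 * ?E (- 1) n)) \<longlonglongrightarrow> 0 - ((1 + cnj u) / 2 * 0 + (1 - cnj u) / 2 * 0)"
      by (intro tendsto_intros E) (auto simp: S1 u)
    moreover have "?E u n - ((1 + cnj u) / 2 * ?E 1 n + (1 - cnj u) / 2 * ?E (- 1) n)
        = of_real (\<integral>t. cmod (six_defect p u (X n t, Y n t)) powr e \<partial>M)" for n
    proof -
      have "?E u n - ((1 + cnj u) / 2 * ?E 1 n + (1 - cnj u) / 2 * ?E (- 1) n)
        = pairing M (f n) (J (W u n)) - ((1 + cnj u) / 2 * pairing M (f n) (J (W 1 n)) + (1 - cnj u) / 2 * pairing M (f n) (J (W (- 1) n)))"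
        by (simp add: field_simps)
      also have "\<dots> = (\<integral>t. f n t * dmap p (W u n t) - ((1 + cnj u) / 2 * (f n t * dmap p (W 1 n t)) + (1 - cnj u) / 2 * (f n t * dmap p (W (- 1) n t))) \<partial>M)"
        unfolding pairing_def using pairing_int[OF f(1) WL] by simp
      also have "\<dots> = (\<integral>t. of_real (cmod (six_defect p u (X n t, Y n t)) powr e) \<partial>M)"
      proof (rule Bochner_Integration.integral_cong)
        fix t
        have "f n t * dmap p (W u n t) - ((1 + cnj u) / 2 * (f n t * dmap p (W 1 n t)) + (1 - cnj u) / 2 * (f n t * dmap p (W (- 1) n t)))
          = six_defect p u (X n t, Y n t) * dmap e (six_defect p u (X n t, Y n t))"
          by (simp add: f_def G_def W_def six_defect_def algebra_simps)
        then show "f n t * dmap p (W u n t) - ((1 + cnj u) / 2 * (f n t * dmap p (W 1 n t)) + (1 - cnj u) / 2 * (f n t * dmap p (W (- 1) n t)))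
          = of_real (cmod (six_defect p u (X n t, Y n t)) powr e)" by (simp only: mult_dmap)
      qed simp
      finally show ?thesis by simp
    qed
    ultimately have "(\<lambda>n. complex_of_real (\<integral>t. cmod (six_defect p u (X n t, Y n t)) powr e \<partial>M)) \<longlonglongrightarrow> of_real 0"
      by simp
    then show ?thesis by (simp only: tendsto_of_real_iff)
  qed
  let ?\<Psi> = "\<lambda>z. \<Sum>u\<in>S. cmod (six_defect p u z) powr e"
  let ?\<Phi> = "\<lambda>z :: complex \<times> complex. norm (cmod (fst z + snd z) powr p - cmod (fst z) powr p - cmod (snd z) powr p)"
  have hR': "homog p (\<lambda>z. cmod (six_defect p u z) powr e)" for u
    using homog_norm_powr[OF hR, of e u] e by simp
  have h\<Psi>: "homog p ?\<Psi>" by (intro homog_sum hR')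
  have h\<Phi>: "homog p ?\<Phi>"
    by (intro homog_norm homog_diff homog_cmod_fst homog_cmod_snd homog_cmod_add p0)
  have nn: "0 \<le> ?\<Psi> z" for z by (intro sum_nonneg) simp
  have zz: "?\<Phi> z \<le> 0" if "?\<Psi> z = 0" for z
  proof -
    have "\<forall>u\<in>S. cmod (six_defect p u z) powr e = 0"
      using that by (subst (asm) sum_nonneg_eq_0_iff) (auto simp: S_def)
    then have "six_defect p u (fst z, snd z) = 0" if "u \<in> S" for u using that by simp
    then have "fst z = 0 \<or> snd z = 0" by (intro dmap_disjoint[OF p p2]) (auto simp: S_def)
    then show ?thesis by auto
  qed
  have int\<Psi>: "(\<lambda>n. \<integral>t. ?\<Psi> (X n t, Y n t) \<partial>M) \<longlonglongrightarrow> 0"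
  proof -
    have "(\<lambda>n. \<Sum>u\<in>S. \<integral>t. cmod (six_defect p u (X n t, Y n t)) powr e \<partial>M) \<longlonglongrightarrow> (\<Sum>u\<in>S. 0)"
      by (intro tendsto_sum dual_lim)
    moreover have "(\<integral>t. ?\<Psi> (X n t, Y n t) \<partial>M) = (\<Sum>u\<in>S. \<integral>t. cmod (six_defect p u (X n t, Y n t)) powr e \<partial>M)" for n
      using Lp_fun_integrable[OF p0 XY(1) hR'] by simp
    ultimately show ?thesis by simp
  qed
  show ?thesis
    unfolding X_def[symmetric] Y_def[symmetric]
  proof (rule LIMSEQ_I)
    fix r :: real assume r: "0 < r"
    then have r2: "0 < r / 2" by simp
    obtain \<kappa> where k: "0 < \<kappa>" "\<And>F. Lp_fun p M F \<Longrightarrow> Lp_int p M F \<le> B \<Longrightarrow>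
        (\<integral>x. ?\<Psi> (F x) \<partial>M) \<le> \<kappa> \<Longrightarrow> (\<integral>x. ?\<Phi> (F x) \<partial>M) \<le> r / 2"
      using integral_transfer[OF p0 h\<Phi> h\<Psi> nn zz r2, of M B] by blast
    have "\<forall>\<^sub>F n in sequentially. (\<integral>t. ?\<Psi> (X n t, Y n t) \<partial>M) < \<kappa>"
      by (rule order_tendstoD(2)[OF int\<Psi> k(1)])
    then have "\<forall>\<^sub>F n in sequentially. norm (\<I> (\<lambda>t. X n t + Y n t) - \<I> (X n) - \<I> (Y n) - 0) < r"
    proof eventually_elim
      case (elim n)
      have i: "integrable M (\<lambda>t. cmod (X n t + Y n t) powr p)" "integrable M (\<lambda>t. cmod (X n t) powr p)" "integrable M (\<lambda>t. cmod (Y n t) powr p)"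
        using XL[of n] YL[of n] Lp_fun_add[OF p0 XL YL, of n n] by (auto simp: Lp_fun_def)
      have "\<I> (\<lambda>t. X n t + Y n t) - \<I> (X n) - \<I> (Y n) = (\<integral>t. cmod (X n t + Y n t) powr p - cmod (X n t) powr p - cmod (Y n t) powr p \<partial>M)"
        using i by (simp add: Lp_int_def)
      then have "norm (\<I> (\<lambda>t. X n t + Y n t) - \<I> (X n) - \<I> (Y n)) \<le> (\<integral>t. ?\<Phi> (X n t, Y n t) \<partial>M)"
        using integral_norm_bound[of M "\<lambda>t. cmod (X n t + Y n t) powr p - cmod (X n t) powr p - cmod (Y n t) powr p"] by simp
      also have "\<dots> \<le> r / 2" using elim by (intro k(2) XY) simp
      finally show ?case using r by simp
    qed
    then show "\<exists>no. \<forall>n\<ge>no. norm (\<I> (\<lambda>t. X n t + Y n t) - \<I> (X n) - \<I> (Y n) - 0) < r" by (simp add: eventually_sequentially)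
  qed
qed

end

section \<open>Approximate rotations in a Banach algebra\<close>

lemma norm_minus_scaleC: "norm (c *\<^sub>C x - d *\<^sub>C x) = cmod (c - d) * norm (x::'a::complex_banach_algebra)"
  by (simp add: norm_scaleC flip: scaleC_diff_left)

text \<open>\<open>euler \<tau> h k\<close> stands for \<open>(1 + \<tau> h)\<^sup>k - 1\<close>, which makes sense without a unit.\<close>

primrec euler :: "complex \<Rightarrow> 'a::complex_banach_algebra \<Rightarrow> nat \<Rightarrow> 'a" where
  "euler \<tau> h 0 = 0"
| "euler \<tau> h (Suc k) = euler \<tau> h k + \<tau> *\<^sub>C (h + h * euler \<tau> h k)"

lemma euler_commute: "h * euler \<tau> h k = euler \<tau> h k * h"
proof (induction k)
  case (Suc k)
  have "h * (h * euler \<tau> h k) = h * euler \<tau> h k * h" by (simp only: mult.assoc Suc[symmetric])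
  then show ?case by (simp add: distrib_left distrib_right mult_scaleC_left mult_scaleC_right Suc)
qed simp

lemma euler_Suc_act: "c + euler \<tau> h (Suc k) * c = (c + euler \<tau> h k * c) + \<tau> *\<^sub>C (h * (c + euler \<tau> h k * c))"
  by (simp add: algebra_simps mult_scaleC_left scaleC_add_right)

lemma euler_Suc_act_right: "c + c * euler \<tau> h (Suc k) = (c + c * euler \<tau> h k) + \<tau> *\<^sub>C ((c + c * euler \<tau> h k) * h)"
  by (simp add: distrib_left distrib_right mult_scaleC_right scaleC_add_right euler_commute mult.assoc add.assoc)

lemma euler_act_norm:
  assumes "\<And>c. norm (c + \<tau> *\<^sub>C (h * c)) \<le> r * norm c" "0 \<le> r"
  shows "norm (c + euler \<tau> h k * c) \<le> r ^ k * norm c"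
proof (induction k)
  case (Suc k)
  show ?case
    unfolding euler_Suc_act
    using order_trans[OF assms(1) mult_left_mono[OF Suc assms(2)]] by (simp add: algebra_simps)
qed simp

lemma euler_norm:
  assumes "norm h \<le> 1"
  shows "1 + norm (euler \<tau> h k) \<le> (1 + cmod \<tau>) ^ k"
proof (induction k)
  case (Suc k)
  have "norm (h * euler \<tau> h k) \<le> 1 * norm (euler \<tau> h k)"
    by (rule order_trans[OF norm_mult_ineq mult_right_mono[OF assms]]) simp
  then have "norm (h + h * euler \<tau> h k) \<le> 1 + norm (euler \<tau> h k)"
    using assms by (intro order_trans[OF norm_triangle_ineq add_mono]) auto
  then have "norm (\<tau> *\<^sub>C (h + h * euler \<tau> h k)) \<le> cmod \<tau> * (1 + norm (euler \<tau> h k))"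
    by (simp add: norm_scaleC mult_left_mono)
  then have "1 + norm (euler \<tau> h (Suc k)) \<le> (1 + cmod \<tau>) * (1 + norm (euler \<tau> h k))"
    using norm_triangle_ineq[of "euler \<tau> h k" "\<tau> *\<^sub>C (h + h * euler \<tau> h k)"] by (simp add: algebra_simps)
  also have "\<dots> \<le> (1 + cmod \<tau>) * (1 + cmod \<tau>) ^ k" using Suc by (intro mult_left_mono) auto
  finally show ?case by simp
qed simp

lemma power_le_exp: "0 \<le> (x::real) \<Longrightarrow> (1 + x) ^ k \<le> exp (k * x)"
  using power_mono[OF exp_ge_add_one_self[of x], of k] by (simp add: exp_of_nat_mult)

text \<open>A discrete Gronwall inequality. It is applied with \<open>k * t\<close> bounded while
  the number of steps grows, so the factor of \<open>\<eta>\<close> stays bounded too.\<close>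

lemma linear_recursion_bound:
  fixes D :: "nat \<Rightarrow> real"
  assumes "D 0 = 0" "0 \<le> t" "0 \<le> \<eta>" "\<And>k. D (Suc k) \<le> (1 + t) * D k + t * (1 + t) ^ k * \<eta>"
  shows "D k \<le> (k * t) * exp (k * t) * \<eta>"
proof -
  have D: "D k \<le> k * t * (1 + t) ^ k * \<eta>" for k
  proof (induction k)
    case (Suc k)
    have "D (Suc k) \<le> (1 + t) * (k * t * (1 + t) ^ k * \<eta>) + t * (1 + t) ^ k * \<eta>"
      using assms(2) Suc by (intro order_trans[OF assms(4)] add_mono mult_left_mono) auto
    also have "t * (1 + t) ^ k * \<eta> \<le> t * (1 + t) ^ Suc k * \<eta>"
      using assms(2,3) by (intro mult_right_mono mult_left_mono power_increasing) auto
    finally show ?case by (simp add: algebra_simps)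
  qed (simp add: assms(1))
  also have "k * t * (1 + t) ^ k * \<eta> \<le> k * t * exp (k * t) * \<eta>"
    using assms(2,3) by (intro mult_right_mono mult_left_mono power_le_exp) auto
  finally show ?thesis .
qed

text \<open>The error of an approximate eigenvector satisfies the recursion of
  \<open>linear_recursion_bound\<close>. It is used with \<open>\<mu> = 1\<close> for elements
  absorbed by \<open>h\<close> and with \<open>\<mu> = 0\<close> for elements annihilated by
  it.\<close>

lemma euler_eigen:
  assumes h: "norm h \<le> 1" and \<mu>: "cmod \<mu> \<le> 1" and c: "norm (h * c - \<mu> *\<^sub>C c) \<le> \<eta>"
  shows "norm (c + euler \<tau> h k * c - (1 + \<tau> * \<mu>) ^ k *\<^sub>C c) \<le> (k * cmod \<tau>) * exp (k * cmod \<tau>) * \<eta>"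
proof -
  define D where "D k = c + euler \<tau> h k * c - (1 + \<tau> * \<mu>) ^ k *\<^sub>C c" for k
  show ?thesis
    unfolding D_def[symmetric]
  proof (rule linear_recursion_bound)
    fix k
    have "D (Suc k) = D k + \<tau> *\<^sub>C (h * D k) + (\<tau> * (1 + \<tau> * \<mu>) ^ k) *\<^sub>C (h * c - \<mu> *\<^sub>C c)"
      unfolding D_def euler_Suc_act
      by (simp add: algebra_simps scaleC_add_right scaleC_diff_right scaleC_add_left scaleC_scaleC mult_scaleC_right mult_scaleC_left)
    also have "norm \<dots> \<le> norm (D k) + cmod \<tau> * norm (D k) + cmod \<tau> * (1 + cmod \<tau>) ^ k * \<eta>"
    proof (intro order_trans[OF norm_triangle_ineq] add_mono order_refl)
      have "norm (h * D k) \<le> 1 * norm (D k)"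
        by (rule order_trans[OF norm_mult_ineq mult_right_mono[OF h]]) simp
      then show "norm (\<tau> *\<^sub>C (h * D k)) \<le> cmod \<tau> * norm (D k)" by (simp add: norm_scaleC mult_left_mono)
      have "cmod (1 + \<tau> * \<mu>) \<le> 1 + cmod \<tau>"
        using norm_triangle_ineq[of 1 "\<tau> * \<mu>"] mult_left_mono[OF \<mu>, of "cmod \<tau>"] by (simp add: norm_mult)
      then show "norm ((\<tau> * (1 + \<tau> * \<mu>) ^ k) *\<^sub>C (h * c - \<mu> *\<^sub>C c)) \<le> cmod \<tau> * (1 + cmod \<tau>) ^ k * \<eta>"
        using c by (simp add: norm_scaleC norm_mult norm_power) (intro mult_mono power_mono; simp)
    qed
    finally show "norm (D (Suc k)) \<le> (1 + cmod \<tau>) * norm (D k) + cmod \<tau> * (1 + cmod \<tau>) ^ k * \<eta>"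
      by (simp add: algebra_simps)
  qed (use order_trans[OF norm_ge_zero c] in \<open>auto simp: D_def scaleC_one\<close>)
qed

lemma euler_eigen_right:
  assumes h: "norm h \<le> 1" and c: "norm (c * h - c) \<le> \<eta>"
  shows "norm (c + c * euler \<tau> h k - (1 + \<tau>) ^ k *\<^sub>C c) \<le> (k * cmod \<tau>) * exp (k * cmod \<tau>) * \<eta>"
proof -
  define D where "D k = c + c * euler \<tau> h k - (1 + \<tau>) ^ k *\<^sub>C c" for k
  show ?thesis
    unfolding D_def[symmetric]
  proof (rule linear_recursion_bound)
    fix k
    have "D (Suc k) = D k + \<tau> *\<^sub>C (D k * h) + (\<tau> * (1 + \<tau>) ^ k) *\<^sub>C (c * h - c)"
      unfolding D_def euler_Suc_act_right
      by (simp add: algebra_simps scaleC_add_right scaleC_diff_right scaleC_add_left scaleC_scaleC mult_scaleC_right mult_scaleC_left)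
    also have "norm \<dots> \<le> norm (D k) + cmod \<tau> * norm (D k) + cmod \<tau> * (1 + cmod \<tau>) ^ k * \<eta>"
    proof (intro order_trans[OF norm_triangle_ineq] add_mono order_refl)
      have "norm (D k * h) \<le> norm (D k) * 1"
        by (rule order_trans[OF norm_mult_ineq mult_left_mono[OF h]]) simp
      then show "norm (\<tau> *\<^sub>C (D k * h)) \<le> cmod \<tau> * norm (D k)" by (simp add: norm_scaleC mult_left_mono)
      have "cmod (1 + \<tau>) \<le> 1 + cmod \<tau>" using norm_triangle_ineq[of 1 \<tau>] by simp
      then show "norm ((\<tau> * (1 + \<tau>) ^ k) *\<^sub>C (c * h - c)) \<le> cmod \<tau> * (1 + cmod \<tau>) ^ k * \<eta>"
        using c by (simp add: norm_scaleC norm_mult norm_power) (intro mult_mono power_mono; simp)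
    qed
    finally show "norm (D (Suc k)) \<le> (1 + cmod \<tau>) * norm (D k) + cmod \<tau> * (1 + cmod \<tau>) ^ k * \<eta>"
      by (simp add: algebra_simps)
  qed (use order_trans[OF norm_ge_zero c] in \<open>auto simp: D_def scaleC_one\<close>)
qed

lemma euler_absorb:
  assumes h: "norm h \<le> 1" and g: "norm (g * h - h) \<le> \<eta>"
  shows "norm (g * euler \<tau> h k - euler \<tau> h k) \<le> (k * cmod \<tau>) * exp (k * cmod \<tau>) * \<eta>"
proof (rule linear_recursion_bound)
  fix k
  let ?E = "euler \<tau> h k"
  have "g * euler \<tau> h (Suc k) - euler \<tau> h (Suc k) = (g * ?E - ?E) + \<tau> *\<^sub>C ((g * h - h) + (g * h - h) * ?E)"
    by (simp add: algebra_simps scaleC_add_right scaleC_diff_right mult_scaleC_right)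
  also have "norm \<dots> \<le> (1 + cmod \<tau>) * norm (g * ?E - ?E) + cmod \<tau> * (1 + cmod \<tau>) ^ k * \<eta>"
  proof (intro order_trans[OF norm_triangle_ineq] add_mono)
    have "norm ((g * h - h) * ?E) \<le> \<eta> * norm ?E"
      by (rule order_trans[OF norm_mult_ineq mult_right_mono[OF g]]) simp
    then have "norm ((g * h - h) + (g * h - h) * ?E) \<le> \<eta> + \<eta> * norm ?E"
      using g by (intro order_trans[OF norm_triangle_ineq add_mono])
    also have "\<dots> = (1 + norm ?E) * \<eta>" by (simp add: algebra_simps)
    also have "\<dots> \<le> (1 + cmod \<tau>) ^ k * \<eta>"
      using euler_norm[OF h] order_trans[OF norm_ge_zero g] by (intro mult_right_mono)
    finally have "cmod \<tau> * norm ((g * h - h) + (g * h - h) * ?E) \<le> cmod \<tau> * ((1 + cmod \<tau>) ^ k * \<eta>)"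
      by (intro mult_left_mono) auto
    then show "norm (\<tau> *\<^sub>C ((g * h - h) + (g * h - h) * ?E)) \<le> cmod \<tau> * (1 + cmod \<tau>) ^ k * \<eta>"
      by (simp add: norm_scaleC mult.assoc)
    show "norm (g * ?E - ?E) \<le> (1 + cmod \<tau>) * norm (g * ?E - ?E)"
      using mult_right_mono[of 1 "1 + cmod \<tau>" "norm (g * ?E - ?E)"] by simp
  qed
  finally show "norm (g * euler \<tau> h (Suc k) - euler \<tau> h (Suc k))
      \<le> (1 + cmod \<tau>) * norm (g * ?E - ?E) + cmod \<tau> * (1 + cmod \<tau>) ^ k * \<eta>" .
qed (use order_trans[OF norm_ge_zero g] in auto)

lemma euler_absorb_right:
  assumes h: "norm h \<le> 1" and g: "norm (h * g - h) \<le> \<eta>"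
  shows "norm (euler \<tau> h k * g - euler \<tau> h k) \<le> (k * cmod \<tau>) * exp (k * cmod \<tau>) * \<eta>"
proof (rule linear_recursion_bound)
  fix k
  let ?E = "euler \<tau> h k"
  have "euler \<tau> h (Suc k) * g - euler \<tau> h (Suc k) = (?E * g - ?E) + \<tau> *\<^sub>C ((h * g - h) + ?E * (h * g - h))"
    by (simp add: euler_commute distrib_right right_diff_distrib mult_scaleC_left scaleC_add_right scaleC_diff_right mult.assoc)
  also have "norm \<dots> \<le> (1 + cmod \<tau>) * norm (?E * g - ?E) + cmod \<tau> * (1 + cmod \<tau>) ^ k * \<eta>"
  proof (intro order_trans[OF norm_triangle_ineq] add_mono)
    have "norm (?E * (h * g - h)) \<le> norm ?E * \<eta>"
      by (rule order_trans[OF norm_mult_ineq mult_left_mono[OF g]]) simp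
    then have "norm ((h * g - h) + ?E * (h * g - h)) \<le> \<eta> + norm ?E * \<eta>"
      using g by (intro order_trans[OF norm_triangle_ineq add_mono])
    also have "\<dots> = (1 + norm ?E) * \<eta>" by (simp add: algebra_simps)
    also have "\<dots> \<le> (1 + cmod \<tau>) ^ k * \<eta>"
      using euler_norm[OF h] order_trans[OF norm_ge_zero g] by (intro mult_right_mono)
    finally have "cmod \<tau> * norm ((h * g - h) + ?E * (h * g - h)) \<le> cmod \<tau> * ((1 + cmod \<tau>) ^ k * \<eta>)"
      by (intro mult_left_mono) auto
    then show "norm (\<tau> *\<^sub>C ((h * g - h) + ?E * (h * g - h))) \<le> cmod \<tau> * (1 + cmod \<tau>) ^ k * \<eta>"
      by (simp add: norm_scaleC mult.assoc)
    show "norm (?E * g - ?E) \<le> (1 + cmod \<tau>) * norm (?E * g - ?E)"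
      using mult_right_mono[of 1 "1 + cmod \<tau>" "norm (?E * g - ?E)"] by simp
  qed
  finally show "norm (euler \<tau> h (Suc k) * g - euler \<tau> h (Suc k))
      \<le> (1 + cmod \<tau>) * norm (?E * g - ?E) + cmod \<tau> * (1 + cmod \<tau>) ^ k * \<eta>" .
qed (use order_trans[OF norm_ge_zero g] in auto)

section \<open>Convergence of Euler products, and approximate rotations\<close>

lemma tendsto_exp_limit_complex:
  assumes "filterlim m at_top F"
  shows "((\<lambda>n. (1 + z / of_nat (m n)) ^ m n) \<longlongrightarrow> exp (z::complex)) F"
proof (cases "z = 0")
  case False
  have der: "((\<lambda>h. (Ln (1 + h) - Ln 1) / h) \<longlongrightarrow> 1) (at 0)"
    using has_field_derivative_Ln[of 1] by (simp add: DERIV_def)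
  have inv: "((\<lambda>n. z / of_nat (m n)) \<longlongrightarrow> 0) F"
    using filterlim_compose[OF lim_1_over_n assms] tendsto_mult_right_zero[of "\<lambda>n. 1 / of_nat (m n)" F z] by simp
  have pos: "\<forall>\<^sub>F n in F. 0 < m n"
    by (rule eventually_compose_filterlim[OF eventually_gt_at_top assms])
  have "filterlim (\<lambda>n. z / of_nat (m n)) (at 0) F"
    using inv pos False by (auto simp: filterlim_at elim!: eventually_mono)
  from filterlim_compose[OF der this]
  have "((\<lambda>n. Ln (1 + z / of_nat (m n)) / (z / of_nat (m n))) \<longlongrightarrow> 1) F" by simp
  from tendsto_mult_right[OF this, of z]
  have "((\<lambda>n. z * (Ln (1 + z / of_nat (m n)) / (z / of_nat (m n)))) \<longlongrightarrow> z) F" by simp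
  then have lim: "((\<lambda>n. exp (z * (Ln (1 + z / of_nat (m n)) / (z / of_nat (m n))))) \<longlongrightarrow> exp z) F"
    by (rule tendsto_exp)
  have "((\<lambda>n. 1 + z / of_nat (m n)) \<longlongrightarrow> 1 + 0) F" by (intro tendsto_intros inv)
  then have ne: "\<forall>\<^sub>F n in F. 1 + z / of_nat (m n) \<noteq> 0"
    by (intro tendsto_imp_eventually_ne) auto
  have "\<forall>\<^sub>F n in F. exp (z * (Ln (1 + z / of_nat (m n)) / (z / of_nat (m n)))) = (1 + z / of_nat (m n)) ^ m n"
    using pos ne
  proof eventually_elim
    case (elim n)
    have "z * (Ln (1 + z / of_nat (m n)) / (z / of_nat (m n))) = of_nat (m n) * Ln (1 + z / of_nat (m n))"
      using elim False by (simp add: field_simps)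
    then show ?case using elim by (simp add: exp_of_nat_mult)
  qed
  then show ?thesis using lim by (simp cong: filterlim_cong add: tendsto_cong)
qed simp

text \<open>\<open>1 + rot u h m\<close> is the Euler approximation in \<open>m\<close> steps to the
  exponential of \<open>\<i> * Arg u\<close> times \<open>h\<close>. For large \<open>m\<close> it
  nearly multiplies by \<open>u\<close> what \<open>h\<close> fixes, and it fixes what
  \<open>h\<close> annihilates.\<close>

definition rot :: "complex \<Rightarrow> 'a::complex_banach_algebra \<Rightarrow> nat \<Rightarrow> 'a" where
  "rot u h m = euler (\<i> * Arg u / m) h m"

lemma abs_Arg_le: "\<bar>Arg u\<bar> \<le> 4"
  using Arg_le_pi[of u] mpi_less_Arg[of u] pi_less_4 by linarith

lemma rot_step:
  assumes "0 < m" shows "of_nat m * cmod (\<i> * Arg u / m) \<le> 4"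
  using abs_Arg_le[of u] assms by (simp add: norm_mult norm_divide)

lemma rot_factor:
  assumes "filterlim m at_top F" "cmod u = 1"
  shows "((\<lambda>n. (1 + \<i> * Arg u / m n) ^ m n) \<longlongrightarrow> u) F"
proof -
  have "u \<noteq> 0" using assms(2) by auto
  then have "exp (\<i> * Arg u) = u" using Arg_eq[of u] assms(2) by simp
  then show ?thesis using tendsto_exp_limit_complex[OF assms(1), of "\<i> * Arg u"] by simp
qed

abbreviation \<kappa>\<^sub>0 :: real where "\<kappa>\<^sub>0 \<equiv> 4 * exp 4"

text \<open>The constant \<open>\<kappa>\<^sub>0\<close> is the factor \<open>x * exp x\<close> of
  \<open>linear_recursion_bound\<close> at \<open>x = 4\<close>, a convenient bound for the angle
  \<open>\<bar>Arg u\<bar>\<close>, which is at most pi.\<close>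

lemma rot_const:
  assumes "0 < m" "0 \<le> \<eta>"
  shows "(of_nat m * cmod (\<i> * Arg u / m)) * exp (of_nat m * cmod (\<i> * Arg u / m)) * \<eta> \<le> \<kappa>\<^sub>0 * \<eta>"
  using rot_step[OF assms(1), of u] assms(2) by (intro mult_right_mono mult_mono) auto

lemma norm_rot:
  assumes "norm h \<le> 1" "0 < m" shows "1 + norm (rot u h m) \<le> exp 4"
proof -
  have "1 + norm (rot u h m) \<le> (1 + cmod (\<i> * Arg u / m)) ^ m"
    unfolding rot_def by (rule euler_norm[OF assms(1)])
  also have "\<dots> \<le> exp (of_nat m * cmod (\<i> * Arg u / m))" by (rule power_le_exp) simp
  finally show ?thesis using rot_step[OF assms(2), of u] by (meson exp_le_cancel_iff order_trans)
qed

lemma rot_eigen: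
  assumes "norm h \<le> 1" "0 < m"
  shows "norm (c + rot u h m * c - (1 + \<i> * Arg u / m) ^ m *\<^sub>C c) \<le> \<kappa>\<^sub>0 * norm (h * c - c)"
    and "norm (c + c * rot u h m - (1 + \<i> * Arg u / m) ^ m *\<^sub>C c) \<le> \<kappa>\<^sub>0 * norm (c * h - c)"
    and "norm (rot u h m * c) \<le> \<kappa>\<^sub>0 * norm (h * c)"
    and "norm (g * rot u h m - rot u h m) \<le> \<kappa>\<^sub>0 * norm (g * h - h)"
proof -
  let ?\<tau> = "\<i> * Arg u / m"
  have "norm (c + euler ?\<tau> h m * c - (1 + ?\<tau> * 1) ^ m *\<^sub>C c) \<le> (m * cmod ?\<tau>) * exp (m * cmod ?\<tau>) * norm (h * c - c)"
    by (rule euler_eigen[OF assms(1)]) (simp_all add: scaleC_one)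
  then show "norm (c + rot u h m * c - (1 + ?\<tau>) ^ m *\<^sub>C c) \<le> \<kappa>\<^sub>0 * norm (h * c - c)"
    unfolding rot_def mult_1_right by (rule order_trans[OF _ rot_const[OF assms(2)]]) simp
  have "norm (c + euler ?\<tau> h m * c - (1 + ?\<tau> * 0) ^ m *\<^sub>C c) \<le> (m * cmod ?\<tau>) * exp (m * cmod ?\<tau>) * norm (h * c)"
    by (rule euler_eigen[OF assms(1)]) simp_all
  then have "norm (rot u h m * c) \<le> (m * cmod ?\<tau>) * exp (m * cmod ?\<tau>) * norm (h * c)"
    by (simp only: mult_zero_right add_0_right power_one scaleC_one add_diff_cancel_left' rot_def)
  then show "norm (rot u h m * c) \<le> \<kappa>\<^sub>0 * norm (h * c)"
    by (rule order_trans[OF _ rot_const[OF assms(2)]]) simp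
  show "norm (c + c * rot u h m - (1 + ?\<tau>) ^ m *\<^sub>C c) \<le> \<kappa>\<^sub>0 * norm (c * h - c)"
    unfolding rot_def by (rule order_trans[OF euler_eigen_right[OF assms(1) order_refl] rot_const[OF assms(2)]]) simp
  show "norm (g * rot u h m - rot u h m) \<le> \<kappa>\<^sub>0 * norm (g * h - h)"
    unfolding rot_def by (rule order_trans[OF euler_absorb[OF assms(1) order_refl] rot_const[OF assms(2)]]) simp
qed

lemma rot_absorb_right:
  assumes "norm h \<le> 1" "0 < m"
  shows "norm (rot u h m * g - rot u h m) \<le> \<kappa>\<^sub>0 * norm (h * g - h)"
  unfolding rot_def by (rule order_trans[OF euler_absorb_right[OF assms(1) order_refl] rot_const[OF assms(2)]]) simp

section \<open>Asymptotically equal sequences\<close>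

text \<open>Multiplication respects this relation only next to bounded factors, which is why uniform
  norm bounds accompany the sequences below.\<close>

definition asym_eq :: "(nat \<Rightarrow> 'a::real_normed_vector) \<Rightarrow> (nat \<Rightarrow> 'a) \<Rightarrow> bool"  (infix \<open>\<simeq>\<close> 50) where
  "x \<simeq> y \<longleftrightarrow> (\<lambda>n. norm (x n - y n)) \<longlonglongrightarrow> 0"

lemma asym_eq_iff: "x \<simeq> y \<longleftrightarrow> (\<lambda>n. x n - y n) \<longlonglongrightarrow> 0"
  by (simp add: asym_eq_def tendsto_norm_zero_iff)

lemma asym_refl [simp]: "x \<simeq> x"
  by (simp add: asym_eq_def)

lemma asym_sym: "x \<simeq> y \<Longrightarrow> y \<simeq> x"
  by (simp add: asym_eq_def norm_minus_commute)

lemma asym_trans [trans]: "x \<simeq> y \<Longrightarrow> y \<simeq> z \<Longrightarrow> x \<simeq> z"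
  unfolding asym_eq_iff using tendsto_add[of "\<lambda>n. x n - y n" 0 _ "\<lambda>n. y n - z n" 0] by simp

lemma asym_add: "x \<simeq> y \<Longrightarrow> x' \<simeq> y' \<Longrightarrow> (\<lambda>n. x n + x' n) \<simeq> (\<lambda>n. y n + y' n)"
  unfolding asym_eq_iff using tendsto_add[of "\<lambda>n. x n - y n" 0 _ "\<lambda>n. x' n - y' n" 0] by (simp add: algebra_simps)

lemma asym_diff: "x \<simeq> y \<Longrightarrow> x' \<simeq> y' \<Longrightarrow> (\<lambda>n. x n - x' n) \<simeq> (\<lambda>n. y n - y' n)"
  unfolding asym_eq_iff using tendsto_diff[of "\<lambda>n. x n - y n" 0 _ "\<lambda>n. x' n - y' n" 0] by (simp add: algebra_simps)

lemma asym_scaleC: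
  fixes x y :: "nat \<Rightarrow> 'a::complex_banach_algebra"
  shows "x \<simeq> y \<Longrightarrow> (\<lambda>n. c *\<^sub>C x n) \<simeq> (\<lambda>n. c *\<^sub>C y n)"
  unfolding asym_eq_def using tendsto_mult_left[of "\<lambda>n. norm (x n - y n)" 0 _ "cmod c"]
  by (simp add: norm_scaleC flip: scaleC_diff_right)

lemma asym_bound:
  assumes "x \<simeq> y" "\<And>n. norm (x' n - y' n) \<le> C * norm (x n - y n)"
  shows "x' \<simeq> y'"
proof -
  have "(\<lambda>n. C * norm (x n - y n)) \<longlonglongrightarrow> 0"
    using assms(1) tendsto_mult_left[of "\<lambda>n. norm (x n - y n)" 0 _ C] by (simp add: asym_eq_def)
  then show ?thesis unfolding asym_eq_iff
    by (rule Lim_null_comparison[rotated]) (simp add: assms(2))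
qed

lemma asym_mult_left:
  fixes x y z :: "nat \<Rightarrow> 'a::complex_banach_algebra"
  assumes "x \<simeq> y" "\<And>n. norm (z n) \<le> C"
  shows "(\<lambda>n. z n * x n) \<simeq> (\<lambda>n. z n * y n)"
proof (rule asym_bound[OF assms(1)])
  fix n
  have "norm (z n * (x n - y n)) \<le> C * norm (x n - y n)"
    by (rule order_trans[OF norm_mult_ineq mult_right_mono[OF assms(2)]]) simp
  then show "norm (z n * x n - z n * y n) \<le> C * norm (x n - y n)" by (simp add: right_diff_distrib)
qed

lemma asym_mult_right:
  fixes x y z :: "nat \<Rightarrow> 'a::complex_banach_algebra"
  assumes "x \<simeq> y" "\<And>n. norm (z n) \<le> C"
  shows "(\<lambda>n. x n * z n) \<simeq> (\<lambda>n. y n * z n)"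
proof (rule asym_bound[OF assms(1)])
  fix n
  have "norm ((x n - y n) * z n) \<le> norm (x n - y n) * C"
    by (rule order_trans[OF norm_mult_ineq mult_left_mono[OF assms(2)]]) simp
  then show "norm (x n * z n - y n * z n) \<le> C * norm (x n - y n)" by (simp add: left_diff_distrib mult.commute)
qed

lemma asym_scaleC_tendsto:
  fixes x :: "nat \<Rightarrow> 'a::complex_banach_algebra"
  assumes "c \<longlonglongrightarrow> u" "\<And>n. norm (x n) \<le> C"
  shows "(\<lambda>n. c n *\<^sub>C x n) \<simeq> (\<lambda>n. u *\<^sub>C x n)"
proof -
  have "(\<lambda>n. c n - u) \<longlonglongrightarrow> 0" using assms(1) by (simp add: LIM_zero)
  then have "(\<lambda>n. cmod (c n - u) * C) \<longlonglongrightarrow> 0"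
    by (intro tendsto_mult_left_zero tendsto_norm_zero)
  then show ?thesis unfolding asym_eq_iff
    by (rule Lim_null_comparison[rotated]) (simp add: norm_minus_scaleC assms(2) mult_left_mono)
qed

locale rotations =
  fixes h :: "nat \<Rightarrow> 'a::complex_banach_algebra" and m :: "nat \<Rightarrow> nat"
  assumes h: "\<And>n. norm (h n) \<le> 1" and m: "filterlim m at_top sequentially" "\<And>n. 0 < m n"
begin

abbreviation "E u n \<equiv> rot u (h n) (m n)"

lemma E_bound: "norm (E u n) \<le> exp 4"
  using norm_rot[OF h m(2), of u n n] by linarith

lemma E_absorbed: "(\<lambda>n. g n * h n) \<simeq> h \<Longrightarrow> (\<lambda>n. g n * E u n) \<simeq> E u"
  by (erule asym_bound) (rule rot_eigen(4)[OF h m(2)])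

lemma E_absorbed_right: "(\<lambda>n. h n * g n) \<simeq> h \<Longrightarrow> (\<lambda>n. E u n * g n) \<simeq> E u"
  by (erule asym_bound) (rule rot_absorb_right[OF h m(2)])

lemma E_kill: "(\<lambda>n. h n * c n) \<simeq> (\<lambda>_. 0) \<Longrightarrow> (\<lambda>n. E u n * c n) \<simeq> (\<lambda>_. 0)"
  by (erule asym_bound[where C = \<kappa>\<^sub>0]) (simp add: rot_eigen(3)[OF h m(2)])

lemma E_low:
  assumes "(\<lambda>n. h n * c n) \<simeq> c" "\<And>n. norm (c n) \<le> C" "cmod u = 1"
  shows "(\<lambda>n. c n + E u n * c n) \<simeq> (\<lambda>n. u *\<^sub>C c n)"
proof -
  have "(\<lambda>n. c n + E u n * c n) \<simeq> (\<lambda>n. (1 + \<i> * Arg u / m n) ^ m n *\<^sub>C c n)"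
    using assms(1) by (rule asym_bound) (rule rot_eigen(1)[OF h m(2)])
  also have "\<dots> \<simeq> (\<lambda>n. u *\<^sub>C c n)"
    by (rule asym_scaleC_tendsto[OF rot_factor[OF m(1) assms(3)] assms(2)])
  finally show ?thesis .
qed

lemma E_low_right:
  assumes "(\<lambda>n. c n * h n) \<simeq> c" "\<And>n. norm (c n) \<le> C" "cmod u = 1"
  shows "(\<lambda>n. c n + c n * E u n) \<simeq> (\<lambda>n. u *\<^sub>C c n)"
proof -
  have "(\<lambda>n. c n + c n * E u n) \<simeq> (\<lambda>n. (1 + \<i> * Arg u / m n) ^ m n *\<^sub>C c n)"
    using assms(1) by (rule asym_bound) (rule rot_eigen(2)[OF h m(2)])
  also have "\<dots> \<simeq> (\<lambda>n. u *\<^sub>C c n)"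
    by (rule asym_scaleC_tendsto[OF rot_factor[OF m(1) assms(3)] assms(2)])
  finally show ?thesis .
qed

end

context Lp_representation
begin

lemma rep_asym:
  assumes "x \<simeq> y" "\<And>n. norm (x n) \<le> C" "\<And>n. norm (y n) \<le> C" "\<And>n. \<L> (g n)" "\<And>n. \<I> (g n) \<le> 1"
  shows "(\<lambda>n. \<I> (\<pi> (x n) (g n)) - \<I> (\<pi> (y n) (g n))) \<longlonglongrightarrow> 0"
proof (rule Lp_int_tendsto_diff)
  have "(\<lambda>n. \<I> (\<pi> (x n - y n) (g n))) \<longlonglongrightarrow> 0"
    using assms(1) by (intro rep_tendsto_0[OF _ assms(4,5)]) (simp add: asym_eq_def)
  moreover have "\<I> (\<pi> (x n - y n) (g n)) = \<I> (\<lambda>t. \<pi> (x n) (g n) t - \<pi> (y n) (g n) t)" for n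
    by (intro Lp_int_cong_AE meas \<L>_intros assms rep_diff)
  ultimately show "(\<lambda>n. \<I> (\<lambda>t. \<pi> (x n) (g n) t - \<pi> (y n) (g n) t)) \<longlonglongrightarrow> 0" by simp
  show "\<I> (\<pi> (x n) (g n)) \<le> C powr p * 1" "\<I> (\<pi> (y n) (g n)) \<le> C powr p * 1" for n
    by (intro rep_bound_le assms)+
qed (intro \<L>_intros assms)+

lemma rep_sum: "\<L> g \<Longrightarrow> \<I> (\<pi> (x + y) g) = \<I> (\<lambda>t. \<pi> x g t + \<pi> y g t)"
  by (intro Lp_int_cong_AE meas \<L>_intros rep_add)

end

lemma norm_mult_le:
  fixes x y :: "'a::real_normed_algebra"
  assumes "norm x \<le> C" "norm y \<le> D"
  shows "norm (x * y) \<le> C * D"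
  using assms by (meson norm_ge_zero norm_mult_ineq mult_mono order_trans)

text \<open>
  Levels of a chain of approximate identities, each absorbing the earlier ones from both sides.
  The elements \<open>P k = (1 - U k) / 2\<close>, with \<open>U k = 1 + E k (- 1)\<close> the rotation by \<open>\<pi>\<close>, act as
  approximate projections. An element \<open>x\<close> absorbed by the levels \<open>2, 4, 6\<close> and an element \<open>y\<close>
  annihilated by them are asymptotically disjoint: level \<open>4\<close> rotates \<open>x\<close>, the product of the
  rotations of levels \<open>2\<close> and \<open>6\<close> is \<open>- 1\<close> on what is between the levels \<open>3\<close> and \<open>5\<close>.
\<close>

locale chain = Lp_representation p M \<pi>
  for p :: real and M :: "'b measure" and \<pi> :: "'a::complex_banach_algebra \<Rightarrow> 'b fun_op" +
  fixes H :: "nat \<Rightarrow> nat \<Rightarrow> 'a" and m :: "nat \<Rightarrow> nat \<Rightarrow> nat" and \<rho> :: "nat \<Rightarrow> real"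
  assumes p2: "p \<noteq> 2"
    and H: "\<And>k n. norm (H k n) \<le> 1"
    and m: "\<And>k. filterlim (m k) at_top sequentially" "\<And>k n. 0 < m k n"
    and iso: "\<And>k n u c. k < 8 \<Longrightarrow> cmod u = 1 \<Longrightarrow> norm (c + rot u (H k n) (m k n) * c) \<le> \<rho> n * norm c"
    and \<rho>: "\<rho> \<longlonglongrightarrow> 1" "\<And>n. 1 \<le> \<rho> n"
    and up: "\<And>k l. k < l \<Longrightarrow> l \<le> 8 \<Longrightarrow> (\<lambda>n. H l n * H k n) \<simeq> H k"
    and down: "\<And>k l. k < l \<Longrightarrow> l \<le> 8 \<Longrightarrow> (\<lambda>n. H k n * H l n) \<simeq> H k"
begin

sublocale R: rotations "H k" "m k" for k
  by unfold_locales (simp_all add: H m)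


abbreviation "E k u n \<equiv> rot u (H k n) (m k n)"

lemma E_bound: "norm (E k u n) \<le> exp 4"
  and E_absorbed: "(\<lambda>n. g n * H k n) \<simeq> H k \<Longrightarrow> (\<lambda>n. g n * E k u n) \<simeq> E k u"
  and E_kill: "(\<lambda>n. H k n * c n) \<simeq> (\<lambda>_. 0) \<Longrightarrow> (\<lambda>n. E k u n * c n) \<simeq> (\<lambda>_. 0)"
  and E_low: "(\<lambda>n. H k n * c n) \<simeq> c \<Longrightarrow> (\<And>n. norm (c n) \<le> C) \<Longrightarrow> cmod u = 1 \<Longrightarrow>
    (\<lambda>n. c n + E k u n * c n) \<simeq> (\<lambda>n. u *\<^sub>C c n)"
  and E_low_right: "(\<lambda>n. c n * H k n) \<simeq> c \<Longrightarrow> (\<And>n. norm (c n) \<le> C) \<Longrightarrow> cmod u = 1 \<Longrightarrow>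
    (\<lambda>n. c n + c n * E k u n) \<simeq> (\<lambda>n. u *\<^sub>C c n)"
  by (fact R.E_bound R.E_absorbed R.E_kill R.E_low R.E_low_right)+

lemma iso_le: "k < 8 \<Longrightarrow> cmod u = 1 \<Longrightarrow> norm c \<le> C \<Longrightarrow> norm (c + E k u n * c) \<le> \<rho> n * C"
  using \<rho>(2)[of n] by (intro order_trans[OF iso mult_left_mono]) auto

definition "P k n = (- 1 / 2) *\<^sub>C E k (- 1) n"

lemma P_act: "P k n * c = (1 / 2) *\<^sub>C c - (1 / 2) *\<^sub>C (c + E k (- 1) n * c)"
  by (simp add: P_def mult_scaleC_left scaleC_add_right scaleC_minus_left)

lemma P_norm: "norm (P k n) \<le> exp 4"
proof -
  have "cmod (- 1 / 2) * norm (E k (- 1) n) \<le> 1 * exp 4" by (intro mult_mono E_bound) auto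
  then show ?thesis by (simp add: P_def norm_scaleC)
qed

lemma P_contractive: "k < 8 \<Longrightarrow> norm (P k n * c) \<le> \<rho> n * norm c"
proof -
  assume k: "k < 8"
  have "norm (P k n * c) \<le> 1 / 2 * norm c + 1 / 2 * norm (c + E k (- 1) n * c)"
    unfolding P_act by (rule order_trans[OF norm_triangle_ineq4]) (simp add: norm_scaleC)
  also have "\<dots> \<le> 1 / 2 * (\<rho> n * norm c) + 1 / 2 * (\<rho> n * norm c)"
    using iso[OF k, of "- 1" c n] mult_right_mono[OF \<rho>(2)[of n], of "norm c"] by (intro add_mono mult_left_mono) auto
  finally show ?thesis by (simp add: mult.commute)
qed

lemma absorb_E: "k < l \<Longrightarrow> l \<le> 8 \<Longrightarrow> (\<lambda>n. H l n * E k u n) \<simeq> E k u"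
  by (rule E_absorbed[OF up])

lemma absorb_P: "k < l \<Longrightarrow> l \<le> 8 \<Longrightarrow> (\<lambda>n. H l n * P k n) \<simeq> P k"
  using asym_scaleC[OF absorb_E[of k l "- 1"], of "- 1 / 2"] by (simp add: P_def[abs_def] mult_scaleC_right)

lemma absorb_P_act:
  assumes "k < l" "l \<le> 8" "\<And>n. norm (c n) \<le> C"
  shows "(\<lambda>n. H l n * (P k n * c n)) \<simeq> (\<lambda>n. P k n * c n)"
  using asym_mult_right[OF absorb_P[OF assms(1,2)] assms(3)] by (simp add: mult.assoc)

lemma below_E:
  assumes "k < l" "l \<le> 8" "cmod u = 1"
  shows "(\<lambda>n. H k n * E l u n) \<simeq> (\<lambda>n. (u - 1) *\<^sub>C H k n)"
proof -
  have "(\<lambda>n. (H k n + H k n * E l u n) - H k n) \<simeq> (\<lambda>n. u *\<^sub>C H k n - H k n)"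
    by (intro asym_diff asym_refl E_low_right[OF down[OF assms(1,2)] H assms(3)])
  then show ?thesis by (simp add: scaleC_diff_left scaleC_one)
qed

lemma below_P: "k < l \<Longrightarrow> l \<le> 8 \<Longrightarrow> (\<lambda>n. H k n * P l n) \<simeq> H k"
  using asym_scaleC[OF below_E[of k l "- 1"], of "- 1 / 2"]
  by (simp add: P_def mult_scaleC_right scaleC_scaleC scaleC_one)

lemma disjoint_levels:
  assumes g: "\<And>n. \<L> (g n)" "\<And>n. \<I> (g n) \<le> 1"
    and x: "\<And>n. norm (x n) \<le> C" "\<And>l. l \<in> {2, 4, 6, 8} \<Longrightarrow> (\<lambda>n. H l n * x n) \<simeq> x"
    and y: "\<And>n. norm (y n) \<le> C" "\<And>l. l \<in> {2, 4, 6} \<Longrightarrow> (\<lambda>n. H l n * y n) \<simeq> (\<lambda>_. 0)"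
      "(\<lambda>n. H 8 n * y n) \<simeq> y"
  shows "(\<lambda>n. \<I> (\<pi> (x n + y n) (g n)) - \<I> (\<pi> (x n) (g n)) - \<I> (\<pi> (y n) (g n))) \<longlonglongrightarrow> 0"
proof -
  \<comment> \<open>\<open>H 8\<close> plays the unit, cut into \<open>H 3\<close>,
    \<open>H 8 - H 5\<close> and the middle piece \<open>d\<close>. The rotation of level 4 nearly
    multiplies the first by \<open>u\<close> and fixes the second; what it makes of \<open>d\<close>
    is \<open>\<mu>\<close> and is left open. In \<open>w\<close> the levels 2 and 6 both reverse
    the sign of \<open>x\<close> and fix \<open>y\<close>, while on \<open>\<mu>\<close> level 2
    acts trivially and level 6 as \<open>-1\<close>.\<close>
  define v where "v u n = H 8 n + E 4 u n * H 8 n" for u n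
  define w\<^sub>1 where "w\<^sub>1 n = H 8 n + E 2 (- 1) n * H 8 n" for n
  define w where "w n = w\<^sub>1 n + E 6 (- 1) n * w\<^sub>1 n" for n
  define d where "d n = H 5 n - H 3 n" for n
  define q where "q n = H 8 n - H 5 n" for n
  define \<mu> where "\<mu> u n = d n + E 4 u n * d n" for u n
  have d: "norm (d n) \<le> 2" for n
    using norm_triangle_ineq4[of "H 5 n" "H 3 n"] H[of 5 n] H[of 3 n] by (simp add: d_def)
  have \<mu>: "norm (\<mu> u n) \<le> 2 + exp 4 * 2" for u n
    unfolding \<mu>_def by (intro order_trans[OF norm_triangle_ineq] add_mono d norm_mult_le E_bound)
  have v\<rho>: "norm (v u n) \<le> \<rho> n * 1" if "cmod u = 1" for u n
    unfolding v_def by (intro iso_le H that) simp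
  have w1\<rho>: "norm (w\<^sub>1 n) \<le> \<rho> n * 1" for n
    unfolding w\<^sub>1_def by (intro iso_le H) simp_all
  have w\<rho>: "norm (w n) \<le> \<rho> n * (\<rho> n * 1)" for n
    unfolding w_def by (intro iso_le w1\<rho>) simp_all
  have \<rho>1: "\<rho> n \<le> \<rho> n * \<rho> n" for n using mult_left_mono[OF \<rho>(2)[of n], of "\<rho> n"] \<rho>(2)[of n] by simp
  have v_act: "(\<lambda>n. v u n * z n) \<simeq> (\<lambda>n. z n + E 4 u n * z n)" if "(\<lambda>n. H 8 n * z n) \<simeq> z" for u z
    using asym_add[OF that asym_mult_left[OF that E_bound[of u 4]]] by (simp add: v_def distrib_right mult.assoc)
  have w1_act: "(\<lambda>n. w\<^sub>1 n * z n) \<simeq> (\<lambda>n. z n + E 2 (- 1) n * z n)" if "(\<lambda>n. H 8 n * z n) \<simeq> z" for z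
    using asym_add[OF that asym_mult_left[OF that E_bound[of "- 1" 2]]] by (simp add: w\<^sub>1_def distrib_right mult.assoc)
  have w_act: "(\<lambda>n. w n * z n) \<simeq> (\<lambda>n. z' n + E 6 (- 1) n * z' n)" if "(\<lambda>n. w\<^sub>1 n * z n) \<simeq> z'" for z z'
    using asym_add[OF that asym_mult_left[OF that E_bound[of "- 1" 6]]] by (simp add: w_def distrib_right mult.assoc)
  have fixed: "(\<lambda>n. z n + E k u n * z n) \<simeq> z" if "(\<lambda>n. H k n * z n) \<simeq> (\<lambda>_. 0)" for k u z
    using asym_add[OF asym_refl[of z] E_kill[OF that, of u]] by simp
  have neg: "(\<lambda>n. z n + E k (- 1) n * z n) \<simeq> (\<lambda>n. - z n)" if "(\<lambda>n. H k n * z n) \<simeq> z" "\<And>n. norm (z n) \<le> D" for k z D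
    using E_low[OF that, of "- 1"] by (simp add: scaleC_minus_one)
  have minus: "(\<lambda>n. - z n) \<simeq> (\<lambda>n. - z' n)" if "z \<simeq> z'" for z z' :: "nat \<Rightarrow> 'a"
    using asym_diff[OF asym_refl[of "\<lambda>_. 0"] that] by simp
  have vx: "(\<lambda>n. v u n * x n) \<simeq> (\<lambda>n. u *\<^sub>C x n)" if "cmod u = 1" for u
    by (rule asym_trans[OF v_act E_low[OF _ x(1) that]]) (simp_all add: x)
  have vy: "(\<lambda>n. v u n * y n) \<simeq> y" for u
    by (rule asym_trans[OF v_act fixed]) (simp_all add: y)
  have w1x: "(\<lambda>n. w\<^sub>1 n * x n) \<simeq> (\<lambda>n. - x n)"
    by (rule asym_trans[OF w1_act neg[OF _ x(1)]]) (simp_all add: x)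
  have wx: "(\<lambda>n. w n * x n) \<simeq> x"
  proof -
    have "(\<lambda>n. w n * x n) \<simeq> (\<lambda>n. - x n + E 6 (- 1) n * (- x n))" by (rule w_act[OF w1x])
    also have "\<dots> \<simeq> (\<lambda>n. - (- x n))"
      using minus[OF neg[OF x(2) x(1), of 6]] by simp
    finally show ?thesis by simp
  qed
  have w1y: "(\<lambda>n. w\<^sub>1 n * y n) \<simeq> y" by (rule asym_trans[OF w1_act fixed]) (simp_all add: y)
  have wy: "(\<lambda>n. w n * y n) \<simeq> y" by (rule asym_trans[OF w_act[OF w1y] fixed]) (simp_all add: y)
  have up_d: "(\<lambda>n. H l n * d n) \<simeq> d" if "l \<in> {6, 8}" for l
    using asym_diff[OF up[of 5 l] up[of 3 l]] that by (auto simp: d_def[abs_def] right_diff_distrib)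
  have up_\<mu>: "(\<lambda>n. H l n * \<mu> u n) \<simeq> \<mu> u" if "l \<in> {6, 8}" for l u
    using asym_add[OF up_d[OF that] asym_mult_right[OF absorb_E[of 4 l u] d]] that
    by (auto simp: \<mu>_def[abs_def] distrib_left mult.assoc)
  have kill_d: "(\<lambda>n. H 2 n * d n) \<simeq> (\<lambda>_. 0)"
    using asym_diff[OF down[of 2 5] down[of 2 3]] by (simp add: d_def right_diff_distrib)
  have kill_\<mu>: "(\<lambda>n. H 2 n * \<mu> u n) \<simeq> (\<lambda>_. 0)" if u: "cmod u = 1" for u
  proof -
    have "(\<lambda>n. H 2 n * E 4 u n * d n) \<simeq> (\<lambda>n. ((u - 1) *\<^sub>C H 2 n) * d n)"
      by (rule asym_mult_right[OF below_E d]) (simp_all add: u)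
    also have "(\<lambda>n. ((u - 1) *\<^sub>C H 2 n) * d n) \<simeq> (\<lambda>n. (u - 1) *\<^sub>C 0)"
      using asym_scaleC[OF kill_d, of "u - 1"] by (simp only: mult_scaleC_left)
    finally show ?thesis
      using asym_add[OF kill_d] by (simp add: \<mu>_def distrib_left mult.assoc)
  qed
  have w1\<mu>: "(\<lambda>n. w\<^sub>1 n * \<mu> u n) \<simeq> \<mu> u" if "cmod u = 1" for u
    by (rule asym_trans[OF w1_act fixed]) (simp_all add: up_\<mu> kill_\<mu> that)
  have w\<mu>: "(\<lambda>n. w n * \<mu> u n) \<simeq> (\<lambda>n. - \<mu> u n)" if "cmod u = 1" for u
    by (rule asym_trans[OF w_act[OF w1\<mu>[OF that]] neg[OF _ \<mu>]]) (simp add: up_\<mu>)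
  have split: "v u \<simeq> (\<lambda>n. u *\<^sub>C H 3 n + q n + \<mu> u n)" if u: "cmod u = 1" for u
  proof -
    have "(\<lambda>n. H 4 n * q n) \<simeq> (\<lambda>_. 0)"
      using asym_diff[OF down[of 4 8] down[of 4 5]] by (simp add: q_def right_diff_distrib)
    from asym_add[OF asym_add[OF E_low[OF up[of 3 4] H u] fixed[OF this, of u]] asym_refl[of "\<mu> u"]]
    have "(\<lambda>n. (H 3 n + E 4 u n * H 3 n) + (q n + E 4 u n * q n) + \<mu> u n) \<simeq> (\<lambda>n. u *\<^sub>C H 3 n + q n + \<mu> u n)"
      by simp
    then show ?thesis by (simp add: v_def[abs_def] \<mu>_def q_def d_def algebra_simps)
  qed
  have "(\<lambda>n. \<I> (\<lambda>t. \<pi> (x n) (g n) t + \<pi> (y n) (g n) t) - \<I> (\<pi> (x n) (g n)) - \<I> (\<pi> (y n) (g n))) \<longlonglongrightarrow> 0"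
  proof (rule asymptotically_disjoint[where v = v and w = w and s = "H 3" and q = q and m = \<mu>
        and \<rho> = "\<lambda>n. \<rho> n * \<rho> n" and C = "max C (2 + exp 4 * 2)"])
    show "(\<lambda>n. \<rho> n * \<rho> n) \<longlonglongrightarrow> 1" using tendsto_mult[OF \<rho>(1) \<rho>(1)] by simp
    show "norm (v u n) \<le> \<rho> n * \<rho> n" if "cmod u = 1" for u n using v\<rho>[OF that, of n] \<rho>1[of n] by simp
    show "norm (w n) \<le> \<rho> n * \<rho> n" for n using w\<rho>[of n] by simp
    show "(\<lambda>n. norm (w n * \<mu> u n + \<mu> u n)) \<longlonglongrightarrow> 0" if "cmod u = 1" for u
      using w\<mu>[OF that] by (simp add: asym_eq_def)
  qed (use p2 g x(1) y(1) \<mu> vx vy wx wy split in \<open>auto simp: asym_eq_def le_max_iff_disj\<close>)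
  then show ?thesis by (simp add: rep_sum g)
qed

text \<open>Levels 0, 1 and 7 are placed around 2, 4 and 6: what \<open>P 0\<close> or
  \<open>P 1\<close> produces is absorbed by these three, what \<open>P 7\<close> leaves over is
  annihilated by them. \<open>P 0\<close> follows the multiplier \<open>a + s 1\<close>, because the
  multiplier need not keep the range of \<open>P 1\<close> absorbed.\<close>

lemma key_bound:
  assumes c: "\<And>n. norm (c n) \<le> 1" "(\<lambda>n. H 8 n * c n) \<simeq> c"
    and b: "\<And>z. norm (a * z + s *\<^sub>C z) \<le> norm z" and \<alpha>: "cmod \<alpha> \<le> 1" and e: "0 < \<epsilon>"
  shows "\<forall>\<^sub>F n in sequentially.
    norm (P 0 n * (a * (P 1 n * c n) + s *\<^sub>C (P 1 n * c n)) + \<alpha> *\<^sub>C (c n - P 7 n * c n)) \<le> 1 + \<epsilon>"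
proof -
  define K :: real where "K = exp 4"
  have K: "1 \<le> K" by (simp add: K_def)
  define X where "X n = P 1 n * c n" for n
  define Y where "Y n = c n - P 7 n * c n" for n
  define X' where "X' n = P 0 n * (a * X n + s *\<^sub>C X n)" for n
  define Z where "Z n = X' n + \<alpha> *\<^sub>C Y n" for n
  have X: "norm (X n) \<le> K * 1" for n unfolding X_def K_def by (intro norm_mult_le P_norm c)
  have Y: "norm (Y n) \<le> 1 + K * 1" for n
    unfolding Y_def K_def by (intro order_trans[OF norm_triangle_ineq4] add_mono norm_mult_le P_norm c)
  have bX: "norm (a * X n + s *\<^sub>C X n) \<le> K * 1" for n by (rule order_trans[OF b X])
  have X': "norm (X' n) \<le> K * (K * 1)" for n
    unfolding X'_def using norm_mult_le[OF P_norm bX] by (simp add: K_def)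
  have KK: "K \<le> 1 + K * K" "1 + K \<le> 1 + K * K" "K * K \<le> 1 + K * K" 
  proof -
    have "K \<le> K * K" using K by simp
    then show "K \<le> 1 + K * K" "1 + K \<le> 1 + K * K" "K * K \<le> 1 + K * K" by linarith+
  qed
  have \<alpha>Y: "norm (\<alpha> *\<^sub>C Y n) \<le> 1 + K * 1" for n
    using mult_mono[OF \<alpha> Y[of n]] by (simp add: norm_scaleC)
  have bd: "norm (X n) \<le> 1 + K * K" "norm (Y n) \<le> 1 + K * K" "norm (X' n) \<le> 1 + K * K" "norm (\<alpha> *\<^sub>C Y n) \<le> 1 + K * K" for n
    using X[of n] Y[of n] X'[of n] \<alpha>Y[of n] KK by linarith+
  \<comment> \<open>The norm need not be attained, so a slack of \<open>1 / Suc n\<close> is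
    allowed; the maximum with 0 covers \<open>Z n\<close> of norm below the slack.\<close>
  have "\<exists>g. \<L> g \<and> \<I> g \<le> 1 \<and> (max 0 (norm (Z n) - 1 / real (Suc n))) powr p \<le> \<I> (\<pi> (Z n) g)" for n
  proof (cases "Z n = 0")
    case True
    have "max 0 (norm (Z n) - 1 / real (Suc n)) = 0" using True by simp
    then show ?thesis by (intro exI[of _ "\<lambda>_. 0"]) (auto simp: Lp_fun_def Lp_int_def)
  next
    case False
    then obtain g where "\<L> g" "\<I> g \<le> 1" "(max 0 (norm (Z n) - 1 / real (Suc n))) powr p < \<I> (\<pi> (Z n) g)"
      using rep_norming[of "max 0 (norm (Z n) - 1 / real (Suc n))" "Z n"] by auto
    then show ?thesis by (intro exI[of _ g]) simp
  qed
  then obtain g where g: "\<And>n. \<L> (g n)" "\<And>n. \<I> (g n) \<le> 1"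
    and norming: "\<And>n. (max 0 (norm (Z n) - 1 / real (Suc n))) powr p \<le> \<I> (\<pi> (Z n) (g n))"
    by metis
  have X_low: "(\<lambda>n. H l n * X n) \<simeq> X" if "l \<in> {2, 4, 6, 7, 8}" for l
    using absorb_P_act[of 1 l c 1] that c by (auto simp: X_def[abs_def])
  have X'_low: "(\<lambda>n. H l n * X' n) \<simeq> X'" if "l \<in> {2, 4, 6, 8}" for l
    using absorb_P_act[of 0 l _ "K * 1", OF _ _ bX] that by (auto simp: X'_def[abs_def])
  have Y_high: "(\<lambda>n. H l n * Y n) \<simeq> (\<lambda>_. 0)" if "l \<in> {2, 4, 6}" for l
    using asym_diff[OF asym_refl[of "\<lambda>n. H l n * c n"] asym_mult_right[where z = c, OF below_P[of l 7] c(1)]] that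
    by (auto simp: Y_def right_diff_distrib mult.assoc)
  have Y_8: "(\<lambda>n. H 8 n * Y n) \<simeq> Y"
    using asym_diff[OF c(2) absorb_P_act[of 7 8 c 1]] c(1) by (auto simp: Y_def[abs_def] right_diff_distrib)
  have l1: "(\<lambda>n. \<I> (\<pi> (Z n) (g n)) - \<I> (\<pi> (X' n) (g n)) - \<I> (\<pi> (\<alpha> *\<^sub>C Y n) (g n))) \<longlonglongrightarrow> 0"
    unfolding Z_def
  proof (rule disjoint_levels[OF g, where C = "1 + K * K"])
    show "(\<lambda>n. H l n * \<alpha> *\<^sub>C Y n) \<simeq> (\<lambda>_. 0)" if "l \<in> {2, 4, 6}" for l
      using asym_scaleC[OF Y_high[OF that], of \<alpha>] by (simp add: mult_scaleC_right)
    show "(\<lambda>n. H 8 n * \<alpha> *\<^sub>C Y n) \<simeq> (\<lambda>n. \<alpha> *\<^sub>C Y n)"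
      using asym_scaleC[OF Y_8, of \<alpha>] by (simp add: mult_scaleC_right)
  qed (fact bd X'_low)+
  have l2: "(\<lambda>n. \<I> (\<pi> (X n + Y n) (g n)) - \<I> (\<pi> (X n) (g n)) - \<I> (\<pi> (Y n) (g n))) \<longlonglongrightarrow> 0"
  proof (rule disjoint_levels[OF g, where C = "1 + K * K"])
    show "(\<lambda>n. H l n * X n) \<simeq> X" if "l \<in> {2, 4, 6, 8}" for l by (rule X_low) (use that in blast)
  qed (fact bd Y_high Y_8)+
  \<comment> \<open>The multiplier \<open>a + s 1\<close> need not belong to the algebra and then
    has no operator on L^p. Cutting it with \<open>H 8\<close> gives an element of the algebra of
    norm at most 1 that acts on \<open>X\<close> in the same way up to a vanishing error.\<close>
  define b8 where "b8 n = a * H 8 n + s *\<^sub>C H 8 n" for n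
  have b8: "norm (b8 n) \<le> 1" for n unfolding b8_def by (rule order_trans[OF b H])
  have X'8: "X' \<simeq> (\<lambda>n. (P 0 n * b8 n) * X n)"
  proof -
    have "(\<lambda>n. b8 n * X n) \<simeq> (\<lambda>n. a * X n + s *\<^sub>C X n)"
      using asym_add[OF asym_mult_left[OF X_low[of 8], of "\<lambda>_. a" "norm a"] asym_scaleC[OF X_low[of 8], of s]]
      by (simp add: b8_def distrib_right mult.assoc mult_scaleC_left)
    from asym_mult_left[OF asym_sym[OF this] P_norm[of 0]] show ?thesis
      by (simp add: X'_def[abs_def] mult.assoc)
  qed
  have l3: "(\<lambda>n. \<I> (\<pi> (X' n) (g n)) - \<I> (\<pi> ((P 0 n * b8 n) * X n) (g n))) \<longlonglongrightarrow> 0"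
  proof (rule rep_asym[OF X'8 _ _ g])
    show "norm (X' n) \<le> K * 1 * (K * 1)" for n using X'[of n] by simp
    show "norm (P 0 n * b8 n * X n) \<le> K * 1 * (K * 1)" for n
      unfolding K_def using X[of n] by (intro norm_mult_le P_norm b8) (simp add: K_def)
  qed
  have le3: "\<I> (\<pi> ((P 0 n * b8 n) * X n) (g n)) \<le> \<rho> n powr p * \<I> (\<pi> (X n) (g n))" for n
  proof -
    have "\<rho> n * norm (b8 n) \<le> \<rho> n * 1" using \<rho>(2)[of n] by (intro mult_left_mono b8) simp
    then have Pb: "norm (P 0 n * b8 n) \<le> \<rho> n" using P_contractive[of 0 n "b8 n"] by simp
    have "\<I> (\<pi> ((P 0 n * b8 n) * X n) (g n)) = \<I> (\<pi> (P 0 n * b8 n) (\<pi> (X n) (g n)))"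
      by (intro Lp_int_cong_AE meas \<L>_intros g rep_mult)
    also have "\<dots> \<le> \<rho> n powr p * \<I> (\<pi> (X n) (g n))"
      by (intro rep_bound_le \<L>_intros g order_refl Pb)
    finally show ?thesis .
  qed
  \<comment> \<open>With \<open>U k = 1 + E k (- 1)\<close> this is half of \<open>c\<close> plus
    \<open>U 7\<close> applied to \<open>U 1\<close> applied to \<open>c\<close>. Since
    \<open>E 7 (- 1)\<close> is nearly \<open>-2\<close> on the range of \<open>E 1 (- 1)\<close>,
    it agrees in the limit with \<open>X + Y\<close>.\<close>
  define V where "V n = (1 / 2) *\<^sub>C (c n + ((c n + E 1 (- 1) n * c n) + E 7 (- 1) n * (c n + E 1 (- 1) n * c n)))" for n
  have V: "norm (V n) \<le> \<rho> n * \<rho> n" for n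
  proof -
    have 2: "norm ((c n + E 1 (- 1) n * c n) + E 7 (- 1) n * (c n + E 1 (- 1) n * c n)) \<le> \<rho> n * (\<rho> n * 1)"
      by (intro iso_le c) simp_all
    have 3: "1 \<le> \<rho> n * \<rho> n" using mult_mono[OF \<rho>(2)[of n] \<rho>(2)[of n]] \<rho>(2)[of n] by simp
    have "norm (V n) \<le> 1 / 2 * (norm (c n) + norm ((c n + E 1 (- 1) n * c n) + E 7 (- 1) n * (c n + E 1 (- 1) n * c n)))"
      unfolding V_def norm_scaleC by (intro mult_mono norm_triangle_ineq) auto
    also have "\<dots> \<le> \<rho> n * \<rho> n" using 2[unfolded mult_1_right] 3 c(1)[of n] by simp
    finally show ?thesis .
  qed
  have XYV: "(\<lambda>n. X n + Y n) \<simeq> V"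
  proof -
    have "(\<lambda>n. E 7 (- 1) n * X n) \<simeq> (\<lambda>n. - 2 *\<^sub>C X n)"
    proof -
      have "(\<lambda>n. (X n + E 7 (- 1) n * X n) - X n) \<simeq> (\<lambda>n. (- 1) *\<^sub>C X n - X n)"
        by (intro asym_diff asym_refl E_low[OF X_low[of 7] X]) simp_all
      moreover have "- 2 *\<^sub>C X n = (- 1) *\<^sub>C X n - X n" for n
        using scaleC_diff_left[of "- 1" 1 "X n"] by (simp add: scaleC_one)
      ultimately show ?thesis by simp
    qed
    then have "(\<lambda>n. E 7 (- 1) n * (E 1 (- 1) n * c n)) \<simeq> (\<lambda>n. - 2 *\<^sub>C (E 1 (- 1) n * c n))"
      using asym_scaleC[of "\<lambda>n. E 7 (- 1) n * X n" _ "- 2"]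
      by (simp add: X_def P_def mult_scaleC_left mult_scaleC_right scaleC_scaleC scaleC_one)
    note * = asym_scaleC[OF asym_sym[OF this], of "1 / 2"]
    have "(\<lambda>n. c n + (1/2) *\<^sub>C (E 1 (- 1) n * c n) + (1/2) *\<^sub>C (E 7 (- 1) n * c n) + (1/2) *\<^sub>C (- 2 *\<^sub>C (E 1 (- 1) n * c n)))
      \<simeq> (\<lambda>n. c n + (1/2) *\<^sub>C (E 1 (- 1) n * c n) + (1/2) *\<^sub>C (E 7 (- 1) n * c n) + (1/2) *\<^sub>C (E 7 (- 1) n * (E 1 (- 1) n * c n)))"
      by (intro asym_add asym_refl *)
    moreover have "c n + (1/2) *\<^sub>C (E 1 (- 1) n * c n) + (1/2) *\<^sub>C (E 7 (- 1) n * c n) + (1/2) *\<^sub>C (- 2 *\<^sub>C (E 1 (- 1) n * c n)) = X n + Y n" for n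
    proof -
      have "(1/2) *\<^sub>C (- 2 *\<^sub>C (E 1 (- 1) n * c n)) = - (1/2) *\<^sub>C (E 1 (- 1) n * c n) - (1/2) *\<^sub>C (E 1 (- 1) n * c n)"
        by (simp add: scaleC_scaleC flip: scaleC_diff_left)
      then show ?thesis
        by (simp add: X_def Y_def P_def mult_scaleC_left scaleC_minus_left)
    qed
    moreover have "c n + (1/2) *\<^sub>C (E 1 (- 1) n * c n) + (1/2) *\<^sub>C (E 7 (- 1) n * c n) + (1/2) *\<^sub>C (E 7 (- 1) n * (E 1 (- 1) n * c n)) = V n" for n
    proof -
      have "c n = (1/2) *\<^sub>C c n + (1/2) *\<^sub>C c n" by (simp add: scaleC_one flip: scaleC_add_left)
      then show ?thesis
        by (simp add: V_def distrib_left scaleC_add_right add.assoc add.left_commute)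
    qed
    ultimately show ?thesis by simp
  qed
  obtain R where R: "\<And>n. norm (\<rho> n) \<le> R"
    using convergent_imp_Bseq[OF convergentI[OF \<rho>(1)]] by (auto simp: Bseq_def)
  have VR: "norm (V n) \<le> max (1 + 2 * K) (R * R)" for n
    using V[of n] mult_mono[OF R[of n] R[of n]] \<rho>(2)[of n] R[of n] by (auto simp: le_max_iff_disj)
  have l4: "(\<lambda>n. \<I> (\<pi> (X n + Y n) (g n)) - \<I> (\<pi> (V n) (g n))) \<longlonglongrightarrow> 0"
  proof (rule rep_asym[OF XYV _ VR g])
    show "norm (X n + Y n) \<le> max (1 + 2 * K) (R * R)" for n
      using norm_triangle_ineq[of "X n" "Y n"] X[of n] Y[of n] by simp
  qed
  have le4: "\<I> (\<pi> (V n) (g n)) \<le> (\<rho> n * \<rho> n) powr p * 1" for n by (rule rep_bound_le[OF g(1) V g(2)])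
  have le2: "\<I> (\<pi> (\<alpha> *\<^sub>C Y n) (g n)) \<le> \<I> (\<pi> (Y n) (g n))" for n
  proof -
    have "\<I> (\<pi> (\<alpha> *\<^sub>C Y n) (g n)) = \<I> (\<lambda>t. \<alpha> * \<pi> (Y n) (g n) t)"
      by (intro Lp_int_cong_AE meas \<L>_intros g rep_scaleC)
    also have "\<dots> \<le> 1 * \<I> (\<pi> (Y n) (g n))"
      unfolding Lp_int_mult using \<alpha> p0 by (intro mult_right_mono) (auto simp: powr_le1 Lp_int_nonneg)
    finally show ?thesis by simp
  qed
  \<comment> \<open>An upper bound assembled from null differences: \<open>X'\<close> and
    \<open>\<alpha> Y\<close> are replaced by \<open>X\<close> and \<open>Y\<close>, these are
    recombined to \<open>X + Y\<close>, and that is replaced by \<open>V\<close>. Hence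
    \<open>D\<close> tends to 1.\<close>
  define D where "D n = (\<I> (\<pi> (Z n) (g n)) - \<I> (\<pi> (X' n) (g n)) - \<I> (\<pi> (\<alpha> *\<^sub>C Y n) (g n)))
     + (\<I> (\<pi> (X' n) (g n)) - \<I> (\<pi> ((P 0 n * b8 n) * X n) (g n)))
     + \<rho> n powr p * ((\<I> (\<pi> (X n + Y n) (g n)) - \<I> (\<pi> (V n) (g n)))
        - (\<I> (\<pi> (X n + Y n) (g n)) - \<I> (\<pi> (X n) (g n)) - \<I> (\<pi> (Y n) (g n))) + (\<rho> n * \<rho> n) powr p)" for n
  have le: "\<I> (\<pi> (Z n) (g n)) \<le> D n" for n
  proof -
    have r1: "1 \<le> \<rho> n powr p" using \<rho>(2)[of n] p0 by (simp add: ge_one_powr_ge_zero)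
    have y1: "\<I> (\<pi> (Y n) (g n)) \<le> \<rho> n powr p * \<I> (\<pi> (Y n) (g n))"
      using mult_right_mono[OF r1 Lp_int_nonneg[of p M "\<pi> (Y n) (g n)"]] by simp
    have "\<rho> n powr p * (\<I> (\<pi> (V n) (g n))) \<le> \<rho> n powr p * (\<rho> n * \<rho> n) powr p"
      using le4[of n] by (intro mult_left_mono) auto
    then show ?thesis unfolding D_def using le2[of n] le3[of n] y1 by (simp add: algebra_simps)
  qed
  have "D \<longlonglongrightarrow> 0 + 0 + 1 powr p * (0 - 0 + (1 * 1) powr p)"
    unfolding D_def by (intro tendsto_add tendsto_mult tendsto_diff tendsto_powr l1 l2 l3 l4 \<rho>(1) tendsto_const) auto
  then have "(\<lambda>n. D n powr (1 / p) + 1 / real (Suc n)) \<longlonglongrightarrow> 1 powr (1 / p) + 0"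
    by (intro tendsto_add tendsto_powr tendsto_const LIMSEQ_Suc[OF lim_1_over_n]) auto
  then have "\<forall>\<^sub>F n in sequentially. D n powr (1 / p) + 1 / real (Suc n) < 1 + \<epsilon>"
    using e by (intro order_tendstoD(2)) auto
  then show ?thesis
    unfolding X_def[symmetric] Y_def[symmetric] X'_def[symmetric] Z_def[symmetric]
  proof eventually_elim
    case (elim n)
    have "max 0 (norm (Z n) - 1 / real (Suc n)) powr p \<le> D n" by (rule order_trans[OF norming le])
    then have "(max 0 (norm (Z n) - 1 / real (Suc n)) powr p) powr (1 / p) \<le> D n powr (1 / p)"
      using p0 by (intro powr_mono2) auto
    then have "max 0 (norm (Z n) - 1 / real (Suc n)) \<le> D n powr (1 / p)" using p0 by (simp add: powr_powr)
    then show ?case using elim by linarith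
  qed
qed

end

section \<open>Dual spaces, the unitization and states\<close>

lemma dual_UNIV_iff: "\<phi> \<in> dual UNIV N \<longleftrightarrow> clinear_on UNIV \<phi> \<and> (\<exists>K. \<forall>x. cmod (\<phi> x) \<le> K * N x)"
  by (simp add: dual_def)

lemma dual_norm_least:
  assumes "cseminorm N" "0 \<le> K" "\<And>x. cmod (\<phi> x) \<le> K * N x"
  shows "dual_norm UNIV N \<phi> \<le> K"
  unfolding dual_norm_def
proof (rule cSup_least)
  show "{cmod (\<phi> x) |x. x \<in> UNIV \<and> N x \<le> 1} \<noteq> {}"
    using cseminorm_0[OF assms(1)] by (auto intro!: exI[of _ 0])
  fix y assume "y \<in> {cmod (\<phi> x) |x. x \<in> UNIV \<and> N x \<le> 1}"
  then obtain x where x: "y = cmod (\<phi> x)" "N x \<le> 1" by auto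
  then have "y \<le> K * N x" using assms(3) by simp
  also have "\<dots> \<le> K" using mult_left_mono[OF x(2) assms(2)] by simp
  finally show "y \<le> K" .
qed

lemma dual_norm_upper:
  assumes N: "cseminorm N" and \<phi>: "\<phi> \<in> dual UNIV N"
  shows "cmod (\<phi> x) \<le> dual_norm UNIV N \<phi> * N x"
proof -
  obtain K where K: "clinear_on UNIV \<phi>" "\<And>x. cmod (\<phi> x) \<le> K * N x" using \<phi> by (auto simp: dual_UNIV_iff)
  have bdd: "bdd_above {cmod (\<phi> x) |x. x \<in> UNIV \<and> N x \<le> 1}"
  proof (rule bdd_aboveI[where M = "\<bar>K\<bar>"])
    fix y assume "y \<in> {cmod (\<phi> x) |x. x \<in> UNIV \<and> N x \<le> 1}"
    then obtain x where x: "y = cmod (\<phi> x)" "N x \<le> 1" by auto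
    have "y \<le> \<bar>K\<bar> * N x" using K(2)[of x] x(1) mult_right_mono[OF abs_ge_self[of K] cseminorm_nonneg[OF N, of x]] by simp
    also have "\<dots> \<le> \<bar>K\<bar>" using mult_left_mono[OF x(2), of "\<bar>K\<bar>"] by simp
    finally show "y \<le> \<bar>K\<bar>" .
  qed
  show ?thesis
  proof (cases "N x = 0")
    case True
    then show ?thesis using K(2)[of x] by simp
  next
    case False
    then have pos: "0 < N x" using cseminorm_nonneg[OF N, of x] by simp
    have "N (complex_of_real (1 / N x) *\<^sub>C x) = 1"
      unfolding cseminorm_scale[OF N] norm_of_real using pos by simp
    then have "cmod (\<phi> (complex_of_real (1 / N x) *\<^sub>C x)) \<le> dual_norm UNIV N \<phi>"
      unfolding dual_norm_def
      by (intro cSup_upper bdd CollectI exI[of _ "complex_of_real (1 / N x) *\<^sub>C x"]) auto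
    then show ?thesis using pos by (simp add: clinear_on_scale[OF K(1)] norm_mult norm_divide field_simps)
  qed
qed

lemma dual_norm_nonneg:
  assumes N: "cseminorm N" and \<phi>: "\<phi> \<in> dual UNIV N"
  shows "0 \<le> dual_norm UNIV N \<phi>"
proof (rule ccontr)
  assume neg: "\<not> 0 \<le> dual_norm UNIV N \<phi>"
  have "cmod (\<phi> x) \<le> 0 * N x" for x
    using order_trans[OF dual_norm_upper[OF assms, of x] mult_right_mono[of _ 0 "N x"]] neg
      cseminorm_nonneg[OF N, of x] by simp
  then have z: "\<phi> x = 0" for x by simp
  have "{cmod (\<phi> x) |x. x \<in> UNIV \<and> N x \<le> 1} = {0}"
    using cseminorm_0[OF N] z by (auto intro!: exI[of _ 0])
  then show False using neg by (simp add: dual_norm_def)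
qed

lemma dual_norm_eqI:
  assumes "cseminorm N" "clinear_on UNIV \<phi>" "\<And>x. cmod (\<phi> x) \<le> N x" "cmod (\<phi> u) = 1" "N u \<le> 1"
  shows "\<phi> \<in> dual UNIV N" "dual_norm UNIV N \<phi> = 1"
proof -
  show d: "\<phi> \<in> dual UNIV N" using assms by (auto simp: dual_UNIV_iff intro!: exI[of _ 1])
  have "1 \<le> dual_norm UNIV N \<phi> * N u" using dual_norm_upper[OF assms(1) d, of u] assms(4) by simp
  also have "\<dots> \<le> dual_norm UNIV N \<phi>"
    using mult_left_mono[OF assms(5) dual_norm_nonneg[OF assms(1) d]] by simp
  finally show "dual_norm UNIV N \<phi> = 1"
    using dual_norm_least[OF assms(1), of 1 \<phi>] assms(3) by simp
qed

lemma cseminorm_norm: "cseminorm (norm :: 'a::complex_banach_algebra \<Rightarrow> real)"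
  by (simp add: cseminorm_def norm_triangle_ineq norm_scaleC)

section \<open>The multiplier unitization of a nonzero nonunital algebra, its dual and its
  states\<close>

locale nonunital_algebra =
  fixes F :: "'a::complex_banach_algebra filter"
  assumes nonunital: "\<not> unital TYPE('a)" and cai: "contractive_approximate_identity F"
    and nonzero: "\<exists>a::'a. a \<noteq> 0"
begin

lemma F_bot: "F \<noteq> bot" and F_norm: "\<forall>\<^sub>F e in F. norm e \<le> 1"
  and F_left: "((\<lambda>e. e * a) \<longlongrightarrow> a) F" and F_right: "((\<lambda>e. a * e) \<longlongrightarrow> a) F"
  using cai by (simp_all add: contractive_approximate_identity_def)

abbreviation N :: "'a \<times> complex \<Rightarrow> real" where "N \<equiv> unitization_norm"
definition act :: "'a \<times> complex \<Rightarrow> 'a \<Rightarrow> 'a" where "act x c = fst x * c + snd x *\<^sub>C c"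

lemma unitization_eq: "(unitization :: ('a \<times> complex) set) = UNIV"
  and one_eq: "(unitization_one :: 'a \<times> complex) = (0, 1)"
  using nonunital by (simp_all add: unitization_def unitization_one_def)

lemma N_eq: "N x = Sup {norm (act x c) | c. norm c \<le> 1}"
  using nonunital by (simp add: unitization_norm_def act_def)

lemma act_add: "act (x + y) c = act x c + act y c"
  and act_scaleC: "act (s *\<^sub>C x) c = s *\<^sub>C act x c"
  and act_scaleC_right: "act x (s *\<^sub>C c) = s *\<^sub>C act x c"
  by (simp_all add: act_def distrib_right scaleC_add_left scaleC_add_right mult_scaleC_left mult_scaleC_right
      scaleC_scaleC mult.commute)

lemma act_le: "norm (act x c) \<le> (norm (fst x) + cmod (snd x)) * norm c"
  unfolding act_def
  by (rule order_trans[OF norm_triangle_ineq]) (simp add: norm_scaleC distrib_right norm_mult_ineq)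

lemma N_bdd: "bdd_above {norm (act x c) | c. norm c \<le> 1}"
proof (rule bdd_aboveI[where M = "norm (fst x) + cmod (snd x)"])
  fix y assume "y \<in> {norm (act x c) | c. norm c \<le> 1}"
  then obtain c where c: "y = norm (act x c)" "norm c \<le> 1" by blast
  have "y \<le> (norm (fst x) + cmod (snd x)) * norm c" using act_le c(1) by simp
  also have "\<dots> \<le> norm (fst x) + cmod (snd x)"
    using mult_left_mono[OF c(2), of "norm (fst x) + cmod (snd x)"] by simp
  finally show "y \<le> norm (fst x) + cmod (snd x)" .
qed

lemma N_least: "(\<And>c. norm c \<le> 1 \<Longrightarrow> norm (act x c) \<le> b) \<Longrightarrow> N x \<le> b"
  unfolding N_eq by (rule cSup_least) (auto intro: exI[of _ 0])

lemma N_upper: "norm (act x c) \<le> N x * norm c"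
proof (cases "c = 0")
  case False
  have "norm (act x (complex_of_real (1 / norm c) *\<^sub>C c)) \<le> N x"
    unfolding N_eq using False by (intro cSup_upper N_bdd) (auto simp: norm_scaleC norm_divide)
  then show ?thesis using False by (simp add: act_scaleC_right norm_scaleC norm_divide field_simps)
qed (simp add: act_def)

lemma N_nonneg: "0 \<le> N x"
  using N_upper[of x 0] order_trans[OF norm_ge_zero cSup_upper[OF _ N_bdd]]
  unfolding N_eq by (auto intro!: cSup_upper2[OF _ _ N_bdd] exI[of _ 0])

lemma N_cseminorm: "cseminorm N"
  unfolding cseminorm_def
proof (intro conjI allI)
  fix x y
  show "N (x + y) \<le> N x + N y"
  proof (rule N_least)
    fix c :: 'a assume c: "norm c \<le> 1"
    have "norm (act (x + y) c) \<le> N x * norm c + N y * norm c"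
      unfolding act_add by (intro order_trans[OF norm_triangle_ineq] add_mono N_upper)
    also have "\<dots> \<le> N x + N y"
      using mult_left_mono[OF c N_nonneg[of x]] mult_left_mono[OF c N_nonneg[of y]] by simp
    finally show "norm (act (x + y) c) \<le> N x + N y" .
  qed
next
  have le: "N (s *\<^sub>C x) \<le> cmod s * N x" for s x
  proof (rule N_least)
    fix c :: 'a assume c: "norm c \<le> 1"
    have "norm (act (s *\<^sub>C x) c) = cmod s * norm (act x c)" by (simp add: act_scaleC norm_scaleC)
    also have "\<dots> \<le> cmod s * (N x * norm c)" by (intro mult_left_mono N_upper) simp
    also have "\<dots> \<le> cmod s * N x"
      using mult_left_mono[OF c N_nonneg[of x]] by (intro mult_left_mono) auto
    finally show "norm (act (s *\<^sub>C x) c) \<le> cmod s * N x" .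
  qed
  fix s x
  show "N (s *\<^sub>C x) = cmod s * N x"
  proof (cases "s = 0")
    case True
    then show ?thesis using le[of 0 x] N_nonneg[of "0 *\<^sub>C x"] by simp
  next
    case False
    have "N x \<le> cmod (inverse s) * N (s *\<^sub>C x)"
      using le[of "inverse s" "s *\<^sub>C x"] False by (simp only: scaleC_scaleC) (simp add: scaleC_one)
    then have "cmod s * N x \<le> cmod s * (cmod (inverse s) * N (s *\<^sub>C x))" by (intro mult_left_mono) auto
    then have "cmod s * N x \<le> N (s *\<^sub>C x)" using False by (simp add: norm_inverse mult.assoc[symmetric])
    then show ?thesis using le[of s x] by simp
  qed
qed

text \<open>The algebra embeds isometrically because of the approximate identity:
  \<open>a * e\<close> tends to \<open>a\<close> with \<open>e\<close> in the unit ball.\<close>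

lemma N_fst: "N (a, 0) = norm a"
proof (rule antisym)
  show "N (a, 0) \<le> norm a"
  proof (rule N_least)
    fix c :: 'a assume c: "norm c \<le> 1"
    have "norm (act (a, 0) c) \<le> norm a * norm c" using act_le[of "(a, 0)" c] by simp
    also have "\<dots> \<le> norm a" using mult_left_mono[OF c, of "norm a"] by simp
    finally show "norm (act (a, 0) c) \<le> norm a" .
  qed
  have "\<forall>\<^sub>F e in F. norm (a * e) \<le> N (a, 0)"
    using F_norm
  proof eventually_elim
    case (elim e)
    have "norm (a * e) \<le> N (a, 0) * norm e" using N_upper[of "(a, 0)" e] by (simp add: act_def)
    also have "\<dots> \<le> N (a, 0) * 1" by (intro mult_left_mono elim N_nonneg)
    finally show ?case by simp
  qed
  then show "norm a \<le> N (a, 0)"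
    using tendsto_upperbound[OF tendsto_norm[OF F_right[of a]] _ F_bot] by blast
qed

lemma unit_vector: obtains c :: 'a where "norm c = 1"
proof -
  obtain a :: 'a where a: "a \<noteq> 0" using nonzero by blast
  then show ?thesis using that[of "complex_of_real (1 / norm a) *\<^sub>C a"] by (simp add: norm_scaleC norm_divide)
qed

lemma act_one [simp]: "act (0, 1) c = c"
  by (simp add: act_def scaleC_one)

lemma N_one: "N (0, 1) = 1"
proof (rule antisym)
  show "N (0, 1) \<le> 1" by (rule N_least) simp
  obtain c :: 'a where "norm c = 1" by (rule unit_vector)
  then show "1 \<le> N (0, 1)" using N_upper[of "(0, 1)" c] by simp
qed

text \<open>
  If \<open>l1 + a\<close> had norm less than \<open>|l|\<close>, left multiplication by \<open>b = - a / l\<close> would be invertible on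
  the algebra, and the solution \<open>u\<close> of \<open>b u = b\<close> would be a unit.
\<close>

lemma N_snd: "cmod l \<le> N (a, l)"
proof (rule ccontr)
  assume "\<not> cmod l \<le> N (a, l)"
  then have less: "N (a, l) < cmod l" by simp
  then have l: "l \<noteq> 0" using N_nonneg[of "(a, l)"] by auto
  define b where "b = (- inverse l) *\<^sub>C a"
  define r where "r = N (a, l) / cmod l"
  have r: "0 \<le> r" "r < 1" using less N_nonneg[of "(a, l)"] l by (auto simp: r_def)
  have contr: "norm (c - b * c) \<le> r * norm c" for c
  proof -
    have "c - b * c = inverse l *\<^sub>C act (a, l) c"
      using l by (simp add: act_def b_def scaleC_add_right scaleC_scaleC scaleC_one mult_scaleC_left scaleC_minus_left)
    then have "norm (c - b * c) = norm (act (a, l) c) / cmod l"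
      by (simp add: norm_scaleC norm_inverse divide_inverse mult.commute)
    also have "\<dots> \<le> N (a, l) * norm c / cmod l" by (intro divide_right_mono N_upper) simp
    finally show ?thesis by (simp add: r_def)
  qed
  \<comment> \<open>The map is a contraction with factor \<open>r\<close> by \<open>contr\<close>,
    and its fixed point solves \<open>b * u = b\<close>.\<close>
  have "\<exists>!u. b + (u - b * u) = u"
    using contr[of "x - y" for x y] by (intro banach_fix_type[OF r]) (simp add: dist_norm algebra_simps)
  then obtain u where "b + (u - b * u) = u" by blast
  then have bu: "b * u = b" by (simp add: algebra_simps)
  have left: "u * c = c" for c
  proof -
    have "b * (u * c - c) = 0" using bu by (simp add: right_diff_distrib mult.assoc[symmetric])
    then have "norm (u * c - c) \<le> r * norm (u * c - c)" using contr[of "u * c - c"] by simp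
    then have "(1 - r) * norm (u * c - c) \<le> 0" by (simp add: algebra_simps)
    then have "norm (u * c - c) \<le> 0" using r by (simp add: mult_le_0_iff)
    then show ?thesis by simp
  qed
  \<comment> \<open>Because \<open>u * e = e\<close>, the approximate identity itself converges to
    \<open>u\<close>; this yields the right unit law and \<open>norm u \<le> 1\<close>.\<close>
  have "((\<lambda>e. e) \<longlongrightarrow> u) F" using F_right[of u] by (simp add: left)
  then have right: "c * u = c" for c
    using tendsto_unique[OF F_bot tendsto_mult_left F_right[of c]] by blast
  have "norm u = 1"
  proof -
    have "norm u \<le> 1"
      using tendsto_upperbound[OF tendsto_norm F_norm F_bot] \<open>((\<lambda>e. e) \<longlongrightarrow> u) F\<close> by blast
    moreover obtain c :: 'a where "norm c = 1" by (rule unit_vector)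
    then have "1 \<le> norm u" using norm_mult_ineq[of u c] by (simp add: left)
    ultimately show ?thesis by simp
  qed
  then show False using nonunital left right by (auto simp: unital_def is_unit_elem_def)
qed

definition state :: "('a \<times> complex \<Rightarrow> complex) \<Rightarrow> bool" where
  "state \<omega> \<longleftrightarrow> clinear_on UNIV \<omega> \<and> (\<forall>x. cmod (\<omega> x) \<le> N x) \<and> \<omega> (0, 1) = 1"

lemma states_eq: "unitization_states = Collect state"
proof (intro set_eqI iffI)
  fix \<omega> :: "'a \<times> complex \<Rightarrow> complex" assume "\<omega> \<in> unitization_states"
  then have w: "\<omega> \<in> dual UNIV N" "dual_norm UNIV N \<omega> = 1" "\<omega> (0, 1) = 1"
    by (auto simp: unitization_states_def unitization_eq one_eq)
  then show "\<omega> \<in> Collect state"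
    using dual_norm_upper[OF N_cseminorm w(1)] by (auto simp: state_def dual_UNIV_iff)
next
  fix \<omega> :: "'a \<times> complex \<Rightarrow> complex" assume "\<omega> \<in> Collect state"
  then have "clinear_on UNIV \<omega>" "\<And>x. cmod (\<omega> x) \<le> N x" "\<omega> (0, 1) = 1" by (auto simp: state_def)
  then show "\<omega> \<in> unitization_states"
    using dual_norm_eqI[OF N_cseminorm, of \<omega> "(0, 1)"] N_one
    by (simp add: unitization_states_def unitization_eq one_eq)
qed

lemma restricted_states_eq: "restricted_states = (\<lambda>\<omega> a. \<omega> (a, 0)) ` Collect state"
  by (simp add: restricted_states_def states_eq)

lemma vector_state:
  assumes "clinear_on UNIV \<phi>" "\<And>x. cmod (\<phi> x) \<le> norm x" "norm c = 1" "\<phi> c = 1"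
  shows "state (\<lambda>x. \<phi> (act x c))"
  unfolding state_def
proof (intro conjI allI)
  show "clinear_on UNIV (\<lambda>x. \<phi> (act x c))"
    using assms(1) by (simp add: clinear_on_def act_add act_scaleC)
  show "cmod (\<phi> (act x c)) \<le> N x" for x
    using order_trans[OF assms(2) N_upper[of x c]] assms(3) by simp
qed (simp add: assms)

lemma restrict_clinear: "state \<omega> \<Longrightarrow> clinear_on UNIV (\<lambda>a. \<omega> (a, 0))"
proof -
  assume "state \<omega>"
  then have l: "clinear_on UNIV \<omega>" by (simp add: state_def)
  show ?thesis
    using clinear_on_add[OF l, of "(x, 0)" "(y, 0)" for x y] clinear_on_scale[OF l, of s "(x, 0)" for s x]
    by (simp add: clinear_on_def)
qed

lemma restrict_le: "state \<omega> \<Longrightarrow> cmod (\<omega> (a, 0)) \<le> norm a"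
  unfolding state_def N_fst[symmetric] by blast

text \<open>A vector state, sending \<open>a\<close> to \<open>\<phi> (a * c)\<close>, keeps norm 1
  on the algebra because \<open>e * c\<close> tends to \<open>c\<close>. Without any state not even
  0 would be a quasistate.\<close>

lemma states_nonempty: "(states :: ('a \<Rightarrow> complex) set) \<noteq> {}"
proof -
  obtain c :: 'a where c: "norm c = 1" by (rule unit_vector)
  obtain \<phi> :: "'a \<Rightarrow> complex" where p: "clinear_on UNIV \<phi>" "\<And>x. cmod (\<phi> x) \<le> norm x" "\<phi> c = norm c"
    using hahn_banach_norming[OF cseminorm_norm, of c] by blast
  have s: "state (\<lambda>x. \<phi> (act x c))" using p c by (intro vector_state) auto
  define \<psi> where "\<psi> a = \<phi> (act (a, 0) c)" for a
  have \<psi>: "\<psi> a = \<phi> (a * c)" for a by (simp add: \<psi>_def act_def)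
  have le: "cmod (\<psi> a) \<le> 1 * norm a" for a using restrict_le[OF s] by (simp add: \<psi>_def)
  have lin: "clinear_on UNIV \<psi>" using restrict_clinear[OF s] by (simp add: \<psi>_def[abs_def])
  have d: "\<psi> \<in> dual UNIV norm" using lin le unfolding dual_UNIV_iff by blast
  have "((\<lambda>e. \<phi> (e * c)) \<longlongrightarrow> \<phi> c) F"
  proof (rule LIM_zero_cancel)
    have "((\<lambda>e. e * c - c) \<longlongrightarrow> 0) F" using F_left[of c] by (simp add: LIM_zero)
    then have "((\<lambda>e. norm (e * c - c)) \<longlongrightarrow> 0) F" by (rule tendsto_norm_zero)
    then show "((\<lambda>e. \<phi> (e * c) - \<phi> c) \<longlongrightarrow> 0) F"
      by (rule Lim_null_comparison[rotated])
        (simp add: always_eventually clinear_on_diff[OF p(1), symmetric] p(2))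
  qed
  then have lim: "((\<lambda>e. cmod (\<psi> e)) \<longlongrightarrow> 1) F"
    using tendsto_norm[of "\<lambda>e. \<phi> (e * c)" "\<phi> c" F] c p(3) by (simp add: \<psi>)
  have "\<forall>\<^sub>F e in F. cmod (\<psi> e) \<le> dual_norm UNIV norm \<psi>"
    using F_norm
  proof eventually_elim
    case (elim e)
    show ?case
      using dual_norm_upper[OF cseminorm_norm d, of e] mult_left_mono[OF elim dual_norm_nonneg[OF cseminorm_norm d]] by simp
  qed
  then have "1 \<le> dual_norm UNIV norm \<psi>" using tendsto_upperbound[OF lim _ F_bot] by blast
  moreover have "dual_norm UNIV norm \<psi> \<le> 1" by (rule dual_norm_least[OF cseminorm_norm _ le]) simp
  ultimately have "dual_norm UNIV norm \<psi> = 1" by simp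
  moreover have "\<psi> \<in> restricted_states"
    unfolding restricted_states_eq using s by (auto simp: \<psi>_def[abs_def])
  ultimately have "\<psi> \<in> states" by (simp add: states_def)
  then show ?thesis by blast
qed

lemma character_state: "state snd"
  by (auto simp: state_def clinear_on_def N_snd)

lemma quasistates_subset: "quasistates \<subseteq> (restricted_states :: ('a \<Rightarrow> complex) set)"
proof
  fix \<psi> :: "'a \<Rightarrow> complex" assume "\<psi> \<in> quasistates"
  then obtain t \<phi> where t: "0 \<le> t" "t \<le> 1" and \<phi>: "\<phi> \<in> states" and \<psi>: "\<psi> = complex_of_real t *\<^sub>C \<phi>"
    by (auto simp: quasistates_def)
  obtain \<omega> where \<omega>: "state \<omega>" "\<phi> = (\<lambda>a. \<omega> (a, 0))"
    using \<phi> by (auto simp: states_def restricted_states_eq)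
  \<comment> \<open>Mixing with the character \<open>snd\<close>, which vanishes on the algebra,
    restores the value 1 at the unit without changing the restriction.\<close>
  define \<omega>' where "\<omega>' x = complex_of_real t * \<omega> x + complex_of_real (1 - t) * snd x" for x
  have "state \<omega>'"
    unfolding state_def
  proof (intro conjI allI)
    show "clinear_on UNIV \<omega>'"
      using \<omega>(1) by (simp add: state_def clinear_on_def \<omega>'_def algebra_simps)
    fix x :: "'a \<times> complex"
    have "cmod (\<omega>' x) \<le> t * cmod (\<omega> x) + (1 - t) * cmod (snd x)"
      unfolding \<omega>'_def using t by (intro order_trans[OF norm_triangle_ineq]) (simp add: norm_mult del: of_real_diff)
    also have "\<dots> \<le> t * N x + (1 - t) * N x"
    proof (intro add_mono mult_left_mono)
      show "cmod (\<omega> x) \<le> N x" using \<omega>(1) unfolding state_def by blast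
      show "cmod (snd x) \<le> N x" using N_snd[of "snd x" "fst x"] by simp
    qed (use t in auto)
    finally show "cmod (\<omega>' x) \<le> N x" by (simp add: algebra_simps)
    show "\<omega>' (0, 1) = 1" using \<omega>(1) by (simp add: \<omega>'_def state_def)
  qed
  moreover have "\<psi> = (\<lambda>a. \<omega>' (a, 0))" by (simp add: \<psi> \<omega>(2) \<omega>'_def fun_eq_iff)
  ultimately show "\<psi> \<in> restricted_states" unfolding restricted_states_eq by blast
qed

lemma scaled_iff: "scaled TYPE('a) \<longleftrightarrow> (restricted_states :: ('a \<Rightarrow> complex) set) \<subseteq> quasistates"
  using nonunital quasistates_subset by (auto simp: scaled_def)

lemma dual_add:
  assumes "\<phi> \<in> dual UNIV N" "\<psi> \<in> dual UNIV N"
  shows "\<phi> + \<psi> \<in> dual UNIV N"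
proof -
  obtain K where K: "clinear_on UNIV \<phi>" "\<And>x. cmod (\<phi> x) \<le> K * N x" using assms(1) unfolding dual_UNIV_iff by blast
  obtain L where L: "clinear_on UNIV \<psi>" "\<And>x. cmod (\<psi> x) \<le> L * N x" using assms(2) unfolding dual_UNIV_iff by blast
  have "cmod ((\<phi> + \<psi>) x) \<le> (K + L) * N x" for x
    unfolding distrib_right plus_fun_apply by (intro order_trans[OF norm_triangle_ineq] add_mono K L)
  moreover have "clinear_on UNIV (\<phi> + \<psi>)"
    unfolding clinear_on_def plus_fun_apply
    by (simp add: clinear_on_add[OF K(1)] clinear_on_add[OF L(1)] clinear_on_scale[OF K(1)] clinear_on_scale[OF L(1)] distrib_left)
  ultimately show ?thesis unfolding dual_UNIV_iff by blast
qed

lemma dual_scaleC: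
  assumes "\<phi> \<in> dual UNIV N"
  shows "s *\<^sub>C \<phi> \<in> dual UNIV N"
proof -
  obtain K where K: "clinear_on UNIV \<phi>" "\<And>x. cmod (\<phi> x) \<le> K * N x" using assms unfolding dual_UNIV_iff by blast
  have "cmod ((s *\<^sub>C \<phi>) x) \<le> (cmod s * K) * N x" for x
    unfolding scaleC_simps norm_mult mult.assoc by (intro mult_left_mono K) auto
  moreover have "clinear_on UNIV (s *\<^sub>C \<phi>)"
    unfolding clinear_on_def
    by (simp add: clinear_on_add[OF K(1)] clinear_on_scale[OF K(1)] distrib_left mult.left_commute)
  ultimately show ?thesis unfolding dual_UNIV_iff by blast
qed

lemma annihilator_iff:
  "\<phi> \<in> annihilator UNIV N (range (\<lambda>a. (a, 0))) \<longleftrightarrow> (\<exists>s. \<phi> = s *\<^sub>C snd)"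
proof
  assume "\<phi> \<in> annihilator UNIV N (range (\<lambda>a. (a, 0)))"
  then have lin: "clinear_on UNIV \<phi>" and z: "\<phi> (a, 0) = 0" for a
    by (auto simp: annihilator_def dual_UNIV_iff)
  have eq: "\<phi> (a, l) = \<phi> (0, 1) * l" for a l
  proof -
    have "(a, l) = (a, 0) + l *\<^sub>C (0, 1 :: complex)" by simp
    then have "\<phi> (a, l) = \<phi> (a, 0) + l * \<phi> (0, 1)"
      by (simp only: clinear_on_add[OF lin] clinear_on_scale[OF lin] scaleC_simps(1))
    then show ?thesis by (simp add: z mult.commute)
  qed
  have "\<phi> x = (\<phi> (0, 1) *\<^sub>C snd) x" for x using eq[of "fst x" "snd x"] by simp
  then show "\<exists>s. \<phi> = s *\<^sub>C snd" by blast
next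
  assume "\<exists>s. \<phi> = s *\<^sub>C snd"
  then obtain s where "\<phi> = s *\<^sub>C snd" by blast
  moreover have "snd \<in> dual UNIV N"
    unfolding dual_UNIV_iff using N_snd by (auto simp: clinear_on_def intro!: exI[of _ 1])
  ultimately show "\<phi> \<in> annihilator UNIV N (range (\<lambda>a. (a, 0)))"
    using dual_scaleC[of snd s] by (auto simp: annihilator_def)
qed

lemma dual_diff: "\<phi> \<in> dual UNIV N \<Longrightarrow> \<psi> \<in> dual UNIV N \<Longrightarrow> \<phi> - \<psi> \<in> dual UNIV N"
  using dual_add[of \<phi> "(- 1) *\<^sub>C \<psi>"] dual_scaleC[of \<psi> "- 1"] by (simp only: scaleC_minus_one) simp

lemma state_dual: "state \<omega> \<Longrightarrow> \<omega> \<in> dual UNIV N" "state \<omega> \<Longrightarrow> dual_norm UNIV N \<omega> = 1"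
  using states_eq by (auto simp: unitization_states_def unitization_eq)

lemma dual_norm_scaleC:
  assumes "\<phi> \<in> dual UNIV N"
  shows "dual_norm UNIV N (s *\<^sub>C \<phi>) = cmod s * dual_norm UNIV N \<phi>"
proof -
  have le: "dual_norm UNIV N (s *\<^sub>C \<phi>) \<le> cmod s * dual_norm UNIV N \<phi>" if "\<phi> \<in> dual UNIV N" for s \<phi>
  proof (rule dual_norm_least[OF N_cseminorm])
    show "0 \<le> cmod s * dual_norm UNIV N \<phi>" using dual_norm_nonneg[OF N_cseminorm that] by simp
    show "cmod ((s *\<^sub>C \<phi>) x) \<le> cmod s * dual_norm UNIV N \<phi> * N x" for x
      using dual_norm_upper[OF N_cseminorm that, of x] by (simp add: norm_mult mult.assoc mult_left_mono)
  qed
  show ?thesis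
  proof (cases "s = 0")
    case True
    then show ?thesis using le[OF assms, of 0] dual_norm_nonneg[OF N_cseminorm dual_scaleC[OF assms, of 0]] by simp
  next
    case False
    have "dual_norm UNIV N \<phi> \<le> cmod (inverse s) * dual_norm UNIV N (s *\<^sub>C \<phi>)"
      using le[OF dual_scaleC[OF assms, of s], of "inverse s"] False by (simp only: scaleC_scaleC) (simp add: scaleC_one)
    then have "cmod s * dual_norm UNIV N \<phi> \<le> cmod s * (cmod (inverse s) * dual_norm UNIV N (s *\<^sub>C \<phi>))"
      by (intro mult_left_mono) auto
    then have "cmod s * dual_norm UNIV N \<phi> \<le> dual_norm UNIV N (s *\<^sub>C \<phi>)"
      using False by (simp add: norm_inverse mult.assoc[symmetric])
    then show ?thesis using le[OF assms, of s] by simp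
  qed
qed

lemma M_ideal_imp_scaled:
  assumes M: "M_ideal UNIV N (range (\<lambda>a. (a, 0)))"
  shows "scaled TYPE('a)"
  unfolding scaled_iff
proof
  let ?D = "dual UNIV N" and ?n = "dual_norm UNIV N"
  obtain P where lin: "clinear_on ?D P" and PD: "P ` ?D \<subseteq> ?D" and idem: "\<And>\<xi>. \<xi> \<in> ?D \<Longrightarrow> P (P \<xi>) = P \<xi>"
    and L: "\<And>\<xi>. \<xi> \<in> ?D \<Longrightarrow> ?n \<xi> = ?n (P \<xi>) + ?n (\<xi> - P \<xi>)"
    and range: "annihilator UNIV N (range (\<lambda>a. (a, 0))) = P ` ?D"
    using M unfolding M_ideal_def L_summand_def L_projection_def bounded_operator_on_def by blast
  have P_add: "P (\<xi> + \<eta>) = P \<xi> + P \<eta>" if "\<xi> \<in> ?D" "\<eta> \<in> ?D" for \<xi> \<eta>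
    using lin that by (simp add: clinear_on_def)
  have P_scale: "P (s *\<^sub>C \<xi>) = s *\<^sub>C P \<xi>" if "\<xi> \<in> ?D" for s \<xi>
    using lin that by (simp add: clinear_on_def)
  have P_form: "P \<xi> = P \<xi> (0, 1) *\<^sub>C snd" if "\<xi> \<in> ?D" for \<xi>
  proof -
    have "P \<xi> \<in> annihilator UNIV N (range (\<lambda>a. (a, 0)))" using range that by blast
    then obtain s where "P \<xi> = s *\<^sub>C snd" using annihilator_iff by blast
    then show ?thesis by simp
  qed
  have P_fix: "P (s *\<^sub>C snd) = s *\<^sub>C snd" for s
  proof -
    have "s *\<^sub>C snd \<in> P ` ?D" using range annihilator_iff by blast
    then show ?thesis using idem by auto
  qed
  note snd_dual = state_dual[OF character_state]
  fix \<phi> :: "'a \<Rightarrow> complex" assume "\<phi> \<in> restricted_states"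
  then obtain \<omega> where \<omega>: "state \<omega>" "\<phi> = (\<lambda>a. \<omega> (a, 0))" by (auto simp: restricted_states_eq)
  have \<omega>D: "\<omega> \<in> ?D" and \<omega>n: "?n \<omega> = 1" using state_dual[OF \<omega>(1)] .
  define s where "s = P \<omega> (0, 1)"
  define \<psi> where "\<psi> = \<omega> - s *\<^sub>C snd"
  have P\<omega>: "P \<omega> = s *\<^sub>C snd" unfolding s_def by (rule P_form[OF \<omega>D])
  have \<psi>D: "\<psi> \<in> ?D" unfolding \<psi>_def by (intro dual_diff dual_scaleC \<omega>D snd_dual)
  have sum: "1 = cmod s + ?n \<psi>"
    using L[OF \<omega>D] \<omega>n P\<omega> dual_norm_scaleC[OF snd_dual(1), of s] snd_dual(2) by (simp add: \<psi>_def)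
  have \<psi>1: "\<psi> (0, 1) = 1 - s" using \<omega>(1) by (simp add: \<psi>_def state_def)
  have "cmod (1 - s) \<le> ?n \<psi>" using dual_norm_upper[OF N_cseminorm \<psi>D, of "(0, 1)"] \<psi>1 N_one by simp
  \<comment> \<open>Equality in the triangle inequality puts \<open>s\<close> on the segment from 0
    to 1 and makes \<open>\<psi>\<close> attain its norm at the unit.\<close>
  then have "cmod s + cmod (1 - s) \<le> 1" using sum by simp
  then have s: "s = cmod s" "1 - s = ?n \<psi>"
  proof -
    assume le: "cmod s + cmod (1 - s) \<le> 1"
    have "Re s \<le> cmod s" "Re (1 - s) \<le> cmod (1 - s)" by (rule complex_Re_le_cmod)+
    then have "Re s = cmod s" using le by simp
    then show "s = cmod s" using cmod_power2[of s] by (simp add: complex_eq_iff)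
    then show "1 - s = ?n \<psi>" using sum by (simp add: complex_eq_iff)
  qed
  have \<phi>\<psi>: "\<phi> a = \<psi> (a, 0)" for a by (simp add: \<omega>(2) \<psi>_def)
  define t where "t = ?n \<psi>"
  have t: "0 \<le> t" "t \<le> 1" using sum dual_norm_nonneg[OF N_cseminorm \<psi>D] norm_ge_zero[of s] unfolding t_def by linarith+
  show "\<phi> \<in> quasistates"
  proof (cases "t = 0")
    case True
    obtain \<tau> :: "'a \<Rightarrow> complex" where "\<tau> \<in> states" using states_nonempty by blast
    moreover have "\<phi> = complex_of_real 0 *\<^sub>C \<tau>"
    proof
      fix a
      have "cmod (\<psi> (a, 0)) \<le> 0 * N (a, 0)"
        using dual_norm_upper[OF N_cseminorm \<psi>D, of "(a, 0)"] True by (simp add: t_def)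
      then show "\<phi> a = (complex_of_real 0 *\<^sub>C \<tau>) a" by (simp add: \<phi>\<psi>)
    qed
    ultimately show ?thesis unfolding quasistates_def by (intro CollectI exI[of _ 0] exI[of _ \<tau>]) simp
  next
    case False
    define \<theta> where "\<theta> = complex_of_real (1 / t) *\<^sub>C \<psi>"
    have \<theta>D: "\<theta> \<in> ?D" unfolding \<theta>_def by (intro dual_scaleC \<psi>D)
    have \<theta>n: "?n \<theta> = 1"
      unfolding \<theta>_def dual_norm_scaleC[OF \<psi>D] using False t by (simp add: t_def[symmetric] norm_divide)
    have \<theta>1: "\<theta> (0, 1) = 1" using \<psi>1 s(2) False by (simp add: \<theta>_def t_def)
    have \<theta>s: "state \<theta>"
      using dual_norm_upper[OF N_cseminorm \<theta>D] \<theta>n \<theta>1 \<theta>D by (simp add: state_def dual_UNIV_iff)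
    have P\<psi>: "P \<psi> = 0"
    proof -
      have "P (\<psi> + s *\<^sub>C snd) = P \<psi> + s *\<^sub>C snd" using P_add[OF \<psi>D dual_scaleC[OF snd_dual(1)]] P_fix by simp
      moreover have "\<psi> + s *\<^sub>C snd = \<omega>" by (simp add: \<psi>_def)
      ultimately show ?thesis using P\<omega> by simp
    qed
    have P\<theta>: "P \<theta> = 0" unfolding \<theta>_def P_scale[OF \<psi>D] P\<psi> by simp
    let ?\<phi>' = "\<lambda>a. \<theta> (a, 0)"
    define k where "k = dual_norm UNIV norm ?\<phi>'"
    have dd: "?\<phi>' \<in> dual UNIV norm"
      using restrict_clinear[OF \<theta>s] restrict_le[OF \<theta>s] by (auto simp: dual_UNIV_iff intro!: exI[of _ 1])
    have k0: "0 \<le> k" unfolding k_def by (rule dual_norm_nonneg[OF cseminorm_norm dd])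
    have k1: "k \<le> 1" unfolding k_def using restrict_le[OF \<theta>s] by (intro dual_norm_least[OF cseminorm_norm]) auto
    \<comment> \<open>Every extension of the restriction of \<open>\<theta>\<close> differs from
      \<open>\<theta>\<close> by some \<open>r *\<^sub>C snd\<close>, so the
      \<open>L\<close>-projection gives it the norm \<open>cmod r + 1\<close>. An extension of norm
      at most \<open>k\<close> therefore forces \<open>k = 1\<close>.\<close>
    obtain \<theta>' where ext: "clinear_on UNIV \<theta>'" "\<And>x. cmod (\<theta>' x) \<le> k * N x" "\<And>x. x \<in> range (\<lambda>a. (a, 0)) \<Longrightarrow> \<theta>' x = \<theta> x"
    proof (rule hahn_banach_extension[OF cseminorm_mult[OF N_cseminorm k0], of "range (\<lambda>a. (a, 0))" \<theta>])
      show "csubspace (range (\<lambda>a. (a :: 'a, 0 :: complex)))"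
        by (auto simp: csubspace_def zero_prod_def)
      show "clinear_on (range (\<lambda>a. (a, 0))) \<theta>" using \<theta>s unfolding state_def clinear_on_def by blast
      show "cmod (\<theta> x) \<le> k * N x" if "x \<in> range (\<lambda>a. (a, 0))" for x
        using that dual_norm_upper[OF cseminorm_norm dd] by (auto simp: k_def N_fst)
    qed blast
    have \<theta>'D: "\<theta>' \<in> ?D" using ext by (auto simp: dual_UNIV_iff)
    have "\<theta>' - \<theta> \<in> annihilator UNIV N (range (\<lambda>a. (a, 0)))"
      using dual_diff[OF \<theta>'D \<theta>D] ext(3) by (auto simp: annihilator_def)
    then obtain r where r: "\<theta>' - \<theta> = r *\<^sub>C snd" using annihilator_iff by blast
    then have \<theta>': "\<theta>' = \<theta> + r *\<^sub>C snd" by (simp add: algebra_simps)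
    have "P \<theta>' = r *\<^sub>C snd"
      unfolding \<theta>' P_add[OF \<theta>D dual_scaleC[OF snd_dual(1)]] P\<theta> P_fix by simp
    then have "?n \<theta>' = cmod r + 1"
      using L[OF \<theta>'D] dual_norm_scaleC[OF snd_dual(1), of r] snd_dual(2) \<theta>n by (simp add: \<theta>')
    moreover have "?n \<theta>' \<le> k" by (rule dual_norm_least[OF N_cseminorm k0 ext(2)])
    ultimately have "k = 1" using k1 norm_ge_zero[of r] by linarith
    then have "?\<phi>' \<in> states" using \<theta>s by (auto simp: states_def restricted_states_eq k_def)
    moreover have "\<phi> = complex_of_real t *\<^sub>C ?\<phi>'"
      using False by (simp add: fun_eq_iff \<phi>\<psi> \<theta>_def)
    ultimately show ?thesis unfolding quasistates_def using t by blast
  qed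
qed

end

section \<open>Scaled algebras have nearly hermitian approximate identities\<close>

context Lp_representation
begin

text \<open>The sum is paired with its own duality map. Young's inequality is sharp only for
  arguments of equal norm, so \<open>f\<close> and \<open>g\<close> are first rescaled to the common
  norm bound \<open>s + t\<close>.\<close>

lemma minkowski:
  fixes f g :: "'b \<Rightarrow> complex"
  assumes f: "\<L> f" "\<I> f \<le> s powr p" and g: "\<L> g" "\<I> g \<le> t powr p" and st: "0 < s" "0 < t"
  shows "\<I> (\<lambda>x. f x + g x) \<le> (s + t) powr p"
proof -
  let ?h = "\<lambda>x. f x + g x" and ?u = "s + t"
  have h: "\<L> ?h" by (intro \<L>_intros f g)
  have *: "Re (pairing M k (J ?h)) \<le> r / ?u * (?u powr p / p + (p - 1) / p * \<I> ?h)"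
    if k: "\<L> k" "\<I> k \<le> r powr p" and r: "0 < r" for k r
  proof -
    let ?k = "\<lambda>x. complex_of_real (?u / r) * k x"
    have "\<I> ?k = (?u / r) powr p * \<I> k"
      unfolding Lp_int_mult using r st by (simp del: of_real_add of_real_divide)
    also have "\<dots> \<le> (?u / r) powr p * r powr p" using k by (intro mult_left_mono) auto
    also have "\<dots> = ?u powr p" using r st by (simp add: powr_divide)
    finally have le: "\<I> ?k \<le> ?u powr p" .
    have "pairing M ?k (J ?h) = complex_of_real (?u / r) * pairing M k (J ?h)" by (rule pairing_mult[OF k(1) h])
    then have "?u / r * Re (pairing M k (J ?h)) = Re (pairing M ?k (J ?h))" by (simp del: of_real_divide of_real_add)
    also have "\<dots> \<le> \<I> ?k / p + (p - 1) / p * \<I> ?h" by (intro pairing_young \<L>_intros k h)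
    also have "\<dots> \<le> ?u powr p / p + (p - 1) / p * \<I> ?h" using le p0 by (intro add_mono divide_right_mono) auto
    finally have "r / ?u * (?u / r * Re (pairing M k (J ?h))) \<le> r / ?u * (?u powr p / p + (p - 1) / p * \<I> ?h)"
      using r st by (intro mult_left_mono) auto
    then show ?thesis using r st by simp
  qed
  have "\<I> ?h = Re (pairing M f (J ?h)) + Re (pairing M g (J ?h))"
    using pairing_add[OF f(1) g(1) h] pairing_self[of ?h] by (metis Re_complex_of_real plus_complex.sel(1))
  also have "\<dots> \<le> s / ?u * (?u powr p / p + (p - 1) / p * \<I> ?h) + t / ?u * (?u powr p / p + (p - 1) / p * \<I> ?h)"
    by (intro add_mono * f g st)
  also have "\<dots> = (s / ?u + t / ?u) * (?u powr p / p + (p - 1) / p * \<I> ?h)" by (simp only: distrib_right)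
  also have "s / ?u + t / ?u = 1" using st by (simp add: add_divide_distrib[symmetric])
  finally have "\<I> ?h \<le> ?u powr p / p + (p - 1) / p * \<I> ?h" by simp
  moreover have "i \<le> u / p + (p - 1) / p * i \<Longrightarrow> i \<le> u" for i u
    using p0 by (simp add: field_simps)
  ultimately show ?thesis by blast
qed

lemma norm_le_of_rep:
  assumes "0 \<le> r" "\<And>f. \<L> f \<Longrightarrow> \<I> f \<le> 1 \<Longrightarrow> \<I> (\<pi> a f) \<le> r powr p"
  shows "norm a \<le> r"
  using rep_norming[of r a] assms by (meson not_le)

end

locale represented_algebra = Lp_representation p M \<pi> + nonunital_algebra F
  for p :: real and M :: "'b measure" and \<pi> :: "'a::complex_banach_algebra \<Rightarrow> 'b fun_op" and F :: "'a filter"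
begin

text \<open>
  By uniform convexity, \<open>\<parallel>\<xi> + a \<xi>\<parallel>\<close> is close to \<open>2\<close> only if \<open>a \<xi>\<close> is close to \<open>\<xi>\<close>, and then
  \<open>\<xi> - e \<xi>\<close> is small. A state with \<open>\<omega> a\<close> close to \<open>1\<close> is therefore small on \<open>1 - e\<close>.
\<close>

lemma perturbation_norm:
  assumes e0: "0 < \<epsilon>" "\<epsilon> \<le> 1"
  obtains \<delta> where "0 < \<delta>"
    "\<And>a e z. norm a \<le> 1 \<Longrightarrow> norm e \<le> 1 \<Longrightarrow> norm (e * a - a) \<le> \<epsilon> / 4 \<Longrightarrow> cmod z \<le> 1 \<Longrightarrow>
       N ((a, 1) + (complex_of_real \<delta> * z) *\<^sub>C ((- e, 1) :: 'a \<times> complex)) \<le> 2 + \<delta> * \<epsilon>"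
proof -
  have ep: "0 < (\<epsilon> / 4) powr p" using e0 by simp
  obtain \<kappa>' where k': "0 < \<kappa>'" "\<And>f g :: 'b \<Rightarrow> complex. \<L> f \<Longrightarrow> \<L> g \<Longrightarrow> \<I> f \<le> 1 \<Longrightarrow> \<I> g \<le> 1 \<Longrightarrow>
       2 powr p * (1 - \<kappa>') \<le> \<I> (\<lambda>x. f x + g x) \<Longrightarrow> \<I> (\<lambda>x. f x - g x) \<le> (\<epsilon> / 4) powr p"
    using Lp_uniformly_convex[OF p ep, of M] by blast
  define \<kappa> where "\<kappa> = min \<kappa>' (1 / 2)"
  have k: "0 < \<kappa>" "\<kappa> \<le> 1 / 2" "\<kappa> \<le> \<kappa>'" using k'(1) by (auto simp: \<kappa>_def)
  \<comment> \<open>Uniform convexity applies to sums of norm above \<open>2 - \<beta>\<close>.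
    Below, \<open>\<delta>\<close> is half of \<open>\<beta>\<close>, so that
    \<open>\<delta>\<close> times a vector of norm 2 just fills the gap.\<close>
  define \<beta> where "\<beta> = 2 - 2 * (1 - \<kappa>) powr (1 / p)"
  have "(1 - \<kappa>) powr (1 / p) < 1 powr (1 / p)" using k p0 by (intro powr_less_mono2) auto
  then have \<beta>: "0 < \<beta>" "\<beta> < 2" using k by (auto simp: \<beta>_def)
  have \<beta>p: "(2 - \<beta>) powr p = 2 powr p * (1 - \<kappa>)"
    using k p0 by (simp add: \<beta>_def powr_mult powr_powr)
  define \<delta> where "\<delta> = \<beta> / 2"
  have \<delta>: "0 < \<delta>" "\<delta> < 1" using \<beta> by (auto simp: \<delta>_def)
  show ?thesis
  proof (rule that[OF \<delta>(1)], rule N_least)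
    fix a e :: 'a and z :: complex and c :: 'a
    assume a: "norm a \<le> 1" and e: "norm e \<le> 1" "norm (e * a - a) \<le> \<epsilon> / 4" and z: "cmod z \<le> 1" and c: "norm c \<le> 1"
    define w where "w = complex_of_real \<delta> * z"
    have w: "cmod w \<le> \<delta>" using z \<delta> by (simp add: w_def norm_mult mult_left_le)
    have act_eq: "act ((a, 1) + w *\<^sub>C (- e, 1)) c = (c + a * c) + w *\<^sub>C (c - e * c)"
      unfolding act_add act_scaleC by (simp add: act_def scaleC_one algebra_simps)
    show "norm (act ((a, 1) + (complex_of_real \<delta> * z) *\<^sub>C (- e, 1)) c) \<le> 2 + \<delta> * \<epsilon>"
      unfolding w_def[symmetric] act_eq
    proof (rule norm_le_of_rep)
      show "0 \<le> 2 + \<delta> * \<epsilon>" using \<delta> e0 by simp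
      fix f :: "'b \<Rightarrow> complex" assume f: "\<L> f" "\<I> f \<le> 1"
      define \<xi> where "\<xi> = \<pi> c f"
      define \<eta> where "\<eta> = \<pi> (a * c) f"
      define y where "y = \<pi> (c - e * c) f"
      have L: "\<L> \<xi>" "\<L> \<eta>" "\<L> y" by (simp_all add: \<xi>_def \<eta>_def y_def rep_in f)
      have ac: "norm (a * c) \<le> 1" and ec: "norm (e * c) \<le> 1" using norm_mult_le[OF a c] norm_mult_le[OF e(1) c] by auto
      have cec: "norm (c - e * c) \<le> 2" using norm_triangle_ineq4[of c "e * c"] c ec by linarith
      have \<xi>1: "\<I> \<xi> \<le> 1 powr p" and \<eta>1: "\<I> \<eta> \<le> 1 powr p"
        using rep_bound_le[OF f(1) c f(2)] rep_bound_le[OF f(1) ac f(2)] by (simp_all add: \<xi>_def \<eta>_def)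
      have y2: "\<I> y \<le> 2 powr p" using rep_bound_le[OF f(1) cec f(2)] by (simp add: y_def)
      have sum2: "\<I> (\<lambda>t. \<xi> t + \<eta> t) \<le> (1 + 1) powr p" by (rule minkowski[OF L(1) \<xi>1 L(2) \<eta>1]) simp_all
      have wy: "\<I> (\<lambda>t. w * y t) \<le> (\<delta> * r) powr p" if "\<I> y \<le> r powr p" "0 < r" for r
      proof -
        have "cmod w powr p * \<I> y \<le> \<delta> powr p * r powr p"
          using that w p0 by (intro mult_mono powr_mono2) (auto simp: Lp_int_nonneg)
        then show ?thesis using \<delta> that by (simp add: Lp_int_mult powr_mult)
      qed
      have "AE t in M. \<pi> ((c + a * c) + w *\<^sub>C (c - e * c)) f t = (\<xi> t + \<eta> t) + w * y t"
        using rep_add[OF f(1), of "c + a * c" "w *\<^sub>C (c - e * c)"] rep_add[OF f(1), of c "a * c"] rep_scaleC[OF f(1), of w "c - e * c"]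
        by eventually_elim (simp add: \<xi>_def \<eta>_def y_def)
      then have eq: "\<I> (\<pi> ((c + a * c) + w *\<^sub>C (c - e * c)) f) = \<I> (\<lambda>t. (\<xi> t + \<eta> t) + w * y t)"
        by (intro Lp_int_cong_AE meas \<L>_intros L f)
      show "\<I> (\<pi> ((c + a * c) + w *\<^sub>C (c - e * c)) f) \<le> (2 + \<delta> * \<epsilon>) powr p"
      \<comment> \<open>Either \<open>\<xi> + \<eta>\<close> is shorter than 2 by
        \<open>\<beta>\<close>, or \<open>\<xi>\<close> and \<open>\<eta>\<close> are
        \<open>\<epsilon> / 4\<close> close. In the second case \<open>y\<close> is the difference
        of \<open>\<xi>\<close> and \<open>\<eta>\<close>, minus its image under \<open>e\<close>,
        plus the image of \<open>f\<close> under \<open>a c - e a c\<close>: three terms of size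
        \<open>\<epsilon> / 4\<close>.\<close>
      proof (cases "\<I> (\<lambda>t. \<xi> t + \<eta> t) \<le> (2 - \<beta>) powr p")
        case True
        have "\<I> (\<lambda>t. (\<xi> t + \<eta> t) + w * y t) \<le> ((2 - \<beta>) + \<delta> * 2) powr p"
          using \<beta> \<delta> by (intro minkowski \<L>_intros L True wy y2) auto
        also have "\<dots> \<le> (2 + \<delta> * \<epsilon>) powr p" using p0 \<delta> e0 by (intro powr_mono2) (auto simp: \<delta>_def)
        finally show ?thesis by (simp add: eq)
      next
        case False
        have "2 powr p * (1 - \<kappa>') \<le> 2 powr p * (1 - \<kappa>)" using k by (intro mult_left_mono) auto
        then have "2 powr p * (1 - \<kappa>') \<le> \<I> (\<lambda>t. \<xi> t + \<eta> t)" using False \<beta>p by linarith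
        then have d: "\<I> (\<lambda>t. \<xi> t - \<eta> t) \<le> (\<epsilon> / 4) powr p" using \<xi>1 \<eta>1 by (intro k'(2) L) auto
        let ?d = "\<lambda>t. \<xi> t - \<eta> t"
        have dL: "\<L> ?d" by (intro \<L>_intros L)
        have "\<I> (\<lambda>t. (- 1) * \<pi> e ?d t) \<le> 1 powr p * (\<epsilon> / 4) powr p"
          using rep_bound_le[OF dL e(1) d] unfolding Lp_int_mult by simp
        then have ed: "\<I> (\<lambda>t. (- 1) * \<pi> e ?d t) \<le> (\<epsilon> / 4) powr p" by simp
        have eac: "norm (a * c - e * (a * c)) \<le> \<epsilon> / 4"
        proof -
          have "norm ((e * a - a) * c) \<le> \<epsilon> / 4 * 1" by (rule norm_mult_le[OF e(2) c])
          then show ?thesis by (simp add: left_diff_distrib mult.assoc norm_minus_commute)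
        qed
        have r: "\<I> (\<pi> (a * c - e * (a * c)) f) \<le> (\<epsilon> / 4) powr p" using rep_bound_le[OF f(1) eac f(2)] by simp
        have "AE t in M. \<pi> e (\<lambda>t. \<xi> t + (- 1) * \<eta> t) t = \<pi> e \<xi> t + (- 1) * \<pi> e \<eta> t"
          using rep_add_vec[OF L(1) Lp_fun_mult[OF p0 L(2), of "- 1"], of e] rep_mult_vec[OF L(2), of e "- 1"]
          by eventually_elim simp
        then have "AE t in M. y t = ?d t + (- 1) * \<pi> e ?d t + \<pi> (a * c - e * (a * c)) f t"
          using rep_diff[OF f(1), of c "e * c"] rep_diff[OF f(1), of "a * c" "e * (a * c)"] rep_mult[OF f(1), of e c]
            rep_mult[OF f(1), of e "a * c"]
          by eventually_elim (simp add: y_def \<xi>_def \<eta>_def)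
        then have "\<I> y = \<I> (\<lambda>t. ?d t + (- 1) * \<pi> e ?d t + \<pi> (a * c - e * (a * c)) f t)"
          by (intro Lp_int_cong_AE meas \<L>_intros L f dL)
        also have "\<dots> \<le> (\<epsilon> / 4 + \<epsilon> / 4 + \<epsilon> / 4) powr p"
          using e0 by (intro minkowski \<L>_intros L f dL d ed r) auto
        also have "\<dots> \<le> \<epsilon> powr p" using p0 e0 by (intro powr_mono2) auto
        finally have "\<I> y \<le> \<epsilon> powr p" .
        then have "\<I> (\<lambda>t. (\<xi> t + \<eta> t) + w * y t) \<le> ((1 + 1) + \<delta> * \<epsilon>) powr p"
          using \<delta> e0 by (intro minkowski \<L>_intros L sum2 wy) auto
        then show ?thesis by (simp add: eq)
      qed
    qed
  qed
qed

lemma state_tendsto_1: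
  assumes \<omega>: "state \<omega>" and n1: "dual_norm UNIV norm (\<lambda>a. \<omega> (a, 0)) = 1"
  shows "((\<lambda>e. \<omega> (e, 0)) \<longlongrightarrow> 1) F"
proof (rule tendstoI)
  fix r :: real assume r: "0 < r"
  define \<epsilon> where "\<epsilon> = min (r / 3) 1"
  have e: "0 < \<epsilon>" "\<epsilon> \<le> 1" "2 * \<epsilon> < r" using r by (auto simp: \<epsilon>_def)
  obtain \<delta> where d: "0 < \<delta>"
    "\<And>a e z. norm a \<le> 1 \<Longrightarrow> norm e \<le> 1 \<Longrightarrow> norm (e * a - a) \<le> \<epsilon> / 4 \<Longrightarrow> cmod z \<le> 1 \<Longrightarrow>
       N ((a, 1) + (complex_of_real \<delta> * z) *\<^sub>C (- e, 1)) \<le> 2 + \<delta> * \<epsilon>"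
    using perturbation_norm[OF e(1,2)] by blast
  have lin: "clinear_on UNIV \<omega>" and le: "cmod (\<omega> x) \<le> N x" and one: "\<omega> (0, 1) = 1" for x
    using \<omega> unfolding state_def by blast+
  have "\<exists>a. norm a \<le> 1 \<and> 1 - \<delta> * \<epsilon> < cmod (\<omega> (a, 0))"
  proof (rule ccontr)
    assume "\<not> ?thesis"
    then have *: "cmod (\<omega> (a, 0)) \<le> 1 - \<delta> * \<epsilon>" if "norm a \<le> 1" for a using that by force
    have "dual_norm UNIV norm (\<lambda>a. \<omega> (a, 0)) \<le> 1 - \<delta> * \<epsilon>"
      unfolding dual_norm_def
    proof (rule cSup_least)
      show "{cmod (\<omega> (x, 0)) |x. x \<in> UNIV \<and> norm x \<le> 1} \<noteq> {}" by (auto intro: exI[of _ 0])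
    qed (use * in auto)
    then show False using n1 d(1) e(1) mult_pos_pos[of \<delta> \<epsilon>] by linarith
  qed
  then obtain a where a: "norm a \<le> 1" "1 - \<delta> * \<epsilon> < cmod (\<omega> (a, 0))" by blast
  define b where "b = cnj (sgn (\<omega> (a, 0))) *\<^sub>C a"
  have unrot: "cnj (sgn x) * x = cmod x" for x :: complex
    using mult_dmap[of x 1] by (simp add: dmap_def mult.commute split: if_splits)
  have b: "norm b \<le> 1" using a(1) by (simp add: b_def norm_scaleC norm_sgn)
  have "(b, 0) = cnj (sgn (\<omega> (a, 0))) *\<^sub>C (a, 0 :: complex)" by (simp add: b_def)
  then have \<omega>b: "\<omega> (b, 0) = cmod (\<omega> (a, 0))" by (simp only: clinear_on_scale[OF lin] scaleC_simps(1) unrot)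
  have "((\<lambda>e. norm (e * b - b)) \<longlongrightarrow> 0) F"
    using F_left[of b] by (intro tendsto_norm_zero LIM_zero)
  then have "\<forall>\<^sub>F e in F. norm (e * b - b) < \<epsilon> / 4" using e(1) by (intro order_tendstoD) auto
  then show "\<forall>\<^sub>F e in F. dist (\<omega> (e, 0)) 1 < r"
    using F_norm
  proof eventually_elim
    case (elim e)
    \<comment> \<open>This phase makes the contributions of \<open>b\<close>, of the unit and of
      \<open>1 - e\<close> add up without cancellation. The first two are within
      \<open>\<delta> * \<epsilon>\<close> of 2, so at most \<open>2 * \<delta> * \<epsilon>\<close>
      is left for the third.\<close>
    define z where "z = cnj (sgn (1 - \<omega> (e, 0)))"
    have z: "cmod z \<le> 1" by (simp add: z_def norm_sgn)
    let ?x = "(b, 1) + (complex_of_real \<delta> * z) *\<^sub>C ((- e, 1) :: 'a \<times> complex)"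
    have s1: "\<omega> (x, 1) = \<omega> (x, 0) + 1" for x
      using clinear_on_add[OF lin, of "(x, 0)" "(0, 1)"] one by simp
    have s2: "\<omega> (- e, 0) = - \<omega> (e, 0)" using clinear_on_minus[OF lin, of "(e, 0)"] by simp
    have "\<omega> ?x = \<omega> (b, 1) + (complex_of_real \<delta> * z) * \<omega> (- e, 1)"
      by (simp only: clinear_on_add[OF lin] clinear_on_scale[OF lin] scaleC_simps(1))
    also have "\<dots> = \<omega> (b, 0) + 1 + complex_of_real \<delta> * (z * (1 - \<omega> (e, 0)))"
      by (simp add: s1 s2 algebra_simps)
    also have "z * (1 - \<omega> (e, 0)) = cmod (1 - \<omega> (e, 0))" unfolding z_def by (rule unrot)
    finally have "\<omega> ?x = complex_of_real (cmod (\<omega> (a, 0)) + 1 + \<delta> * cmod (1 - \<omega> (e, 0)))"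
      by (simp add: \<omega>b)
    then have "cmod (\<omega> (a, 0)) + 1 + \<delta> * cmod (1 - \<omega> (e, 0)) \<le> cmod (\<omega> ?x)"
      by (simp only: norm_of_real abs_ge_self)
    also have "\<dots> \<le> 2 + \<delta> * \<epsilon>"
      using elim by (intro order_trans[OF le] d(2) b z) auto
    finally have "\<delta> * cmod (1 - \<omega> (e, 0)) \<le> \<delta> * (2 * \<epsilon>)" using a(2) by (simp add: algebra_simps)
    then have "cmod (1 - \<omega> (e, 0)) \<le> 2 * \<epsilon>" using d(1) by simp
    then show ?case using e(3) by (simp add: dist_norm norm_minus_commute)
  qed
qed

lemma scaled_imp_Im_tendsto_0:
  assumes "scaled TYPE('a)" "state \<omega>"
  shows "((\<lambda>e. Im (\<omega> (e, 0))) \<longlongrightarrow> 0) F"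
proof -
  have "(\<lambda>a. \<omega> (a, 0)) \<in> quasistates"
    using assms by (auto simp: scaled_iff restricted_states_eq)
  then obtain t \<phi> where t: "\<phi> \<in> states" "(\<lambda>a. \<omega> (a, 0)) = complex_of_real t *\<^sub>C \<phi>" by (auto simp: quasistates_def)
  obtain \<omega>' where w: "state \<omega>'" "\<phi> = (\<lambda>a. \<omega>' (a, 0))" "dual_norm UNIV norm \<phi> = 1"
    using t(1) by (auto simp: states_def restricted_states_eq)
  have eq: "\<omega> (a, 0) = complex_of_real t * \<omega>' (a, 0)" for a using fun_cong[OF t(2), of a] w(2) by simp
  have "((\<lambda>e. complex_of_real t * \<omega>' (e, 0)) \<longlongrightarrow> complex_of_real t * 1) F"
    using w by (intro tendsto_mult tendsto_const state_tendsto_1) auto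
  then show ?thesis using tendsto_Im unfolding eq by fastforce
qed

end

section \<open>Spatial numerical ranges and nearly Hermitian elements\<close>

context nonunital_algebra
begin

definition vectors :: "(('a \<Rightarrow> complex) \<times> 'a) set" where
  "vectors = {(\<phi>, c). clinear_on UNIV \<phi> \<and> (\<forall>x. cmod (\<phi> x) \<le> norm x) \<and> norm c = 1 \<and> \<phi> c = 1}"

text \<open>The supremum of the real parts of the spatial numerical range of \<open>x\<close> acting
  on the algebra. It is sublinear, and real-linear functionals below it are real parts of states by
  \<open>state_complexify\<close>, so Hahn-Banach arguments with it produce states.\<close>

definition num_max :: "'a \<times> complex \<Rightarrow> real" where
  "num_max x = Sup ((\<lambda>(\<phi>, c). Re (\<phi> (act x c))) ` vectors)"

lemma vectors_norming:
  assumes "c \<noteq> 0"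
  obtains \<phi> where "clinear_on UNIV \<phi>" "(\<phi>, complex_of_real (1 / norm c) *\<^sub>C c) \<in> vectors" "\<phi> c = norm c"
    "\<And>x. cmod (\<phi> x) \<le> norm x"
proof -
  obtain \<phi> :: "'a \<Rightarrow> complex" where p: "clinear_on UNIV \<phi>" "\<And>x. cmod (\<phi> x) \<le> norm x" "\<phi> c = norm c"
    using hahn_banach_norming[OF cseminorm_norm, of c] by blast
  have "(\<phi>, complex_of_real (1 / norm c) *\<^sub>C c) \<in> vectors"
    using p assms by (simp add: vectors_def norm_scaleC norm_divide clinear_on_scale[OF p(1)])
  then show ?thesis using that p by blast
qed

lemma vectors_nonempty: "vectors \<noteq> {}"
  using vectors_norming nonzero by (metis empty_iff)

lemma vectors_le: "(\<phi>, c) \<in> vectors \<Longrightarrow> Re (\<phi> (act x c)) \<le> N x"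
proof -
  assume "(\<phi>, c) \<in> vectors"
  then have "state (\<lambda>x. \<phi> (act x c))" by (intro vector_state) (auto simp: vectors_def)
  then have "cmod (\<phi> (act x c)) \<le> N x" unfolding state_def by blast
  then show ?thesis using complex_Re_le_cmod[of "\<phi> (act x c)"] by linarith
qed

lemma num_max_bdd: "bdd_above ((\<lambda>(\<phi>, c). Re (\<phi> (act x c))) ` vectors)"
proof (rule bdd_aboveI[where M = "N x"])
  fix y assume "y \<in> (\<lambda>(\<phi>, c). Re (\<phi> (act x c))) ` vectors"
  then obtain \<phi> c where "(\<phi>, c) \<in> vectors" "y = Re (\<phi> (act x c))" by auto
  then show "y \<le> N x" using vectors_le by simp
qed

lemma num_max_upper: "(\<phi>, c) \<in> vectors \<Longrightarrow> Re (\<phi> (act x c)) \<le> num_max x"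
  unfolding num_max_def by (rule cSup_upper[OF _ num_max_bdd]) force

lemma num_max_least: "(\<And>\<phi> c. (\<phi>, c) \<in> vectors \<Longrightarrow> Re (\<phi> (act x c)) \<le> b) \<Longrightarrow> num_max x \<le> b"
  unfolding num_max_def using vectors_nonempty by (intro cSup_least) auto

lemma num_max_le: "num_max x \<le> N x"
  by (rule num_max_least) (rule vectors_le)

lemma vectors_lin: "(\<phi>, c) \<in> vectors \<Longrightarrow> \<phi> (act (x + y) c) = \<phi> (act x c) + \<phi> (act y c)"
  "(\<phi>, c) \<in> vectors \<Longrightarrow> \<phi> (act (s *\<^sub>C x) c) = s * \<phi> (act x c)"
  by (simp_all add: vectors_def act_add act_scaleC clinear_on_add clinear_on_scale)

lemma vectors_one: "(\<phi>, c) \<in> vectors \<Longrightarrow> \<phi> (act (complex_of_real r *\<^sub>C (0, 1)) c) = r"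
  using vectors_lin(2)[of \<phi> c "complex_of_real r" "(0, 1)"] by (simp add: vectors_def)

lemma num_max_sublinear: "sublinear num_max"
  unfolding sublinear_def
proof (intro conjI allI impI)
  show "num_max (x + y) \<le> num_max x + num_max y" for x y
  proof (rule num_max_least)
    fix \<phi> c assume v: "(\<phi>, c) \<in> vectors"
    show "Re (\<phi> (act (x + y) c)) \<le> num_max x + num_max y"
      using num_max_upper[OF v, of x] num_max_upper[OF v, of y] by (simp add: vectors_lin(1)[OF v])
  qed
  have le: "num_max (r *\<^sub>r x) \<le> r * num_max x" if "0 \<le> r" for r x
  proof (rule num_max_least)
    fix \<phi> c assume v: "(\<phi>, c) \<in> vectors"
    show "Re (\<phi> (act (r *\<^sub>r x) c)) \<le> r * num_max x"
      using mult_left_mono[OF num_max_upper[OF v, of x] that] by (simp add: vectors_lin(2)[OF v])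
  qed
  fix r :: real and x assume r: "0 \<le> r"
  show "num_max (r *\<^sub>r x) = r * num_max x"
  proof (cases "r = 0")
    case True
    obtain \<phi> c where v: "(\<phi>, c) \<in> vectors" using vectors_nonempty by auto
    show ?thesis using le[of 0 x] num_max_upper[OF v, of "0 *\<^sub>r x"] vectors_lin(2)[OF v, of 0 x] True by simp
  next
    case False
    then have "num_max x \<le> inverse r * num_max (r *\<^sub>r x)"
      using le[of "inverse r" "r *\<^sub>r x"] r by (simp add: scaleC_scaleC scaleC_one flip: of_real_mult)
    then have "r * num_max x \<le> num_max (r *\<^sub>r x)" using False r by (simp add: field_simps)
    then show ?thesis using le[OF r, of x] by simp
  qed
qed

text \<open>That this covers negative \<open>r\<close> as well pins the value at the unit of every
  real-linear functional below \<open>num_max\<close>.\<close>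

lemma num_max_shift: "num_max (r *\<^sub>r (0, 1)) = r"
proof (rule antisym)
  show "num_max (r *\<^sub>r (0, 1)) \<le> r" by (rule num_max_least) (simp only: vectors_one Re_complex_of_real order_refl)
  obtain \<phi> c where v: "(\<phi>, c) \<in> vectors" using vectors_nonempty by auto
  show "r \<le> num_max (r *\<^sub>r (0, 1))" using num_max_upper[OF v, of "r *\<^sub>r (0, 1)"] by (simp only: vectors_one[OF v] Re_complex_of_real)
qed

lemma state_complexify:
  assumes g: "real_linear g" "\<And>x. g x \<le> num_max x"
  shows "state (complexify g)"
proof -
  have lin: "clinear_on UNIV (complexify g)" by (rule complexify_clinear[OF g(1)])
  have le: "cmod (complexify g x) \<le> N x" for x
    by (rule cmod_le_of_Re_le[OF lin N_cseminorm]) (simp add: order_trans[OF g(2) num_max_le])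
  have "r * g (0, 1) \<le> r" for r
    using g(2)[of "r *\<^sub>r (0, 1)"] by (simp only: real_linear_scale[OF g(1)] num_max_shift)
  from this[of 1] this[of "- 1"] have "Re (complexify g (0, 1)) = 1" by simp
  moreover have "cmod (complexify g (0, 1)) \<le> 1" using le[of "(0, 1)"] by (simp add: N_one)
  ultimately have "complexify g (0, 1) = 1"
    using cmod_power2[of "complexify g (0, 1)"] power_mono[of "cmod (complexify g (0, 1))" 1 2]
    by (simp add: complex_eq_iff del: Re_complexify)
  then show ?thesis using lin le by (simp add: state_def)
qed

lemma real_functional_tendsto_0:
  assumes Im: "\<And>\<omega>. state \<omega> \<Longrightarrow> ((\<lambda>e. Im (\<omega> (e, 0))) \<longlongrightarrow> 0) F"
    and g: "real_linear g" "0 \<le> s" "\<And>x. g x \<le> s * num_max x"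
  shows "((\<lambda>e. g (\<i> *\<^sub>C (e, 0))) \<longlongrightarrow> 0) F"
proof (cases "s = 0")
  case True
  then have "g x = 0" for x using g(3)[of x] g(3)[of "- x"] real_linear_minus[OF g(1), of x] by simp
  then show ?thesis by simp
next
  case False
  define g' where "g' x = g x / s" for x
  have lin: "real_linear g'" using g(1) by (simp add: real_linear_def g'_def add_divide_distrib)
  have "g' x \<le> num_max x" for x using g(2) g(3)[of x] False by (simp add: g'_def field_simps)
  from state_complexify[OF lin this] have st: "state (complexify g')" .
  then have l: "clinear_on UNIV (complexify g')" by (simp add: state_def)
  have "g (\<i> *\<^sub>C (e, 0)) = - s * Im (complexify g' (e, 0))" for e
  proof -
    have "g' (\<i> *\<^sub>C (e, 0)) = Re (complexify g' (\<i> *\<^sub>C (e, 0)))" by simp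
    also have "\<dots> = Re (\<i> * complexify g' (e, 0))" by (simp only: clinear_on_scale[OF l] scaleC_simps(1))
    also have "\<dots> = - Im (complexify g' (e, 0))" by simp
    finally have "s * g' (\<i> *\<^sub>C (e, 0)) = s * (- Im (complexify g' (e, 0)))" by (rule arg_cong)
    then show ?thesis using False by (simp add: g'_def)
  qed
  then show ?thesis using tendsto_mult[OF tendsto_const[of "- s"] Im[OF st]] by simp
qed

text \<open>
  A minimax argument: if no element of a convex set \<open>C\<close> had \<open>num_max\<close> of both \<open>\<i> h\<close> and \<open>- \<i> h\<close>
  small, separation would give a combination of two states whose imaginary parts stay away from
  \<open>0\<close> on \<open>C\<close>.
\<close>

lemma minimax:
  assumes Im: "\<And>\<omega>. state \<omega> \<Longrightarrow> ((\<lambda>e. Im (\<omega> (e, 0))) \<longlongrightarrow> 0) F"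
    and C: "\<And>h k t. h \<in> C \<Longrightarrow> k \<in> C \<Longrightarrow> 0 \<le> t \<Longrightarrow> t \<le> 1 \<Longrightarrow> t *\<^sub>r h + (1 - t) *\<^sub>r k \<in> C"
    and ev: "\<forall>\<^sub>F e in F. e \<in> C" and d: "0 < \<delta>"
  obtains h where "h \<in> C" "num_max (\<i> *\<^sub>C (h, 0)) \<le> \<delta>" "num_max ((- \<i>) *\<^sub>C (h, 0)) \<le> \<delta>"
proof -
  have "\<exists>h\<in>C. num_max (\<i> *\<^sub>C (h, 0)) \<le> \<delta> \<and> num_max ((- \<i>) *\<^sub>C (h, 0)) \<le> \<delta>"
  proof (rule ccontr)
    assume no: "\<not> ?thesis"
    have big: "\<delta> \<le> max (num_max (\<i> *\<^sub>C (h, 0))) (num_max ((- \<i>) *\<^sub>C (h, 0)))" if "h \<in> C" for h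
      using no that unfolding le_max_iff_disj by (meson linear)
    \<comment> \<open>Both conditions are treated at once on the product space: a functional below
      \<open>Q\<close> splits into two, dominated by \<open>s1\<close> and \<open>s2\<close> times
      \<open>num_max\<close>, with \<open>s1 + s2 = 1\<close>.\<close>
    define Q where "Q z = max (num_max (fst z)) (num_max (snd z))" for z :: "('a \<times> complex) \<times> 'a \<times> complex"
    define k where "k h = (\<i> *\<^sub>C (h, 0 :: complex), (- \<i>) *\<^sub>C (h, 0 :: complex))" for h :: 'a
    note nm = sublinear_add[OF num_max_sublinear] sublinear_scale[OF num_max_sublinear]
    have Q: "sublinear Q"
      unfolding sublinear_def
    proof (intro conjI allI impI)
      fix z w :: "('a \<times> complex) \<times> 'a \<times> complex"
      show "Q (z + w) \<le> Q z + Q w"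
        using nm(1)[of "fst z" "fst w"] nm(1)[of "snd z" "snd w"] by (auto simp: Q_def max_def)
      fix r :: real assume "0 \<le> r"
      then show "Q (r *\<^sub>r z) = r * Q z" by (simp add: Q_def nm(2) max_mult_distrib_left)
    qed
    have k_add: "k (x + y) = k x + k y" and k_scale: "k (r *\<^sub>r x) = r *\<^sub>r k x" for x y r
      by (simp_all add: k_def scaleC_add_right scaleC_scaleC mult.commute)
    let ?K = "{(t *\<^sub>r k h, t * \<delta>) | t h. 0 \<le> t \<and> h \<in> C}"
    obtain h0 where h0: "h0 \<in> C" using eventually_happens'[OF F_bot ev] by blast
    have K: "real_cone ?K"
    proof (rule real_coneI)
      show "(0, 0) \<in> ?K" using h0 by (intro CollectI exI[of _ 0] exI[of _ h0]) simp
    next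
      fix x y a b assume "(x, a) \<in> ?K" "(y, b) \<in> ?K"
      then obtain t u h l where t: "0 \<le> t" "0 \<le> u" "h \<in> C" "l \<in> C"
        and x: "x = t *\<^sub>r k h" "a = t * \<delta>" "y = u *\<^sub>r k l" "b = u * \<delta>"
        by blast
      have "\<exists>v j. (t *\<^sub>r k h + u *\<^sub>r k l, t * \<delta> + u * \<delta>) = (v *\<^sub>r k j, v * \<delta>) \<and> 0 \<le> v \<and> j \<in> C"
      proof (cases "t + u = 0")
        case True
        then have "t = 0" "u = 0" using t by auto
        then show ?thesis using h0 by (intro exI[of _ 0] exI[of _ h0]) simp
      next
        case False
        let ?s = "t / (t + u)"
        have s: "0 \<le> ?s" "?s \<le> 1" "(t + u) * ?s = t" "(t + u) * (1 - ?s) = u" using t False by (auto simp: field_simps)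
        have "(t + u) *\<^sub>r k (?s *\<^sub>r h + (1 - ?s) *\<^sub>r l) = ((t + u) * ?s) *\<^sub>r k h + ((t + u) * (1 - ?s)) *\<^sub>r k l"
          unfolding k_add k_scale scaleC_add_right scaleC_scaleC of_real_mult ..
        also have "\<dots> = t *\<^sub>r k h + u *\<^sub>r k l" by (simp only: s)
        finally show ?thesis using t C[OF t(3,4) s(1,2)]
          by (intro exI[of _ "t + u"] exI[of _ "?s *\<^sub>r h + (1 - ?s) *\<^sub>r l"]) (simp add: distrib_right)
      qed
      then show "(x + y, a + b) \<in> ?K" unfolding x by blast
    next
      fix x a and r :: real assume "(x, a) \<in> ?K" "0 < r"
      then obtain t h where "0 \<le> t" "h \<in> C" "x = t *\<^sub>r k h" "a = t * \<delta>" by blast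
      then show "(r *\<^sub>r x, r * a) \<in> ?K"
        using \<open>0 < r\<close> by (intro CollectI exI[of _ "r * t"] exI[of _ h]) (simp add: scaleC_scaleC)
    qed
    have le: "r \<le> Q x" if "(x, r) \<in> ?K" for x r
    proof -
      obtain t h where t: "0 \<le> t" "h \<in> C" "x = t *\<^sub>r k h" "r = t * \<delta>" using \<open>(x, r) \<in> ?K\<close> by blast
      have "\<delta> \<le> Q (k h)" unfolding Q_def k_def fst_conv snd_conv by (rule big[OF t(2)])
      then show ?thesis unfolding t(3,4) sublinear_scale[OF Q t(1)] by (rule mult_left_mono[OF _ t(1)])
    qed
    obtain G where G: "real_linear G" "\<And>x. G x \<le> Q x" "\<And>x r. (x, r) \<in> ?K \<Longrightarrow> r \<le> G x"
      using mazur_orlicz[OF Q K le] by blast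
    have Gk: "\<delta> \<le> G (k h)" if "h \<in> C" for h
      using that by (intro G(3) CollectI exI[of _ 1] exI[of _ h]) (simp add: scaleC_one)
    define G1 where "G1 x = G (x, 0)" for x
    define G2 where "G2 x = G (0, x)" for x
    have Gs: "G (x, y) = G1 x + G2 y" for x y
      using real_linear_add[OF G(1), of "(x, 0)" "(0, y)"] by (simp add: G1_def G2_def)
    have lin: "real_linear G1" "real_linear G2"
      using real_linear_add[OF G(1), of "(x, 0)" "(y, 0)" for x y] real_linear_add[OF G(1), of "(0, x)" "(0, y)" for x y]
        real_linear_scale[OF G(1), of r "(x, 0)" for r x] real_linear_scale[OF G(1), of r "(0, x)" for r x]
      by (simp_all add: real_linear_def G1_def G2_def)
    define s1 where "s1 = G1 (0, 1)"
    define s2 where "s2 = G2 (0, 1)"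
    have G1r: "G1 (r *\<^sub>r (0, 1)) = r * s1" and G2r: "G2 (r *\<^sub>r (0, 1)) = r * s2" for r
      unfolding s1_def s2_def by (rule real_linear_scale[OF lin(1)], rule real_linear_scale[OF lin(2)])
    have Gle: "G1 x + G2 y \<le> max (num_max x) (num_max y)" for x y
      using G(2)[of "(x, y)"] by (simp add: Gs Q_def)
    have nm0: "num_max 0 = 0" by (rule sublinear_0[OF num_max_sublinear])
    have sum: "s1 + s2 = 1"
      using Gle[of "1 *\<^sub>r (0, 1)" "1 *\<^sub>r (0, 1)"] Gle[of "(- 1) *\<^sub>r (0, 1)" "(- 1) *\<^sub>r (0, 1)"]
      unfolding G1r G2r num_max_shift by simp
    then have sum1: "s1 = 1 - s2" and sum2: "s2 = 1 - s1" by simp_all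
    have s: "0 \<le> s1" "0 \<le> s2"
      using Gle[of "(- 1) *\<^sub>r (0, 1)" 0] Gle[of 0 "(- 1) *\<^sub>r (0, 1)"] real_linear_0[OF lin(1)] real_linear_0[OF lin(2)]
      unfolding G1r G2r num_max_shift nm0 by simp_all
    \<comment> \<open>With \<open>num_max x\<close> times the unit in the other slot, both entries
      of the maximum equal \<open>num_max x\<close>.\<close>
    have le1: "G1 x \<le> s1 * num_max x" for x
      using Gle[of x "num_max x *\<^sub>r (0, 1)"] unfolding G2r num_max_shift
      unfolding sum1 by (simp add: algebra_simps)
    have lim1: "((\<lambda>e. G1 (\<i> *\<^sub>C (e, 0))) \<longlongrightarrow> 0) F"
      by (rule real_functional_tendsto_0[OF Im lin(1) s(1) le1])
    have le2: "G2 x \<le> s2 * num_max x" for x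
      using Gle[of "num_max x *\<^sub>r (0, 1)" x] unfolding G1r num_max_shift
      unfolding sum2 by (simp add: algebra_simps)
    have lim2: "((\<lambda>e. G2 (\<i> *\<^sub>C (e, 0))) \<longlongrightarrow> 0) F"
      by (rule real_functional_tendsto_0[OF Im lin(2) s(2) le2])
    have "G (k e) = G1 (\<i> *\<^sub>C (e, 0)) - G2 (\<i> *\<^sub>C (e, 0))" for e
      using real_linear_minus[OF lin(2), of "\<i> *\<^sub>C (e, 0)"] unfolding k_def Gs scaleC_minus_left by simp
    then have "((\<lambda>e. G (k e)) \<longlongrightarrow> 0) F" using tendsto_diff[OF lim1 lim2] by simp
    moreover have "\<forall>\<^sub>F e in F. \<delta> \<le> G (k e)" using ev by eventually_elim (rule Gk)
    ultimately have "\<delta> \<le> 0" by (intro tendsto_lowerbound[OF _ _ F_bot])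
    then show False using d by simp
  qed
  then show ?thesis using that by blast
qed

definition near_hermitian :: "real \<Rightarrow> 'a \<Rightarrow> bool" where
  "near_hermitian \<delta> h \<longleftrightarrow> norm h \<le> 1 \<and> num_max (\<i> *\<^sub>C (h, 0)) \<le> \<delta> \<and> num_max ((- \<i>) *\<^sub>C (h, 0)) \<le> \<delta>"

text \<open>The elements of the unit ball that nearly absorb \<open>S\<close> form a convex set
  containing a tail of the approximate identity, so \<open>minimax\<close> applies to it.\<close>

lemma near_hermitian_exists:
  assumes Im: "\<And>\<omega>. state \<omega> \<Longrightarrow> ((\<lambda>e. Im (\<omega> (e, 0))) \<longlongrightarrow> 0) F"
    and S: "finite S" and d: "0 < \<delta>"
  obtains h where "near_hermitian \<delta> h" "\<And>c. c \<in> S \<Longrightarrow> norm (h * c - c) \<le> \<delta>" "\<And>c. c \<in> S \<Longrightarrow> norm (c * h - c) \<le> \<delta>"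
proof -
  let ?C = "{h. norm h \<le> 1 \<and> (\<forall>c\<in>S. norm (h * c - c) \<le> \<delta> \<and> norm (c * h - c) \<le> \<delta>)}"
  have conv: "norm (t *\<^sub>r x + (1 - t) *\<^sub>r y) \<le> b" if "norm x \<le> b" "norm y \<le> b" "0 \<le> t" "t \<le> 1" for x y :: 'a and t b
  proof -
    have "norm (t *\<^sub>r x + (1 - t) *\<^sub>r y) \<le> t * norm x + (1 - t) * norm y"
      using that by (intro order_trans[OF norm_triangle_ineq]) (simp add: norm_scaleC del: of_real_diff)
    also have "\<dots> \<le> t * b + (1 - t) * b" using that by (intro add_mono mult_left_mono) auto
    finally show ?thesis by (simp add: algebra_simps)
  qed
  have comb: "t *\<^sub>r c + (1 - t) *\<^sub>r c = c" for t and c :: 'a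
    by (simp add: scaleC_one flip: scaleC_add_left)
  obtain h where "h \<in> ?C" "num_max (\<i> *\<^sub>C (h, 0)) \<le> \<delta>" "num_max ((- \<i>) *\<^sub>C (h, 0)) \<le> \<delta>"
  proof (rule minimax[of ?C \<delta>, OF Im])
    fix h k :: 'a and t :: real assume a: "h \<in> ?C" "k \<in> ?C" "0 \<le> t" "t \<le> 1"
    have "(t *\<^sub>r h + (1 - t) *\<^sub>r k) * c - c = t *\<^sub>r (h * c - c) + (1 - t) *\<^sub>r (k * c - c)"
      "c * (t *\<^sub>r h + (1 - t) *\<^sub>r k) - c = t *\<^sub>r (c * h - c) + (1 - t) *\<^sub>r (c * k - c)" for c
      using comb[of t c]
      by (simp_all add: distrib_left distrib_right mult_scaleC_left mult_scaleC_right scaleC_diff_right algebra_simps)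
    then show "t *\<^sub>r h + (1 - t) *\<^sub>r k \<in> ?C" using a by (auto intro!: conv simp del: of_real_diff)
  next
    have "\<forall>\<^sub>F e in F. norm (e * c - c) < \<delta> \<and> norm (c * e - c) < \<delta>" for c
      using d F_left[of c] F_right[of c]
      by (intro eventually_conj order_tendstoD(2)[OF tendsto_norm_zero[OF LIM_zero]])
    then have "\<forall>\<^sub>F e in F. \<forall>c\<in>S. norm (e * c - c) < \<delta> \<and> norm (c * e - c) < \<delta>"
      by (intro eventually_ball_finite S) auto
    then show "\<forall>\<^sub>F e in F. e \<in> ?C" using F_norm by eventually_elim (auto intro: less_imp_le)
  qed (use d in auto)
  then show ?thesis using that by (auto simp: near_hermitian_def)
qed

text \<open>As for dissipative operators: with \<open>t = \<tau> s\<close>, the numerical range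
  makes \<open>1 - t h\<close> bounded below by \<open>1 - \<tau> * \<delta>\<close>, and
  \<open>1 - t h\<close> carries \<open>(1 + t h) c\<close> to
  \<open>c - t\<^sup>2 h\<^sup>2 c\<close>. One step therefore grows only by the order of
  \<open>\<tau> * \<delta> + \<tau>\<^sup>2\<close>.\<close>

lemma near_hermitian_step:
  assumes h: "norm h \<le> 1" and \<tau>: "cmod s = 1" "0 \<le> \<tau>" "\<tau> * \<delta> < 1" and m: "num_max (s *\<^sub>C (h, 0)) \<le> \<delta>"
  shows "norm (c + (complex_of_real \<tau> * s) *\<^sub>C (h * c)) \<le> (1 + \<tau>\<^sup>2) / (1 - \<tau> * \<delta>) * norm c"
proof -
  define t where "t = complex_of_real \<tau> * s"
  define c' where "c' = c + t *\<^sub>C (h * c)"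
  have lower: "(1 - \<tau> * \<delta>) * norm c' \<le> norm (c' - t *\<^sub>C (h * c'))"
  proof (cases "c' = 0")
    case False
    obtain \<phi> where \<phi>: "clinear_on UNIV \<phi>" "(\<phi>, complex_of_real (1 / norm c') *\<^sub>C c') \<in> vectors" "\<phi> c' = norm c'"
      "\<And>x. cmod (\<phi> x) \<le> norm x"
      using vectors_norming[OF False] by blast
    have "Re (\<phi> (act (s *\<^sub>C (h, 0)) (complex_of_real (1 / norm c') *\<^sub>C c'))) \<le> \<delta>"
      by (rule order_trans[OF num_max_upper[OF \<phi>(2)] m])
    then have "1 / norm c' * Re (s * \<phi> (h * c')) \<le> \<delta>"
      unfolding act_scaleC_right act_scaleC clinear_on_scale[OF \<phi>(1)]
      by (simp add: act_def)
    then have le: "Re (s * \<phi> (h * c')) \<le> \<delta> * norm c'" using False by (simp add: field_simps)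
    have "Re (\<phi> (c' - t *\<^sub>C (h * c'))) = norm c' - \<tau> * Re (s * \<phi> (h * c'))"
      by (simp add: clinear_on_diff[OF \<phi>(1)] clinear_on_scale[OF \<phi>(1)] \<phi>(3) t_def algebra_simps)
    moreover have "\<tau> * Re (s * \<phi> (h * c')) \<le> \<tau> * (\<delta> * norm c')" by (intro mult_left_mono le \<tau>)
    moreover have "Re (\<phi> (c' - t *\<^sub>C (h * c'))) \<le> norm (c' - t *\<^sub>C (h * c'))"
      by (rule order_trans[OF complex_Re_le_cmod \<phi>(4)])
    ultimately show ?thesis by (simp add: algebra_simps)
  qed simp
  have "c' - t *\<^sub>C (h * c') = c - (t * t) *\<^sub>C (h * (h * c))"
    by (simp add: c'_def distrib_left scaleC_add_right mult_scaleC_right scaleC_scaleC)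
  also have "norm \<dots> \<le> norm c + \<tau>\<^sup>2 * norm c"
  proof (rule order_trans[OF norm_triangle_ineq4 add_left_mono])
    have "norm (h * (h * c)) \<le> 1 * (1 * norm c)" by (intro norm_mult_le h) simp
    then show "norm ((t * t) *\<^sub>C (h * (h * c))) \<le> \<tau>\<^sup>2 * norm c"
      using \<tau> by (simp add: norm_scaleC t_def norm_mult power2_eq_square mult_left_mono)
  qed
  finally have "(1 - \<tau> * \<delta>) * norm c' \<le> (1 + \<tau>\<^sup>2) * norm c" using lower by (simp add: algebra_simps)
  then show ?thesis using \<tau> by (simp add: c'_def t_def field_simps)
qed

text \<open>Over \<open>m\<close> steps of size at most \<open>4 / m\<close> the quadratic errors
  add up to \<open>16 / m\<close> and the linear ones to \<open>8 * \<delta>\<close>. The sign of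
  \<open>Arg u\<close> decides which of the two numerical range bounds is used.\<close>

lemma near_hermitian_rot:
  assumes h: "near_hermitian \<delta> h" and m: "0 < m" "8 * \<delta> \<le> m" and d: "0 \<le> \<delta>"
  shows "norm (c + rot u h m * c) \<le> exp (16 / m + 8 * \<delta>) * norm c"
proof -
  define \<tau> where "\<tau> = \<bar>Arg u\<bar> / m"
  have t: "0 \<le> \<tau>" "m * \<tau> \<le> 4" using m abs_Arg_le[of u] by (simp_all add: \<tau>_def)
  have td: "\<tau> * \<delta> \<le> 1 / 2"
  proof -
    have "m * (\<tau> * \<delta>) \<le> 4 * \<delta>" using mult_right_mono[OF t(2) d] by (simp add: mult.assoc)
    also have "\<dots> \<le> m * (1 / 2)" using m by simp
    finally show ?thesis using m by simp
  qed
  define r where "r = (1 + \<tau>\<^sup>2) / (1 - \<tau> * \<delta>)"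
  have r0: "0 \<le> r" using td by (simp add: r_def)
  have step: "norm (c + (\<i> * Arg u / m) *\<^sub>C (h * c)) \<le> r * norm c" for c
  proof (cases "0 \<le> Arg u")
    case True
    then have "\<i> * Arg u / m = complex_of_real \<tau> * \<i>" by (simp add: \<tau>_def)
    then show ?thesis
      using near_hermitian_step[of h \<i> \<tau> \<delta> c] h t td unfolding r_def near_hermitian_def by simp
  next
    case False
    then have "\<i> * Arg u / m = complex_of_real \<tau> * (- \<i>)" by (simp add: \<tau>_def)
    then show ?thesis
      using near_hermitian_step[of h "- \<i>" \<tau> \<delta> c] h t td unfolding r_def near_hermitian_def by simp
  qed
  \<comment> \<open>This rests on \<open>1 / (1 - x) \<le> exp (2 * x)\<close> between 0 and 1/2,
    the reason for the assumption \<open>8 * \<delta> \<le> m\<close>.\<close>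
  have "r \<le> exp (\<tau>\<^sup>2 + 2 * (\<tau> * \<delta>))"
  proof -
    define x where "x = \<tau> * \<delta>"
    have x: "0 \<le> x" "x \<le> 1 / 2" using t d td by (simp_all add: x_def)
    have "1 \<le> (1 - x) * (1 + 2 * x)" using x mult_left_mono[OF x(2) x(1)] by (simp add: algebra_simps)
    also have "\<dots> \<le> (1 - x) * exp (2 * x)" using x by (intro mult_left_mono exp_ge_add_one_self) auto
    finally have "1 / (1 - x) \<le> exp (2 * x)" using x by (simp add: field_simps)
    then have "(1 + \<tau>\<^sup>2) * (1 / (1 - x)) \<le> exp (\<tau>\<^sup>2) * exp (2 * x)"
      using x by (intro mult_mono exp_ge_add_one_self) auto
    then show ?thesis by (simp add: r_def x_def exp_add)
  qed
  then have "r ^ m \<le> exp (\<tau>\<^sup>2 + 2 * (\<tau> * \<delta>)) ^ m" using r0 by (intro power_mono)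
  also have "\<dots> = exp (m * (\<tau>\<^sup>2 + 2 * (\<tau> * \<delta>)))" by (simp add: exp_of_nat_mult)
  also have "\<dots> \<le> exp (16 / m + 8 * \<delta>)"
  proof -
    have "m * \<tau>\<^sup>2 = (m * \<tau>)\<^sup>2 / m" using m by (simp add: power2_eq_square)
    also have "\<dots> \<le> 4\<^sup>2 / m" using t m by (intro divide_right_mono power_mono) auto
    finally have "m * \<tau>\<^sup>2 \<le> 16 / m" by simp
    moreover have "m * (\<tau> * \<delta>) \<le> 4 * \<delta>" using mult_right_mono[OF t(2) d] by (simp add: mult.assoc)
    ultimately show ?thesis by (simp add: algebra_simps)
  qed
  finally have "r ^ m * norm c \<le> exp (16 / m + 8 * \<delta>) * norm c" by (intro mult_right_mono) auto
  moreover have "norm (c + rot u h m * c) \<le> r ^ m * norm c"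
    unfolding rot_def by (rule euler_act_norm[OF step r0])
  ultimately show ?thesis by linarith
qed

end

section \<open>The \<open>L\<close>-projection\<close>

text \<open>Tychonoff's theorem provides a finer filter along which all the bounded functions converge.\<close>

lemma simultaneous_limits:
  fixes \<Theta> :: "'x \<Rightarrow> 'i \<Rightarrow> complex"
  assumes G: "G \<noteq> bot" and B: "\<forall>\<^sub>F x in G. \<forall>i. cmod (\<Theta> x i) \<le> B i"
  obtains G' \<Lambda> where "G' \<le> G" "G' \<noteq> bot" "\<And>i. ((\<lambda>x. \<Theta> x i) \<longlongrightarrow> \<Lambda> i) G'"
proof -
  let ?U = "PiE UNIV (\<lambda>i. cball (0::complex) (B i))"
  have "compactin (product_topology (\<lambda>i. euclidean) UNIV) ?U"
    unfolding compactin_PiE by simp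
  then have "compact ?U" by (simp add: euclidean_product_topology)
  moreover have "filtermap \<Theta> G \<noteq> bot" using G by (simp add: filtermap_bot_iff)
  moreover have "\<forall>\<^sub>F y in filtermap \<Theta> G. y \<in> ?U"
    using B by (simp add: eventually_filtermap PiE_UNIV_domain Pi_iff)
  ultimately obtain \<Lambda> where \<Lambda>: "inf (nhds \<Lambda>) (filtermap \<Theta> G) \<noteq> bot"
    unfolding compact_filter by blast
  \<comment> \<open>The preimages under \<open>\<Theta>\<close> of the neighbourhoods of a cluster
    point are added to \<open>G\<close>; that they meet \<open>G\<close> is the cluster
    property.\<close>
  let ?G = "inf G (filtercomap \<Theta> (nhds \<Lambda>))"
  show ?thesis
  proof (rule that[of ?G \<Lambda>])
    show "?G \<noteq> bot"
    proof
      assume "?G = bot"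
      then have "\<forall>\<^sub>F x in ?G. False" by simp
      then obtain P Q where PQ: "\<forall>\<^sub>F x in G. P x" "\<forall>\<^sub>F x in filtercomap \<Theta> (nhds \<Lambda>). Q x" "\<And>x. P x \<Longrightarrow> Q x \<Longrightarrow> False"
        unfolding eventually_inf by auto
      obtain R where R: "\<forall>\<^sub>F y in nhds \<Lambda>. R y" "\<And>x. R (\<Theta> x) \<Longrightarrow> Q x"
        using PQ(2) unfolding eventually_filtercomap by blast
      have "\<forall>\<^sub>F y in filtermap \<Theta> G. \<not> R y"
        unfolding eventually_filtermap using PQ(1) by eventually_elim (use PQ(3) R(2) in blast)
      then have "\<forall>\<^sub>F y in inf (nhds \<Lambda>) (filtermap \<Theta> G). False"
        using R(1) unfolding eventually_inf by blast
      then show False using \<Lambda> by (simp add: eventually_False)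
    qed
    show "((\<lambda>x. \<Theta> x i) \<longlongrightarrow> \<Lambda> i) ?G" for i
    proof (rule tendsto_mono[OF inf_le2])
      have "((\<lambda>f. f i) \<longlongrightarrow> \<Lambda> i) (nhds \<Lambda>)"
      proof (rule topological_tendstoI)
        fix S :: "complex set" assume "open S" "\<Lambda> i \<in> S"
        then show "\<forall>\<^sub>F f in nhds \<Lambda>. f i \<in> S"
          unfolding eventually_nhds
          using open_vimage[OF \<open>open S\<close> continuous_on_product_coordinates[of i]]
          by (intro exI[of _ "(\<lambda>f. f i) -` S"]) auto
      qed
      then show "((\<lambda>x. \<Theta> x i) \<longlongrightarrow> \<Lambda> i) (filtercomap \<Theta> (nhds \<Lambda>))"
        by (rule filterlim_compose[OF _ filterlim_filtercomap])
    qed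
  qed simp
qed

context nonunital_algebra
begin

text \<open>For \<open>x = (h, m)\<close> this is \<open>(1 - U) / 2\<close> with \<open>U\<close>
  the approximate rotation of \<open>h\<close> by the angle pi. For large \<open>m\<close> it nearly
  fixes what \<open>h\<close> fixes, and it kills what \<open>h\<close> kills.\<close>

definition proj :: "'a \<times> nat \<Rightarrow> 'a" where
  "proj x = (- 1 / 2) *\<^sub>C rot (- 1) (fst x) (snd x)"

definition absorbing :: "real \<Rightarrow> 'a set \<Rightarrow> nat \<Rightarrow> 'a \<times> nat \<Rightarrow> bool" where
  "absorbing \<delta> S k x \<longleftrightarrow> near_hermitian \<delta> (fst x) \<and> k \<le> snd x \<and>
     (\<forall>c\<in>S. norm (fst x * c - c) \<le> \<delta> \<and> norm (c * fst x - c) \<le> \<delta>)"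

lemma near_hermitian_mono: "near_hermitian \<delta> h \<Longrightarrow> \<delta> \<le> \<epsilon> \<Longrightarrow> near_hermitian \<epsilon> h"
  by (auto simp: near_hermitian_def)

text \<open>The requirements for all \<open>\<delta>\<close>, \<open>S\<close> and \<open>k\<close>
  are directed and each can be met, so they generate one proper filter. Limits are taken along it
  first; what has to be absorbed can be specified later.\<close>

lemma absorbing_filter:
  assumes "\<And>\<omega>. state \<omega> \<Longrightarrow> ((\<lambda>e. Im (\<omega> (e, 0))) \<longlongrightarrow> 0) F"
  obtains G where "G \<noteq> bot" "\<And>\<delta> S k. 0 < \<delta> \<Longrightarrow> finite S \<Longrightarrow> \<forall>\<^sub>F x in G. absorbing \<delta> S k x"
proof -
  let ?I = "{(\<delta>, S, k) | \<delta> S k. (0::real) < \<delta> \<and> finite (S :: 'a set)} :: (real \<times> 'a set \<times> nat) set"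
  define A where "A = (\<lambda>(\<delta>, S, k). principal {x. absorbing \<delta> S k x})"
  define G where "G = (INF i\<in>?I. A i)"
  have "A i \<noteq> bot" if elem: "i \<in> ?I" for i
  proof -
    obtain \<delta> S k where i: "i = (\<delta>, S, k)" "0 < \<delta>" "finite S" using elem by blast
    obtain h where "near_hermitian \<delta> h" "\<And>c. c \<in> S \<Longrightarrow> norm (h * c - c) \<le> \<delta>" "\<And>c. c \<in> S \<Longrightarrow> norm (c * h - c) \<le> \<delta>"
      using near_hermitian_exists[OF assms i(3,2)] by blast
    then have "absorbing \<delta> S k (h, k)" by (simp add: absorbing_def)
    then show ?thesis by (auto simp: A_def i(1) principal_eq_bot_iff)
  qed
  moreover have "(INF i\<in>?I. A i) = bot \<longleftrightarrow> (\<exists>i\<in>?I. A i = bot)"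
  proof (rule INF_filter_bot_base)
    fix i j assume "i \<in> ?I" "j \<in> ?I"
    then obtain \<delta> S k \<epsilon> T l where ij: "i = (\<delta>, S, k)" "j = (\<epsilon>, T, l)" "0 < \<delta>" "0 < \<epsilon>" "finite S" "finite T" by blast
    have "absorbing (min \<delta> \<epsilon>) (S \<union> T) (max k l) x \<Longrightarrow> absorbing \<delta> S k x \<and> absorbing \<epsilon> T l x" for x
      unfolding absorbing_def by (auto intro: near_hermitian_mono)
    then show "\<exists>x\<in>?I. A x \<le> inf (A i) (A j)"
      using ij by (intro bexI[of _ "(min \<delta> \<epsilon>, S \<union> T, max k l)"]) (auto simp: A_def)
  qed
  ultimately have "G \<noteq> bot" unfolding G_def by blast
  moreover have "\<forall>\<^sub>F x in G. absorbing \<delta> S k x" if "0 < \<delta>" "finite S" for \<delta> S k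
  proof -
    have "G \<le> A (\<delta>, S, k)" unfolding G_def using that by (intro INF_lower) blast
    then show ?thesis by (rule filter_leD) (simp add: A_def eventually_principal)
  qed
  ultimately show ?thesis using that by blast
qed

lemma proj_norm:
  assumes "absorbing \<delta> S k x" "0 < k"
  shows "norm (proj x) \<le> exp 4"
proof -
  have "norm (rot (- 1) (fst x) (snd x)) \<le> exp 4"
    using norm_rot[of "fst x" "snd x" "- 1"] assms by (auto simp: absorbing_def near_hermitian_def)
  then have "cmod (- 1 / 2) * norm (rot (- 1) (fst x) (snd x)) \<le> 1 * exp 4" by (intro mult_mono) auto
  then show ?thesis by (simp add: proj_def norm_scaleC)
qed

lemma dual_fst_le: "\<phi> \<in> dual UNIV N \<Longrightarrow> cmod (\<phi> (a, 0)) \<le> dual_norm UNIV N \<phi> * norm a"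
  using dual_norm_upper[OF N_cseminorm, of \<phi> "(a, 0)"] by (simp add: N_fst)

lemma dual_split:
  assumes "\<phi> \<in> dual UNIV N"
  shows "\<phi> (a, l) = \<phi> (a, 0) + l * \<phi> (0, 1)"
proof -
  have lin: "clinear_on UNIV \<phi>" using assms by (simp add: dual_UNIV_iff)
  have "(a, l) = (a, 0) + l *\<^sub>C (0, 1 :: complex)" by simp
  then have "\<phi> (a, l) = \<phi> ((a, 0) + l *\<^sub>C (0, 1))" by (rule arg_cong)
  then show ?thesis by (simp only: clinear_on_add[OF lin] clinear_on_scale[OF lin] scaleC_simps(1))
qed

end

section \<open>The norm inequality behind the L-projection\<close>

context represented_algebra
begin

text \<open>The top level \<open>T n\<close> is chosen last, as it has to fix \<open>c n\<close>
  besides absorbing the other levels. It comes straight from the approximate identity, since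
  \<open>chain\<close> asks for nearly isometric rotations only below level 8.\<close>

lemma chain_exists:
  fixes c :: "nat \<Rightarrow> 'a"
  assumes p2: "p \<noteq> 2" and c: "\<And>n. norm (c n) \<le> 1"
    and f: "\<And>n j. absorbing (1 / real (Suc n)) (insert a ((\<lambda>i. fst (f n i)) ` {..<j})) (8 * Suc n) (f n j)"
  obtains T where "chain p M \<pi> (\<lambda>k n. if k = 8 then T n else fst (f n k)) (\<lambda>k n. snd (f n k)) (\<lambda>n. exp (24 / real (Suc n)))"
    "(\<lambda>n. T n * c n) \<simeq> c"
proof -
  have small: "(\<lambda>n. 1 / real (Suc n)) \<longlonglongrightarrow> 0" by (rule LIMSEQ_Suc[OF lim_1_over_n])
  have asymI: "x \<simeq> y" if "\<And>n. norm (x n - y n) \<le> 1 / real (Suc n)" for x y :: "nat \<Rightarrow> 'a"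
    unfolding asym_eq_iff by (rule Lim_null_comparison[OF always_eventually[OF allI[OF that]] small])
  have "\<exists>t. norm t \<le> 1 \<and> norm (t * c n - c n) \<le> 1 / real (Suc n) \<and>
     (\<forall>i\<in>{..<8::nat}. norm (t * fst (f n i) - fst (f n i)) \<le> 1 / real (Suc n) \<and> norm (fst (f n i) * t - fst (f n i)) \<le> 1 / real (Suc n))" for n
  proof -
    have l: "\<forall>\<^sub>F e in F. norm (e * x - x) < 1 / real (Suc n)" and r: "\<forall>\<^sub>F e in F. norm (x * e - x) < 1 / real (Suc n)" for x :: 'a
      using F_left[of x] F_right[of x] by (intro order_tendstoD(2)[OF tendsto_norm_zero[OF LIM_zero]]; simp)+
    have "\<forall>\<^sub>F e in F. \<forall>i\<in>{..<8::nat}. norm (e * fst (f n i) - fst (f n i)) < 1 / real (Suc n) \<and> norm (fst (f n i) * e - fst (f n i)) < 1 / real (Suc n)"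
      by (intro eventually_ball_finite ballI eventually_conj l r) simp
    with F_norm l[of "c n"] have "\<forall>\<^sub>F t in F. norm t \<le> 1 \<and> norm (t * c n - c n) \<le> 1 / real (Suc n) \<and>
     (\<forall>i\<in>{..<8::nat}. norm (t * fst (f n i) - fst (f n i)) \<le> 1 / real (Suc n) \<and> norm (fst (f n i) * t - fst (f n i)) \<le> 1 / real (Suc n))"
      by eventually_elim (auto intro: less_imp_le)
    then show ?thesis using eventually_happens'[OF F_bot] by blast
  qed
  then obtain T where T: "\<And>n. norm (T n) \<le> 1" "\<And>n. norm (T n * c n - c n) \<le> 1 / real (Suc n)"
    "\<And>n i. i < 8 \<Longrightarrow> norm (T n * fst (f n i) - fst (f n i)) \<le> 1 / real (Suc n)"
    "\<And>n i. i < 8 \<Longrightarrow> norm (fst (f n i) * T n - fst (f n i)) \<le> 1 / real (Suc n)"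
    by (metis lessThan_iff)
  have fn: "norm (fst (f n j)) \<le> 1" and fm: "8 * Suc n \<le> snd (f n j)" and fh: "near_hermitian (1 / real (Suc n)) (fst (f n j))" for n j
    using f[of n j] by (auto simp: absorbing_def near_hermitian_def)
  have fij: "norm (fst (f n j) * fst (f n i) - fst (f n i)) \<le> 1 / real (Suc n)"
    "norm (fst (f n i) * fst (f n j) - fst (f n i)) \<le> 1 / real (Suc n)" if "i < j" for n i j
    using f[of n j] that by (auto simp: absorbing_def)
  show ?thesis
  proof (rule that)
    show "(\<lambda>n. T n * c n) \<simeq> c" by (rule asymI) (rule T(2))
    show "chain p M \<pi> (\<lambda>k n. if k = 8 then T n else fst (f n k)) (\<lambda>k n. snd (f n k)) (\<lambda>n. exp (24 / real (Suc n)))"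
    proof
      show "p \<noteq> 2" by (rule p2)
      show "norm (if k = 8 then T n else fst (f n k)) \<le> 1" for k n using T(1) fn by simp
      show "0 < snd (f n k)" for k n using fm[of n k] by simp
      show "filterlim (\<lambda>n. snd (f n k)) at_top sequentially" for k
      proof (rule filterlim_at_top_mono[OF filterlim_ident always_eventually], rule allI)
        show "n \<le> snd (f n k)" for n using fm[of n k] by simp
      qed
      show "norm (c + rot u (if k = 8 then T n else fst (f n k)) (snd (f n k)) * c) \<le> exp (24 / real (Suc n)) * norm c"
        if "k < 8" for k n u c
      proof -
        have "norm (c + rot u (fst (f n k)) (snd (f n k)) * c) \<le> exp (16 / snd (f n k) + 8 * (1 / real (Suc n))) * norm c"
        proof (rule near_hermitian_rot[OF fh])
          show "0 < snd (f n k)" using fm[of n k] by simp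
          have "8 * (1 / real (Suc n)) \<le> 8" by (simp add: field_simps)
          also have "\<dots> \<le> real (snd (f n k))" using fm[of n k] by simp
          finally show "8 * (1 / real (Suc n)) \<le> real (snd (f n k))" .
        qed simp
        \<comment> \<open>The 24 is 16 + 8: \<open>snd (f n k)\<close> is at least
          \<open>Suc n\<close>, and the Hermitian defect is \<open>1 / Suc n\<close>.\<close>
        also have "\<dots> \<le> exp (24 / real (Suc n)) * norm c"
        proof (rule mult_right_mono)
          have "16 / real (snd (f n k)) \<le> 16 / real (Suc n)"
            using fm[of n k] by (intro divide_left_mono) auto
          then show "exp (16 / snd (f n k) + 8 * (1 / real (Suc n))) \<le> exp (24 / real (Suc n))" by (simp add: add_divide_distrib[symmetric])
        qed simp
        finally show ?thesis using that by simp
      qed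
      have "(\<lambda>n. exp (24 * (1 / real (Suc n)))) \<longlonglongrightarrow> exp (24 * 0)" by (intro tendsto_intros small)
      then show "(\<lambda>n. exp (24 / real (Suc n))) \<longlonglongrightarrow> 1" by simp
      show "1 \<le> exp (24 / real (Suc n))" for n by simp
      show "(\<lambda>n. (if l = 8 then T n else fst (f n l)) * (if k = 8 then T n else fst (f n k))) \<simeq> (\<lambda>n. if k = 8 then T n else fst (f n k))"
        if "k < l" "l \<le> 8" for k l
        by (rule asymI) (use that T(3) fij in auto)
      show "(\<lambda>n. (if k = 8 then T n else fst (f n k)) * (if l = 8 then T n else fst (f n l))) \<simeq> (\<lambda>n. if k = 8 then T n else fst (f n k))"
        if "k < l" "l \<le> 8" for k l
        by (rule asymI) (use that T(4) fij in auto)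
    qed
  qed
qed

text \<open>The quantity on the left is the modulus of the limit of \<open>\<phi> (X n)\<close>,
  where \<open>X n\<close> is \<open>a + s 1\<close> compressed to low levels plus
  \<open>\<alpha>\<close> times the complement of a high level. By \<open>key_bound\<close> the
  norms of \<open>X n\<close> are at most 1 in the limit.\<close>

lemma contraction_sequence:
  assumes p2: "p \<noteq> 2" and G: "G \<noteq> bot" "\<And>\<delta> S k. 0 < \<delta> \<Longrightarrow> finite S \<Longrightarrow> \<forall>\<^sub>F x in G. absorbing \<delta> S k x"
    and \<phi>: "\<phi> \<in> dual UNIV N" "((\<lambda>x. \<phi> (proj x, 0)) \<longlongrightarrow> L) G"
    and x: "N (a, s) \<le> 1" and \<alpha>: "cmod \<alpha> \<le> 1"
  shows "cmod (\<phi> (a, 0) + s * L + \<alpha> * (\<phi> (0, 1) - L)) \<le> dual_norm UNIV N \<phi>"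
proof -
  let ?r = "\<lambda>n. 1 / real (Suc n)"
  have small: "?r \<longlonglongrightarrow> 0" by (rule LIMSEQ_Suc[OF lim_1_over_n])
  let ?Q = "\<lambda>n f j y. absorbing (?r n) (insert a ((\<lambda>i. fst (f i)) ` {..<j})) (8 * Suc n) y \<and> cmod (\<phi> (proj y, 0) - L) < ?r n"
  have "\<exists>f. \<forall>j::nat. ?Q n f j (f j)" for n
  proof (rule dependent_wf_choice[where P = "?Q n", OF wf_less_than])
    show "?Q n f j y = ?Q n g j y" if "\<And>i. (i, j) \<in> less_than \<Longrightarrow> f i = g i" for f g :: "nat \<Rightarrow> 'a \<times> nat" and j y
    proof -
      have "(\<lambda>i. fst (f i)) ` {..<j} = (\<lambda>i. fst (g i)) ` {..<j}" using that by (intro image_cong) auto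
      then show ?thesis by simp
    qed
    fix j and f :: "nat \<Rightarrow> 'a \<times> nat"
    have "\<forall>\<^sub>F y in G. absorbing (?r n) (insert a ((\<lambda>i. fst (f i)) ` {..<j})) (8 * Suc n) y" by (rule G(2)) simp_all
    moreover have "\<forall>\<^sub>F y in G. cmod (\<phi> (proj y, 0) - L) < ?r n" using tendstoD[OF \<phi>(2), of "?r n"] by (simp add: dist_norm)
    ultimately have "\<forall>\<^sub>F y in G. ?Q n f j y" by (rule eventually_conj)
    then show "\<exists>y. ?Q n f j y" using eventually_happens'[OF G(1)] by blast
  qed
  then have "\<forall>n. \<exists>f. \<forall>j::nat. ?Q n f j (f j)" by (rule allI)
  then have "\<exists>f. \<forall>n. \<forall>j::nat. ?Q n (f n) j (f n j)" by (rule choice)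
  then obtain f :: "nat \<Rightarrow> nat \<Rightarrow> 'a \<times> nat" where f: "\<And>n j. absorbing (?r n) (insert a ((\<lambda>i. fst (f n i)) ` {..<j})) (8 * Suc n) (f n j)"
    and fL: "\<And>n j. cmod (\<phi> (proj (f n j), 0) - L) < ?r n"
    by blast
  define q where "q j n = proj (f n j)" for j n
  define X where "X n = (q 0 n * a * q 1 n + s *\<^sub>C (q 0 n * q 1 n) - \<alpha> *\<^sub>C q 7 n, \<alpha>)" for n
  have act_X: "act (X n) c = q 0 n * (a * (q 1 n * c) + s *\<^sub>C (q 1 n * c)) + \<alpha> *\<^sub>C (c - q 7 n * c)" for n c
    by (simp add: act_def X_def distrib_right distrib_left left_diff_distrib mult.assoc mult_scaleC_left mult_scaleC_right scaleC_diff_right)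
  \<comment> \<open>\<open>key_bound\<close> speaks of vectors \<open>c n\<close>. Those on which
    the multiplier \<open>X n\<close> nearly attains its norm are chosen now, before the top level,
    which has to fix them.\<close>
  have "\<exists>c. norm c \<le> 1 \<and> N (X n) - ?r n < norm (act (X n) c)" for n
  proof -
    have "N (X n) - ?r n < Sup {norm (act (X n) c) | c. norm c \<le> 1}" by (simp add: N_eq[symmetric])
    then obtain y where "y \<in> {norm (act (X n) c) | c. norm c \<le> 1}" "N (X n) - ?r n < y"
    proof (rule less_cSupE)
      show "{norm (act (X n) c) | c. norm c \<le> 1} \<noteq> {}" by (auto intro: exI[of _ 0])
    qed blast
    then show ?thesis by blast
  qed
  then have "\<forall>n. \<exists>c. norm c \<le> 1 \<and> N (X n) - ?r n < norm (act (X n) c)" by (rule allI)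
  then have "\<exists>c. \<forall>n. norm (c n) \<le> 1 \<and> N (X n) - ?r n < norm (act (X n) (c n))" by (rule choice)
  then obtain c where c: "\<And>n. norm (c n) \<le> 1" "\<And>n. N (X n) - ?r n < norm (act (X n) (c n))" by blast
  obtain T where ch: "chain p M \<pi> (\<lambda>k n. if k = 8 then T n else fst (f n k)) (\<lambda>k n. snd (f n k)) (\<lambda>n. exp (24 / real (Suc n)))"
    and Tc: "(\<lambda>n. T n * c n) \<simeq> c"
    using chain_exists[where f = f and a = a and c = c, OF p2 c(1) f] by blast
  interpret C: chain p M \<pi> "\<lambda>k n. if k = 8 then T n else fst (f n k)" "\<lambda>k n. snd (f n k)" "\<lambda>n. exp (24 / real (Suc n))"
    by (rule ch)
  have P: "C.P k n = q k n" if "k \<noteq> 8" for k n using that by (simp add: C.P_def q_def proj_def)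
  have asz: "norm (a * z + s *\<^sub>C z) \<le> norm z" for z
    using order_trans[OF N_upper[of "(a, s)" z] mult_right_mono[OF x norm_ge_zero]] by (simp add: act_def)
  have bound: "\<forall>\<^sub>F n in sequentially. N (X n) < 1 + \<epsilon> + ?r n" if e: "0 < \<epsilon>" for \<epsilon>
  proof -
    have "\<forall>\<^sub>F n in sequentially. norm (C.P 0 n * (a * (C.P 1 n * c n) + s *\<^sub>C (C.P 1 n * c n)) + \<alpha> *\<^sub>C (c n - C.P 7 n * c n)) \<le> 1 + \<epsilon>"
      using Tc by (intro C.key_bound c asz \<alpha> e) simp
    then show ?thesis
    proof eventually_elim
      case (elim n)
      then have "norm (act (X n) (c n)) \<le> 1 + \<epsilon>" by (simp add: act_X P)
      then show ?case using c(2)[of n] by linarith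
    qed
  qed
  have qn: "norm (q j n) \<le> exp 4" for j n
    unfolding q_def by (rule proj_norm[OF f]) simp
  have fn: "norm (fst (f n k)) \<le> 1" for n k using f[of n k] by (simp add: absorbing_def near_hermitian_def)
  have rot: "rotations (\<lambda>n. fst (f n k)) (\<lambda>n. snd (f n k))" for k
    by unfold_locales (rule fn C.m)+
  have asymI: "x \<simeq> y" if "\<And>n. norm (x n - y n) \<le> ?r n" for x y :: "nat \<Rightarrow> 'a"
    unfolding asym_eq_iff by (rule Lim_null_comparison[OF always_eventually[OF allI[OF that]] small])
  have fa: "norm (fst (f n j) * a - a) \<le> ?r n" "norm (a * fst (f n j) - a) \<le> ?r n" for n j
    using f[of n j] by (auto simp: absorbing_def)
  \<comment> \<open>If \<open>1 + E\<close> acts as \<open>-1\<close>, then \<open>E\<close> acts as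
    \<open>-2\<close>, so \<open>proj\<close> acts as the identity.\<close>
  have half: "(\<lambda>n. (- 1 / 2) *\<^sub>C y n) \<simeq> z" if "(\<lambda>n. z n + y n) \<simeq> (\<lambda>n. (- 1) *\<^sub>C z n)" for y z :: "nat \<Rightarrow> 'a"
  proof -
    have "(\<lambda>n. (- 1 / 2) *\<^sub>C ((z n + y n) - z n)) \<simeq> (\<lambda>n. (- 1 / 2) *\<^sub>C ((- 1) *\<^sub>C z n - z n))"
      by (intro asym_scaleC asym_diff that asym_refl)
    moreover have "(- 1 / 2) *\<^sub>C ((- 1) *\<^sub>C z n - z n) = z n" for n
      by (simp add: scaleC_diff_right scaleC_scaleC flip: scaleC_diff_left) (simp add: scaleC_minus_left scaleC_one flip: scaleC_add_left)
    ultimately show ?thesis by simp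
  qed
  have q0a: "(\<lambda>n. q 0 n * a) \<simeq> (\<lambda>n. a)"
    using half[OF rotations.E_low[OF rot[of 0], where c = "\<lambda>_. a" and C = "norm a" and u = "- 1"]] asymI[OF fa(1)]
    by (simp add: q_def proj_def mult_scaleC_left)
  have aq1: "(\<lambda>n. a * q 1 n) \<simeq> (\<lambda>n. a)"
    using half[OF rotations.E_low_right[OF rot[of 1], where c = "\<lambda>_. a" and C = "norm a" and u = "- 1"]] asymI[OF fa(2)]
    by (simp add: q_def proj_def mult_scaleC_right)
  have l1: "(\<lambda>n. q 0 n * a * q 1 n) \<simeq> (\<lambda>n. a)"
    by (rule asym_trans[OF asym_mult_right[OF q0a qn] aq1])
  have l2: "(\<lambda>n. q 0 n * q 1 n) \<simeq> q 0"
  proof -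
    have h01: "(\<lambda>n. fst (f n 0) * fst (f n 1)) \<simeq> (\<lambda>n. fst (f n 0))"
      using C.down[of 0 1] by simp
    have e: "(\<lambda>n. rot (- 1) (fst (f n 0)) (snd (f n 0)) * fst (f n 1)) \<simeq> (\<lambda>n. rot (- 1) (fst (f n 0)) (snd (f n 0)))"
      by (rule rotations.E_absorbed_right[OF rot h01])
    have q01: "(\<lambda>n. q 0 n * fst (f n 1)) \<simeq> q 0"
      using asym_scaleC[OF e, of "- 1 / 2"] by (simp add: q_def[abs_def] proj_def mult_scaleC_left)
    have "(\<lambda>n. (- 1 / 2) *\<^sub>C (q 0 n * rot (- 1) (fst (f n 1)) (snd (f n 1)))) \<simeq> q 0"
      by (intro half rotations.E_low_right[OF rot[of 1] q01 qn]) simp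
    then show ?thesis by (simp add: q_def proj_def mult_scaleC_right)
  qed
  define D where "D = dual_norm UNIV N \<phi>"
  have D0: "0 \<le> D" unfolding D_def by (rule dual_norm_nonneg[OF N_cseminorm \<phi>(1)])
  have lin: "clinear_on UNIV \<phi>" using \<phi>(1) by (simp add: dual_UNIV_iff)
  have \<phi>_fst: "\<phi> (x + y, 0) = \<phi> (x, 0) + \<phi> (y, 0)" "\<phi> (x - y, 0) = \<phi> (x, 0) - \<phi> (y, 0)" "\<phi> (r *\<^sub>C x, 0) = r * \<phi> (x, 0)" for x y r
    using clinear_on_add[OF lin, of "(x, 0)" "(y, 0)"] clinear_on_diff[OF lin, of "(x, 0)" "(y, 0)"] clinear_on_scale[OF lin, of r "(x, 0)"]
    by simp_all
  have cont: "(\<lambda>n. \<phi> (y n, 0) - \<phi> (z n, 0)) \<longlonglongrightarrow> 0" if "y \<simeq> z" for y z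
  proof (rule Lim_null_comparison)
    show "(\<lambda>n. D * norm (y n - z n)) \<longlonglongrightarrow> 0"
      using that tendsto_mult_left[of "\<lambda>n. norm (y n - z n)" 0 sequentially D] by (simp add: asym_eq_def)
    show "\<forall>\<^sub>F n in sequentially. norm (\<phi> (y n, 0) - \<phi> (z n, 0)) \<le> D * norm (y n - z n)"
      using dual_fst_le[OF \<phi>(1)] by (intro always_eventually allI) (simp add: \<phi>_fst(2)[symmetric] D_def)
  qed
  have qL: "(\<lambda>n. \<phi> (q j n, 0) - L) \<longlonglongrightarrow> 0" for j
    by (rule Lim_null_comparison[OF _ small]) (use fL in \<open>auto simp: q_def intro!: always_eventually less_imp_le\<close>)
  have "(\<lambda>n. (\<phi> (a, 0) + s * L + \<alpha> * (\<phi> (0, 1) - L)) + (\<phi> (q 0 n * a * q 1 n, 0) - \<phi> (a, 0))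
     + s * ((\<phi> (q 0 n * q 1 n, 0) - \<phi> (q 0 n, 0)) + (\<phi> (q 0 n, 0) - L)) - \<alpha> * (\<phi> (q 7 n, 0) - L))
     \<longlonglongrightarrow> (\<phi> (a, 0) + s * L + \<alpha> * (\<phi> (0, 1) - L)) + 0 + s * (0 + 0) - \<alpha> * 0"
    by (intro tendsto_add tendsto_diff tendsto_mult tendsto_const qL cont l1 l2)
  moreover have "(\<phi> (a, 0) + s * L + \<alpha> * (\<phi> (0, 1) - L)) + (\<phi> (q 0 n * a * q 1 n, 0) - \<phi> (a, 0))
     + s * ((\<phi> (q 0 n * q 1 n, 0) - \<phi> (q 0 n, 0)) + (\<phi> (q 0 n, 0) - L)) - \<alpha> * (\<phi> (q 7 n, 0) - L) = \<phi> (X n)" for n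
    unfolding X_def dual_split[OF \<phi>(1), of _ \<alpha>] \<phi>_fst by (simp add: algebra_simps)
  ultimately have lim: "(\<lambda>n. cmod (\<phi> (X n))) \<longlonglongrightarrow> cmod (\<phi> (a, 0) + s * L + \<alpha> * (\<phi> (0, 1) - L))"
    by (intro tendsto_norm) simp
  show ?thesis
    unfolding D_def[symmetric]
  proof (rule field_le_epsilon)
    fix \<epsilon> :: real assume e: "0 < \<epsilon>"
    define \<epsilon>' where "\<epsilon>' = \<epsilon> / (2 * (D + 1))"
    have e': "0 < \<epsilon>'" "D * (2 * \<epsilon>') \<le> \<epsilon>" using e D0 by (auto simp: \<epsilon>'_def field_simps)
    have "\<forall>\<^sub>F n in sequentially. ?r n < \<epsilon>'" by (rule order_tendstoD(2)[OF small e'(1)])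
    then have "\<forall>\<^sub>F n in sequentially. cmod (\<phi> (X n)) \<le> D + \<epsilon>"
      using bound[OF e'(1)]
    proof eventually_elim
      case (elim n)
      have "cmod (\<phi> (X n)) \<le> D * N (X n)" unfolding D_def by (rule dual_norm_upper[OF N_cseminorm \<phi>(1)])
      also have "\<dots> \<le> D * (1 + 2 * \<epsilon>')" using elim D0 by (intro mult_left_mono) auto
      also have "\<dots> \<le> D + \<epsilon>" using e'(2) by (simp add: algebra_simps)
      finally show ?case .
    qed
    then show "cmod (\<phi> (a, 0) + s * L + \<alpha> * (\<phi> (0, 1) - L)) \<le> D + \<epsilon>"
      by (rule tendsto_upperbound[OF lim]) simp
  qed
qed

lemma scaled_imp_M_ideal:
  assumes p2: "p \<noteq> 2" and scaled: "scaled TYPE('a)"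
  shows "M_ideal UNIV N (range (\<lambda>a. (a, 0)))"
proof -
  let ?D = "dual UNIV N" and ?n = "dual_norm UNIV N"
  obtain G\<^sub>0 where G0: "G\<^sub>0 \<noteq> bot" "\<And>\<delta> S k. 0 < \<delta> \<Longrightarrow> finite S \<Longrightarrow> \<forall>\<^sub>F x in G\<^sub>0. absorbing \<delta> S k x"
    using absorbing_filter scaled_imp_Im_tendsto_0[OF scaled] by blast
  \<comment> \<open>All functionals are treated in one product space so that a single filter serves
    every \<open>\<phi>\<close>; this makes \<open>\<Lambda>\<close> linear. The value 0 outside the
    dual space provides a bound at every index.\<close>
  define \<Theta> where "\<Theta> x \<phi> = (if \<phi> \<in> ?D then \<phi> (proj x, 0) else 0)" for x and \<phi> :: "'a \<times> complex \<Rightarrow> complex"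
  define B where "B \<phi> = (if \<phi> \<in> ?D then ?n \<phi> * exp 4 else 0)" for \<phi>
  have "\<forall>\<^sub>F x in G\<^sub>0. absorbing 1 {} 1 x" by (rule G0(2)) simp_all
  then have "\<forall>\<^sub>F x in G\<^sub>0. \<forall>\<phi>. cmod (\<Theta> x \<phi>) \<le> B \<phi>"
  proof eventually_elim
    case (elim x)
    then have px: "norm (proj x) \<le> exp 4" by (rule proj_norm) simp
    have "cmod (\<phi> (proj x, 0)) \<le> ?n \<phi> * exp 4" if "\<phi> \<in> ?D" for \<phi>
      by (rule order_trans[OF dual_fst_le[OF that] mult_left_mono[OF px dual_norm_nonneg[OF N_cseminorm that]]])
    then show ?case by (simp add: \<Theta>_def B_def)
  qed
  then obtain G \<Lambda> where G: "G \<le> G\<^sub>0" "G \<noteq> bot" and lim: "\<And>\<phi>. ((\<lambda>x. \<Theta> x \<phi>) \<longlongrightarrow> \<Lambda> \<phi>) G"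
    using simultaneous_limits[OF G0(1)] by blast
  have G_absorbing: "\<forall>\<^sub>F x in G. absorbing \<delta> S k x" if "0 < \<delta>" "finite S" for \<delta> S k
    using filter_leD[OF G(1) G0(2)[OF that]] .
  have \<Lambda>: "((\<lambda>x. \<phi> (proj x, 0)) \<longlongrightarrow> \<Lambda> \<phi>) G" if "\<phi> \<in> ?D" for \<phi>
    using lim[of \<phi>] that by (simp add: \<Theta>_def)
  have \<Lambda>_add: "\<Lambda> (\<phi> + \<psi>) = \<Lambda> \<phi> + \<Lambda> \<psi>" if "\<phi> \<in> ?D" "\<psi> \<in> ?D" for \<phi> \<psi>
    using tendsto_unique[OF G(2) \<Lambda>[OF dual_add[OF that]]] tendsto_add[OF \<Lambda>[OF that(1)] \<Lambda>[OF that(2)]] by simp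
  have \<Lambda>_scale: "\<Lambda> (s *\<^sub>C \<phi>) = s * \<Lambda> \<phi>" if "\<phi> \<in> ?D" for s \<phi>
    using tendsto_unique[OF G(2) \<Lambda>[OF dual_scaleC[OF that]]] tendsto_mult[OF tendsto_const \<Lambda>[OF that], of s] by simp
  have snd_dual: "snd \<in> ?D" "?n snd = 1" by (rule state_dual[OF character_state])+
  have \<Lambda>_snd: "\<Lambda> snd = 0"
    using tendsto_unique[OF G(2) \<Lambda>[OF snd_dual(1)]] by simp
  define f where "f \<phi> = \<phi> (0, 1) - \<Lambda> \<phi>" for \<phi>
  define P where "P \<phi> = f \<phi> *\<^sub>C (snd :: 'a \<times> complex \<Rightarrow> complex)" for \<phi>
  have f_add: "f (\<phi> + \<psi>) = f \<phi> + f \<psi>" if "\<phi> \<in> ?D" "\<psi> \<in> ?D" for \<phi> \<psi>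
    using \<Lambda>_add[OF that] by (simp add: f_def)
  have f_scale: "f (s *\<^sub>C \<phi>) = s * f \<phi>" if "\<phi> \<in> ?D" for s \<phi>
    using \<Lambda>_scale[OF that] by (simp add: f_def algebra_simps)
  have f_snd: "f (s *\<^sub>C snd) = s" for s using f_scale[OF snd_dual(1)] \<Lambda>_snd by (simp add: f_def)
  have PD: "P \<phi> \<in> ?D" for \<phi> unfolding P_def by (rule dual_scaleC[OF snd_dual(1)])
  have nP: "?n (P \<phi>) = cmod (f \<phi>)" for \<phi>
    unfolding P_def dual_norm_scaleC[OF snd_dual(1)] snd_dual(2) by simp
  have tri: "?n (\<phi> + \<psi>) \<le> ?n \<phi> + ?n \<psi>" if "\<phi> \<in> ?D" "\<psi> \<in> ?D" for \<phi> \<psi>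
  proof (rule dual_norm_least[OF N_cseminorm])
    show "0 \<le> ?n \<phi> + ?n \<psi>" using dual_norm_nonneg[OF N_cseminorm] that by (intro add_nonneg_nonneg)
    show "cmod ((\<phi> + \<psi>) x) \<le> (?n \<phi> + ?n \<psi>) * N x" for x
      unfolding distrib_right plus_fun_apply
      by (intro order_trans[OF norm_triangle_ineq] add_mono dual_norm_upper[OF N_cseminorm] that)
  qed
  have key: "cmod (f \<phi>) + ?n (\<phi> - P \<phi>) \<le> ?n \<phi>" if \<phi>: "\<phi> \<in> ?D" for \<phi>
  proof -
    have "?n (\<phi> - P \<phi>) \<le> ?n \<phi> - cmod (f \<phi>)"
      unfolding dual_norm_def[of UNIV N "\<phi> - P \<phi>"]
    proof (rule cSup_least)
      show "{cmod ((\<phi> - P \<phi>) x) |x. x \<in> UNIV \<and> N x \<le> 1} \<noteq> {}"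
      proof -
        have "N 0 \<le> 1" by (simp add: cseminorm_0[OF N_cseminorm])
        then show ?thesis by blast
      qed
      fix y assume "y \<in> {cmod ((\<phi> - P \<phi>) x) |x. x \<in> UNIV \<and> N x \<le> 1}"
      then obtain x where x: "y = cmod ((\<phi> - P \<phi>) x)" "N x \<le> 1" by blast
      have unrot: "cnj (sgn z) * z = cmod z" for z :: complex
        using mult_dmap[of z 1] by (simp add: dmap_def mult.commute split: if_splits)
      \<comment> \<open>The phase \<open>u\<close> is absorbed into the point \<open>x\<close>, and
        \<open>\<alpha>\<close> makes the term with \<open>f \<phi>\<close> nonnegative, so that in
        \<open>contraction_sequence\<close> the two parts of \<open>\<phi>\<close> add up in
        modulus.\<close>
      define u where "u = cnj (sgn ((\<phi> - P \<phi>) x))"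
      define \<alpha> where "\<alpha> = cnj (sgn (f \<phi>))"
      have u: "cmod u \<le> 1" and \<alpha>: "cmod \<alpha> \<le> 1" by (simp_all add: u_def \<alpha>_def norm_sgn)
      obtain a s where as: "u *\<^sub>C x = (a, s)" by (cases "u *\<^sub>C x")
      have "N (a, s) = cmod u * N x" unfolding as[symmetric] by (rule cseminorm_scale[OF N_cseminorm])
      also have "\<dots> \<le> 1 * 1" by (intro mult_mono u x cseminorm_nonneg[OF N_cseminorm]) simp
      finally have Nas: "N (a, s) \<le> 1" by simp
      have D: "\<phi> - P \<phi> \<in> ?D" by (intro dual_diff \<phi> PD)
      then have lin: "clinear_on UNIV (\<phi> - P \<phi>)" by (simp add: dual_UNIV_iff)
      have "complex_of_real y = u * (\<phi> - P \<phi>) x" unfolding x(1) u_def by (rule unrot[symmetric])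
      also have "\<dots> = (\<phi> - P \<phi>) (a, s)" unfolding as[symmetric] clinear_on_scale[OF lin] by simp
      also have "\<dots> = \<phi> (a, 0) + s * \<Lambda> \<phi>"
        using dual_split[OF \<phi>, of a s] by (simp add: P_def f_def algebra_simps)
      finally have y: "complex_of_real y = \<phi> (a, 0) + s * \<Lambda> \<phi>" .
      have "\<alpha> * (\<phi> (0, 1) - \<Lambda> \<phi>) = cmod (f \<phi>)" unfolding \<alpha>_def f_def by (rule unrot)
      then have "\<phi> (a, 0) + s * \<Lambda> \<phi> + \<alpha> * (\<phi> (0, 1) - \<Lambda> \<phi>) = complex_of_real (y + cmod (f \<phi>))"
        using y by simp
      then have "cmod (complex_of_real (y + cmod (f \<phi>))) \<le> ?n \<phi>"
        using contraction_sequence[OF p2 G(2) G_absorbing \<phi> \<Lambda>[OF \<phi>] Nas \<alpha>] by simp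
      then show "y \<le> ?n \<phi> - cmod (f \<phi>)" unfolding norm_of_real by linarith
    qed
    then show ?thesis by simp
  qed
  have "L_projection ?D ?n P"
    unfolding L_projection_def bounded_operator_on_def
  proof (intro conjI ballI)
    show "clinear_on ?D P"
      unfolding clinear_on_def
      by (simp add: P_def f_add f_scale scaleC_add_left scaleC_scaleC)
    show "P ` ?D \<subseteq> ?D" using PD by blast
    show "\<exists>K. \<forall>\<phi>\<in>?D. ?n (P \<phi>) \<le> K * ?n \<phi>"
    proof (intro exI ballI)
      fix \<phi> assume \<phi>: "\<phi> \<in> ?D"
      show "?n (P \<phi>) \<le> 1 * ?n \<phi>"
        using key[OF \<phi>] dual_norm_nonneg[OF N_cseminorm dual_diff[OF \<phi> PD, of \<phi>]] unfolding nP by linarith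
    qed
    show "P (P \<phi>) = P \<phi>" for \<phi> by (simp add: P_def f_snd)
    show "?n \<phi> = ?n (P \<phi>) + ?n (\<phi> - P \<phi>)" if \<phi>: "\<phi> \<in> ?D" for \<phi>
    proof -
      have "P \<phi> + (\<phi> - P \<phi>) = \<phi>" by simp
      then have "?n \<phi> \<le> ?n (P \<phi>) + ?n (\<phi> - P \<phi>)" using tri[OF PD dual_diff[OF \<phi> PD], of \<phi> \<phi>] by (simp only:)
      then show ?thesis using key[OF \<phi>] unfolding nP by linarith
    qed
  qed
  moreover have "annihilator UNIV N (range (\<lambda>a. (a, 0))) = P ` ?D"
  proof (intro set_eqI iffI)
    fix \<phi> assume "\<phi> \<in> annihilator UNIV N (range (\<lambda>a. (a, 0)))"
    then obtain s where "\<phi> = s *\<^sub>C snd" using annihilator_iff by blast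
    then have "\<phi> = P \<phi>" "\<phi> \<in> ?D" using f_snd dual_scaleC[OF snd_dual(1)] by (simp_all add: P_def)
    then show "\<phi> \<in> P ` ?D" by blast
  next
    fix \<phi> assume "\<phi> \<in> P ` ?D"
    then show "\<phi> \<in> annihilator UNIV N (range (\<lambda>a. (a, 0)))" using annihilator_iff by (auto simp: P_def)
  qed
  moreover have "csubspace (range (\<lambda>a. (a :: 'a, 0 :: complex)))"
    by (auto simp: csubspace_def zero_prod_def)
  moreover have "norm_closed_in UNIV N (range (\<lambda>a. (a, 0)))"
    unfolding norm_closed_in_def
  proof (intro ballI impI)
    fix x :: "'a \<times> complex" assume near: "\<forall>\<epsilon>>0. \<exists>y\<in>range (\<lambda>a. (a, 0)). N (x - y) < \<epsilon>"
    have "cmod (snd x) \<le> \<epsilon>" if "0 < \<epsilon>" for \<epsilon>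
    proof -
      obtain a where "N (x - (a, 0)) < \<epsilon>" using near \<open>0 < \<epsilon>\<close> by blast
      moreover have "x - (a, 0) = (fst x - a, snd x)" by (simp add: prod_eq_iff)
      ultimately show ?thesis using N_snd[of "snd x" "fst x - a"] by simp
    qed
    then have "cmod (snd x) \<le> 0" using field_le_epsilon[of "cmod (snd x)" 0] by simp
    then have "x = (fst x, 0)" by (simp add: prod_eq_iff)
    then have "x \<in> range (\<lambda>a. (a, 0))" by (rule image_eqI) simp
    moreover have "N (x - x) = 0" by (simp only: diff_self cseminorm_0[OF N_cseminorm])
    ultimately show "\<exists>y\<in>range (\<lambda>a. (a, 0)). N (x - y) = 0" by blast
  qed
  ultimately show ?thesis unfolding M_ideal_def L_summand_def by blast
qed

lemma scaled_iff_M_approximately_unital: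
  assumes "p \<noteq> 2"
  shows "scaled TYPE('a) \<longleftrightarrow> M_approximately_unital TYPE('a)"
proof -
  have "approximately_unital TYPE('a)" using cai by (auto simp: approximately_unital_def)
  then show ?thesis
    using scaled_imp_M_ideal[OF assms] M_ideal_imp_scaled
    by (auto simp: M_approximately_unital_def unitization_eq)
qed

end

section \<open>Degenerate cases and the theorem\<close>

text \<open>Here the unitization is the algebra itself, so its annihilator is trivial and 0 is the
  required \<open>L\<close>-projection.\<close>

lemma unital_imp_M_approximately_unital:
  assumes u: "unital TYPE('a::complex_banach_algebra)" and a: "approximately_unital TYPE('a)"
  shows "M_approximately_unital TYPE('a)"
proof -
  let ?E = "unitization :: ('a \<times> complex) set" and ?N = "unitization_norm :: 'a \<times> complex \<Rightarrow> real"
  let ?D = "dual ?E ?N" and ?n = "dual_norm ?E ?N"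
  have E: "?E = range (\<lambda>a. (a, 0))" using u by (auto simp: unitization_def)
  have N0: "?N (0, 0) = 0" using u by (simp add: unitization_norm_def)
  have zero: "(\<lambda>_. 0) \<in> ?D" by (auto simp: dual_def clinear_on_def intro!: exI[of _ 0])
  have n0: "?n (\<lambda>_. 0) = 0"
  proof -
    have "\<exists>x. x \<in> ?E \<and> ?N x \<le> 1" using E N0 by (intro exI[of _ "(0, 0)"]) auto
    then have "{cmod 0 |x. x \<in> ?E \<and> ?N x \<le> 1} = {0}" by auto
    then show ?thesis by (simp add: dual_norm_def)
  qed
  have "annihilator ?E ?N ?E = {\<lambda>_. 0}"
  proof (intro set_eqI iffI)
    fix \<phi> assume \<phi>: "\<phi> \<in> annihilator ?E ?N ?E"
    have "x \<notin> ?E \<longrightarrow> \<phi> x = 0" "x \<in> ?E \<longrightarrow> \<phi> x = 0" for x using \<phi> unfolding annihilator_def dual_def by blast+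
    then have "\<phi> x = 0" for x by blast
    then show "\<phi> \<in> {\<lambda>_. 0}" by auto
  qed (use zero in \<open>auto simp: annihilator_def\<close>)
  moreover have "(\<lambda>_. (\<lambda>_. 0) :: 'a \<times> complex \<Rightarrow> complex) ` ?D = {\<lambda>_. 0}" using zero by blast
  moreover have "L_projection ?D ?n (\<lambda>_ _. 0)"
    using zero n0
    by (auto simp: L_projection_def bounded_operator_on_def clinear_on_def fun_eq_iff plus_fun_def scaleC_fun_def fun_diff_def
        intro!: exI[of _ 0])
  ultimately have "L_summand ?D ?n (annihilator ?E ?N ?E)" unfolding L_summand_def by metis
  moreover have "csubspace ?E" unfolding E by (auto simp: csubspace_def zero_prod_def)
  moreover have "norm_closed_in ?E ?N ?E"
    unfolding norm_closed_in_def using N0 by (auto simp: zero_prod_def[symmetric] intro!: bexI)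
  ultimately have "M_ideal ?E ?N ?E" by (simp add: M_ideal_def)
  then show ?thesis using a E by (simp add: M_approximately_unital_def)
qed

text \<open>The multiplier seminorm vanishes identically, so the dual space is trivial: there are no
  states, both sets compared by scaledness are empty, and the identity is the required
  \<open>L\<close>-projection.\<close>

lemma zero_algebra_case:
  assumes z: "\<And>a::'a::complex_banach_algebra. a = 0" and a: "approximately_unital TYPE('a)"
  shows "scaled TYPE('a)" and "M_approximately_unital TYPE('a)"
proof -
  let ?E = "unitization :: ('a \<times> complex) set" and ?N = "unitization_norm :: 'a \<times> complex \<Rightarrow> real"
  let ?D = "dual ?E ?N" and ?n = "dual_norm ?E ?N"
  have nu: "\<not> unital TYPE('a)"
    unfolding unital_def is_unit_elem_def using z by (metis norm_zero zero_neq_one)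
  have E: "?E = UNIV" using nu by (simp add: unitization_def)
  have N0: "?N x = 0" for x
  proof -
    have "{norm (fst x * c + snd x *\<^sub>C c) | c :: 'a. norm c \<le> 1} = {0}"
      using z[of "fst x * c + snd x *\<^sub>C c" for c] by (auto intro!: exI[of _ 0])
    then show ?thesis using nu by (simp add: unitization_norm_def)
  qed
  have D: "?D = {\<lambda>_. 0}" by (auto simp: dual_def E N0 clinear_on_def fun_eq_iff)
  have n0: "?n (\<lambda>_. 0) = 0" by (simp add: dual_norm_def E N0)
  have "(unitization_states :: ('a \<times> complex \<Rightarrow> complex) set) = {}"
    using n0 by (auto simp: unitization_states_def D)
  then have r: "(restricted_states :: ('a \<Rightarrow> complex) set) = {}" by (simp add: restricted_states_def)
  then show "scaled TYPE('a)" by (auto simp: scaled_def quasistates_def states_def)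
  have "annihilator ?E ?N (range (\<lambda>a. (a, 0))) = {\<lambda>_. 0}" by (auto simp: annihilator_def D)
  moreover have "L_projection ?D ?n id"
    unfolding L_projection_def bounded_operator_on_def clinear_on_def D zero_fun_def[symmetric]
    using n0 by (auto simp: zero_fun_def[symmetric] intro!: exI[of _ 0])
  ultimately have "L_summand ?D ?n (annihilator ?E ?N (range (\<lambda>a. (a, 0))))" unfolding L_summand_def
    using D by (metis image_id id_apply)
  moreover have "csubspace (range (\<lambda>a. (a :: 'a, 0 :: complex)))" by (auto simp: csubspace_def zero_prod_def)
  ultimately have "M_ideal ?E ?N (range (\<lambda>a. (a, 0)))"
    by (simp add: M_ideal_def norm_closed_in_def N0 E)
  then show "M_approximately_unital TYPE('a)" using a by (simp add: M_approximately_unital_def)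
qed

section \<open>From the definition of an operator algebra on L^p to the locale of
  representations\<close>

lemma Lp_space_iff: "f \<in> Lp_space p M \<longleftrightarrow> Lp_fun p M f"
  by (simp add: Lp_space_def Lp_fun_def)

lemma Lp_norm_eq: "Lp_norm p M f = Lp_int p M f powr (1 / p)"
  by (simp add: Lp_norm_def Lp_int_def)

lemma Lp_norm_le_iff:
  assumes "0 < p" "0 \<le> r"
  shows "Lp_norm p M f \<le> r \<longleftrightarrow> Lp_int p M f \<le> r powr p"
proof
  assume "Lp_norm p M f \<le> r"
  then have "(Lp_int p M f powr (1 / p)) powr p \<le> r powr p"
    unfolding Lp_norm_eq using assms by (intro powr_mono2) auto
  then show "Lp_int p M f \<le> r powr p" using assms by (simp add: powr_powr Lp_int_nonneg)
next
  assume "Lp_int p M f \<le> r powr p"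
  then have "Lp_int p M f powr (1 / p) \<le> (r powr p) powr (1 / p)"
    using assms by (intro powr_mono2) (auto simp: Lp_int_nonneg)
  then show "Lp_norm p M f \<le> r" using assms by (simp add: Lp_norm_eq powr_powr)
qed

lemma Lp_representation_of_isometric_isomorphism:
  fixes \<pi> :: "'a::complex_banach_algebra \<Rightarrow> 'b fun_op"
  assumes p: "1 < p" and B: "Lp_closed_subalgebra p M B" and iso: "isometric_isomorphism_onto p M B \<pi>"
  shows "Lp_representation p M \<pi>"
proof -
  have p0: "0 < p" using p by simp
  have "B \<subseteq> Lp_operators p M" using B unfolding Lp_closed_subalgebra_def by blast
  moreover have "\<pi> a \<in> B" for a using iso unfolding isometric_isomorphism_onto_def by blast
  ultimately have op: "\<pi> a \<in> Lp_operators p M" for a by blast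
  have in_Lp: "Lp_fun p M (\<pi> a f)" if "Lp_fun p M f" for a f
    using op[of a] that unfolding Lp_operators_def Lp_space_iff[symmetric] by blast
  have vec_add: "AE t in M. \<pi> a (f + g) t = \<pi> a f t + \<pi> a g t" if "Lp_fun p M f" "Lp_fun p M g" for a f g
    using op[of a] that unfolding Lp_operators_def Lp_space_iff[symmetric] by blast
  have "AE t in M. \<pi> a (c *\<^sub>C f) t = c * \<pi> a f t" if "Lp_fun p M f" for a c f
    using op[of a] that unfolding Lp_operators_def Lp_space_iff[symmetric] by blast
  then have scale: "AE t in M. \<pi> a (\<lambda>t. c * f t) t = c * \<pi> a f t" if "Lp_fun p M f" for a c f
    using that by (simp add: scaleC_fun_def)
  have hom: "Lp_op_eq p M (\<pi> (a + b)) (\<pi> a + \<pi> b)" "Lp_op_eq p M (\<pi> (c *\<^sub>C a)) (c *\<^sub>C \<pi> a)"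
    "Lp_op_eq p M (\<pi> (a * b)) (\<pi> a \<circ> \<pi> b)" "Lp_op_norm p M (\<pi> a) = norm a" for a b c
    using iso unfolding isometric_isomorphism_onto_def by blast+
  \<comment> \<open>The operator norm is a supremum of reals and can be used only once the set is
    known to be bounded. The constants \<open>K a\<close> ensure this and also settle the vectors of
    norm 0, which cannot be normalized.\<close>
  obtain K where K: "\<And>f. Lp_fun p M f \<Longrightarrow> Lp_norm p M (\<pi> a f) \<le> K a * Lp_norm p M f" for a
  proof -
    have "\<exists>K. \<forall>f. Lp_fun p M f \<longrightarrow> Lp_norm p M (\<pi> a f) \<le> K * Lp_norm p M f" for a
      using op[of a] unfolding Lp_operators_def Lp_space_iff[symmetric] by blast
    then have "\<forall>a. \<exists>K. \<forall>f. Lp_fun p M f \<longrightarrow> Lp_norm p M (\<pi> a f) \<le> K * Lp_norm p M f" by (rule allI)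
    then have "\<exists>K. \<forall>a f. Lp_fun p M f \<longrightarrow> Lp_norm p M (\<pi> a f) \<le> K a * Lp_norm p M f" by (rule choice)
    then show ?thesis using that by blast
  qed
  let ?S = "\<lambda>a. {Lp_norm p M (\<pi> a f) | f. f \<in> Lp_space p M \<and> Lp_norm p M f \<le> 1}"
  have Sup_S: "Sup (?S a) = norm a" for a
    using hom(4)[of a] by (simp add: Lp_op_norm_def)
  have nn: "0 \<le> Lp_norm p M f" for f :: "'b \<Rightarrow> complex" by (simp add: Lp_norm_eq)
  have bdd: "bdd_above (?S a)" for a
  proof (rule bdd_aboveI[where M = "\<bar>K a\<bar>"])
    fix y assume "y \<in> ?S a"
    then obtain f where f: "Lp_fun p M f" "Lp_norm p M f \<le> 1" "y = Lp_norm p M (\<pi> a f)" by (auto simp: Lp_space_iff)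
    have "y \<le> \<bar>K a\<bar> * Lp_norm p M f"
      unfolding f(3) by (rule order_trans[OF K[OF f(1)] mult_right_mono[OF abs_ge_self nn]])
    also have "\<dots> \<le> \<bar>K a\<bar>" using mult_left_mono[OF f(2), of "\<bar>K a\<bar>"] by simp
    finally show "y \<le> \<bar>K a\<bar>" .
  qed
  have zero: "(\<lambda>_. 0) \<in> Lp_space p M" "Lp_norm p M (\<lambda>_. 0) \<le> 1"
    using p0 by (auto simp: Lp_space_def Lp_norm_def)
  show ?thesis
  proof
    show "1 < p" by (rule p)
    show "Lp_fun p M (\<pi> a f)" if "Lp_fun p M f" for a f by (rule in_Lp[OF that])
    show "AE t in M. \<pi> a (\<lambda>t. f t + g t) t = \<pi> a f t + \<pi> a g t" if "Lp_fun p M f" "Lp_fun p M g" for a f g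
      using vec_add[OF that, of a] by (simp add: plus_fun_def)
    show "AE t in M. \<pi> a (\<lambda>t. c * f t) t = c * \<pi> a f t" if "Lp_fun p M f" for a c f by (rule scale[OF that])
    show "AE t in M. \<pi> (a + b) f t = \<pi> a f t + \<pi> b f t" if "Lp_fun p M f" for a b f
      using hom(1)[of a b] that by (simp add: Lp_op_eq_def Lp_space_iff)
    show "AE t in M. \<pi> (c *\<^sub>C a) f t = c * \<pi> a f t" if "Lp_fun p M f" for c a f
      using hom(2)[of c a] that by (simp add: Lp_op_eq_def Lp_space_iff)
    show "AE t in M. \<pi> (a * b) f t = \<pi> a (\<pi> b f) t" if "Lp_fun p M f" for a b f
      using hom(3)[of a b] that by (simp add: Lp_op_eq_def Lp_space_iff)
    show "Lp_int p M (\<pi> a f) \<le> norm a powr p * Lp_int p M f" if f: "Lp_fun p M f" for a f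
    proof (cases "Lp_int p M f = 0")
      case True
      then have "Lp_norm p M (\<pi> a f) \<le> 0" using K[OF f, of a] by (simp add: Lp_norm_eq)
      then show ?thesis using True p0 by (simp add: Lp_norm_le_iff)
    next
      case False
      then have pos: "0 < Lp_int p M f" using Lp_int_nonneg[of p M f] by simp
      define c where "c = 1 / Lp_norm p M f"
      have c: "0 < c" "c powr p * Lp_int p M f = 1"
        using pos p0 by (simp_all add: c_def Lp_norm_eq powr_divide powr_powr)
      let ?g = "\<lambda>t. complex_of_real c * f t"
      have g: "Lp_fun p M ?g" by (rule Lp_fun_mult[OF p0 f])
      have "Lp_int p M ?g = 1" using c by (simp add: Lp_int_mult)
      then have "Lp_norm p M ?g \<le> 1" by (simp add: Lp_norm_eq)
      then have "Lp_norm p M (\<pi> a ?g) \<le> norm a"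
        unfolding Sup_S[of a, symmetric] using g by (intro cSup_upper bdd) (auto simp: Lp_space_iff)
      then have "Lp_int p M (\<pi> a ?g) \<le> norm a powr p" using p0 by (simp add: Lp_norm_le_iff)
      moreover have "Lp_int p M (\<pi> a ?g) = Lp_int p M (\<lambda>t. complex_of_real c * \<pi> a f t)"
        using in_Lp[OF g, of a] Lp_fun_mult[OF p0 in_Lp[OF f, of a], of "complex_of_real c"] scale[OF f, of a "complex_of_real c"]
        by (intro Lp_int_cong_AE) (auto simp: Lp_fun_def)
      ultimately have "c powr p * Lp_int p M (\<pi> a f) \<le> norm a powr p" using c(1) by (simp add: Lp_int_mult)
      then have "Lp_int p M f * (c powr p * Lp_int p M (\<pi> a f)) \<le> Lp_int p M f * norm a powr p"
        using pos by (intro mult_left_mono) auto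
      moreover have "Lp_int p M f * (c powr p * Lp_int p M (\<pi> a f)) = Lp_int p M (\<pi> a f)"
        using c(2) by (metis mult.assoc mult.commute mult_1)
      ultimately show ?thesis by (simp add: mult.commute)
    qed
    show "\<exists>f. Lp_fun p M f \<and> Lp_int p M f \<le> 1 \<and> r powr p < Lp_int p M (\<pi> a f)" if r: "0 \<le> r" "r < norm a" for r a
    proof -
      have "r < Sup (?S a)" using r by (simp add: Sup_S)
      then obtain y where "y \<in> ?S a" "r < y"
      proof (rule less_cSupE)
        show "?S a \<noteq> {}" using zero by blast
      qed blast
      then obtain f where f: "Lp_fun p M f" "Lp_norm p M f \<le> 1" "r < Lp_norm p M (\<pi> a f)" by (auto simp: Lp_space_iff)
      have "Lp_int p M f \<le> 1" using f(2) Lp_norm_le_iff[OF p0, of 1 M f] by simp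
      moreover have "r powr p < Lp_int p M (\<pi> a f)" using f(3) Lp_norm_le_iff[OF p0 r(1), of M "\<pi> a f"] by simp
      ultimately show ?thesis using f(1) by blast
    qed
  qed
qed

theorem corollary6p3:
  fixes p :: real and M :: "'b measure"
  assumes "1 < p" and "p \<noteq> 2"
    and "Lp_operator_algebra_over p M TYPE('a::complex_banach_algebra)"
    and "approximately_unital TYPE('a)"
  shows "scaled TYPE('a) \<longleftrightarrow> M_approximately_unital TYPE('a)"
proof (cases "unital TYPE('a) \<or> (\<forall>a::'a. a = 0)")
  case True
  then show ?thesis
    using unital_imp_M_approximately_unital[OF _ assms(4)] zero_algebra_case[OF _ assms(4)]
    by (auto simp: scaled_def)
next
  case False
  obtain B and \<pi> :: "'a \<Rightarrow> 'b fun_op" where "Lp_closed_subalgebra p M B" "isometric_isomorphism_onto p M B \<pi>"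
    using assms(3) by (auto simp: Lp_operator_algebra_over_def)
  then interpret Lp_representation p M \<pi> by (rule Lp_representation_of_isometric_isomorphism[OF assms(1)])
  obtain F :: "'a filter" where "contractive_approximate_identity F"
    using assms(4) by (auto simp: approximately_unital_def)
  then interpret represented_algebra p M \<pi> F using False by unfold_locales auto
  show ?thesis by (rule scaled_iff_M_approximately_unital[OF assms(2)])
qed

end
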